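(* Let $(X_i, Y_i)_{i=1}^\infty$ be (jointly) i.i.d. random variables uniformly distributed on $(0,1)^2$. Then there exists a rate function $\omega$ such that for every pair of positive integers $n \le m$, $$\mathbb{E}\left[ Wb_{(0,1)^2,2}^2\left( \frac 1 n \sum_{i=1}^n \delta_{X_i}, \frac 1 m \sum_{i=1}^m \delta_{Y_i} \right)\right] \ge \frac{\log n}{4\pi n}\left( 1 + \frac n m - \omega(n) \right).$$
   Context: All the variables $X_1,Y_1,X_2,Y_2,\dots$ are independent. A rate function is a decreasing function $\omega$ with $\lim_{t\to\infty}\omega(t)=0$. For an open set $\Omega\subseteq\mathbb{R}^d$, $p\ge 1$, and finite positive measures $\mu,\lambda$ with finite $p$-th moment, the "boundary" optimal transport cost is $$Wb_{\Omega,p}(\mu,\lambda) = \left( \min_{\pi \in \mathcal{C}b_\Omega(\mu,\lambda)} \int_{\overline\Omega\times\overline\Omega} |x-y|^p\, d\pi(x,y) \right)^{1/p},$$ where $\mathcal{C}b_\Omega(\mu,\lambda)$ is the set of positive measures $\pi$ on $\overline\Omega\times\overline\Omega$ whose first and second marginals $\pi_1,\pi_2$ satisfy $\pi_1\llcorner\Omega = \mu\llcorner\Omega$ and $\pi_2\llcorner\Omega = \lambda\llcorner\Omega$ (restrictions to $\Omega$; the marginals are unconstrained on $\partial\Omega$). $|\cdot|$ is the Euclidean norm. *)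

theory Defs
  imports "HOL-Probability.Probability"
begin

definition rate_function :: "(real \<Rightarrow> real) \<Rightarrow> bool" where
  "rate_function \<omega> \<longleftrightarrow> antimono_on {0..} \<omega> \<and> (\<omega> \<longlongrightarrow> 0) at_top"

text \<open>
  Admissible plans are Borel measures whose underlying space is \<open>closure \<Omega> \<times> closure \<Omega>\<close>.
  Their marginals are prescribed on \<open>\<Omega>\<close> only, so mass may be exchanged freely with the
  boundary. Plans are not required to be finite: the part of a plan living on
  \<open>frontier \<Omega> \<times> frontier \<Omega>\<close> is unconstrained.
\<close>

definition boundary_couplings ::
    "'a::euclidean_space set \<Rightarrow> 'a measure \<Rightarrow> 'a measure \<Rightarrow> ('a \<times> 'a) measure set" where
  "boundary_couplings \<Omega> \<mu> \<nu> =
     {\<pi>. sets \<pi> = sets (restrict_space borel (closure \<Omega> \<times> closure \<Omega>)) \<and>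
         restrict_space (distr \<pi> borel fst) \<Omega> = restrict_space \<mu> \<Omega> \<and>
         restrict_space (distr \<pi> borel snd) \<Omega> = restrict_space \<nu> \<Omega>}"

text \<open>
  The minimum over plans is written as an infimum in \<^typ>\<open>ennreal\<close>, which presupposes neither that
  it is attained nor that plans have finite cost. For bounded open \<open>\<Omega>\<close> and finite measures the
  infimum is finite, because all mass can be sent to the boundary. If it is \<open>\<infinity>\<close> (possible only
  for unbounded \<open>\<Omega>\<close>, e.g. unequal masses on the whole space), \<^const>\<open>enn2real\<close> yields the
  conventional value \<open>0\<close>.
\<close>

definition Wb :: "'a::euclidean_space set \<Rightarrow> real \<Rightarrow> 'a measure \<Rightarrow> 'a measure \<Rightarrow> real" where
  "Wb \<Omega> p \<mu> \<nu> =
     enn2real (INF \<pi> \<in> boundary_couplings \<Omega> \<mu> \<nu>.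
       (\<integral>\<^sup>+ (x, y). ennreal (norm (x - y) powr p) \<partial>\<pi>)) powr (1 / p)"

text \<open>
  The normalised sum of Dirac masses at \<open>x 1, \<dots>, x n\<close>, encoded as the image of the uniform
  distribution on the index set; see \<open>emeasure_empirical_measure\<close> below.
\<close>

definition empirical_measure :: "nat \<Rightarrow> (nat \<Rightarrow> 'a::euclidean_space) \<Rightarrow> 'a measure" where
  "empirical_measure n x = distr (uniform_count_measure {1..n}) borel x"

lemma emeasure_empirical_measure:
  fixes x :: "nat \<Rightarrow> 'a::euclidean_space"
  assumes A: "A \<in> sets borel"
  shows "emeasure (empirical_measure n x) A =
           ennreal (1 / real n) * (\<Sum>i=1..n. emeasure (return borel (x i)) A)"
proof -
  have "emeasure (empirical_measure n x) A =
      emeasure (uniform_count_measure {1..n}) (x -` A \<inter> {1..n})"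
    unfolding empirical_measure_def using A
    by (subst emeasure_distr) (auto simp: space_uniform_count_measure sets_uniform_count_measure
        measurable_def)
  also have "\<dots> = ennreal (real (card (x -` A \<inter> {1..n})) / real n)"
    by (subst emeasure_uniform_count_measure) auto
  also have "real (card (x -` A \<inter> {1..n})) = (\<Sum>i=1..n. indicator A (x i))"
    by (simp add: indicator_def sum.If_cases Int_def vimage_def conj_commute)
  also have "ennreal ((\<Sum>i=1..n. indicator A (x i)) / real n) =
      ennreal (1 / real n) * ennreal (\<Sum>i=1..n. indicator A (x i))"
    by (subst ennreal_mult [symmetric]) (auto intro: sum_nonneg)
  also have "ennreal (\<Sum>i=1..n. indicator A (x i)) = (\<Sum>i=1..n. indicator A (x i))"
    by (subst sum_ennreal [symmetric]) (auto simp: ennreal_indicator)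
  finally show ?thesis
    using A by simp
qed

end

theory Submission
  imports Defs "HOL-Computational_Algebra.Polynomial" "HOL-Real_Asymp.Real_Asymp"
begin

text \<open>
  By weak duality, a potential \<open>f\<close> that vanishes to second order on the boundary and whose Hessian
  is at most \<open>\<tau>\<close> bounds the squared cost from below by
  \<open>2 \<integral> f d(\<mu> - \<lambda>) - (1 - \<tau>)\<^sup>-\<^sup>1 \<integral> \<bar>\<nabla>f\<bar>\<^sup>2 d\<lambda>\<close>.
  Take \<open>f = \<chi> h\<close>, where \<open>\<chi>\<close> is a cutoff and \<open>h\<close> solves \<open>-\<Delta>h = \<mu> - \<lambda>\<close> on the torus with frequencies
  truncated at \<open>N \<approx> \<surd>n / log n\<close>. Independence gives
  \<open>E \<integral> f d(\<mu> - \<lambda>) \<approx> E \<integral> \<bar>\<nabla>f\<bar>\<^sup>2 d\<lambda> \<approx> (1/n + 1/m) \<Sum>\<^sub>k 4/\<lambda>\<^sub>k\<close> with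
  \<open>\<Sum>\<^sub>k 4/\<lambda>\<^sub>k \<approx> log N / (2 \<pi>) \<approx> log n / (4 \<pi>)\<close>; the terms in which \<open>\<nabla>\<chi>\<close> occurs stay of order \<open>1/n\<close>.
  Since \<open>n / N\<^sup>2\<close> exceeds every multiple of \<open>log n\<close>, a Bernstein-type bound on a polynomially fine grid
  shows that the Hessian is small outside an event of superpolynomially small probability.
\<close>

text \<open>The natural dual potential would solve a Dirichlet problem. On the torus, however, the
  field \<open>h\<close> is stationary: its first two moments at a fixed point do not depend on the
  point, so all expectations reduce to finite Fourier sums. The boundary condition is restored by
  the cutoff alone. Its derivative multiplies the undifferentiated \<open>h\<close>, and the series
  for the variance of \<open>h\<close> converges, unlike that for the gradient; a steep cutoff
  therefore costs no logarithm. The constant rests on a coincidence of two mechanisms. In the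
  pairing only the interaction of each point with itself survives and yields the kernel at the
  origin. In the energy it is this self-interaction that vanishes, and pairs of distinct points
  yield the Dirichlet energy of the kernel. Green's identity equates both numbers, so two copies
  minus one leave one. A single \<open>\<tau>\<close> bounds the relative loss in the cutoff mass,
  in Young's inequality and in the Hessian. The cutoff and its constants are fixed before
  \<open>n\<close> grows, and all errors are compared with \<open>1 / n + 1 / m\<close>, which gives
  uniformity in \<open>m\<close>.\<close>

section \<open>Reduction to partial matchings\<close>

text \<open>
  In a partial plan, \<open>p i j\<close> is the mass matched between \<open>x i\<close> and \<open>y j\<close>; the mass of either sample
  that is left over is sent to the nearest point of the boundary.
\<close>

definition partial_plans :: "nat \<Rightarrow> nat \<Rightarrow> (nat \<Rightarrow> nat \<Rightarrow> real) set" where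
  "partial_plans n m = {p. (\<forall>i\<in>{1..n}. \<forall>j\<in>{1..m}. 0 \<le> p i j) \<and>
     (\<forall>i\<in>{1..n}. (\<Sum>j=1..m. p i j) \<le> 1 / real n) \<and>
     (\<forall>j\<in>{1..m}. (\<Sum>i=1..n. p i j) \<le> 1 / real m)}"

definition partial_cost ::
    "'a::euclidean_space set \<Rightarrow> nat \<Rightarrow> nat \<Rightarrow> (nat \<Rightarrow> nat \<Rightarrow> real) \<Rightarrow> (nat \<Rightarrow> 'a) \<Rightarrow> (nat \<Rightarrow> 'a) \<Rightarrow> real" where
  "partial_cost F n m p x y =
     (\<Sum>i=1..n. \<Sum>j=1..m. p i j * (dist (x i) (y j))\<^sup>2) +
     (\<Sum>i=1..n. (1 / real n - (\<Sum>j=1..m. p i j)) * (infdist (x i) F)\<^sup>2) +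
     (\<Sum>j=1..m. (1 / real m - (\<Sum>i=1..n. p i j)) * (infdist (y j) F)\<^sup>2)"

lemma zero_in_partial_plans: "(\<lambda>_ _. 0) \<in> partial_plans n m"
  by (simp add: partial_plans_def)

text \<open>The coupling is a finite sum of point masses. Its auxiliary endpoints on the frontier
  lie outside the open set \<open>\<Omega>\<close>, so the restricted marginals see only sample
  points, each with its row or column sum plus remainder.\<close>

lemma coupling_of_partial_plan:
  fixes \<Omega> :: "'a::euclidean_space set"
  assumes "open \<Omega>" and F: "frontier \<Omega> \<noteq> {}"
    and xs: "x ` {1..n} \<subseteq> closure \<Omega>" and ys: "y ` {1..m} \<subseteq> closure \<Omega>"
    and p: "p \<in> partial_plans n m"
  shows "\<exists>\<pi>\<in>boundary_couplings \<Omega> (empirical_measure n x) (empirical_measure m y).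
    (\<integral>\<^sup>+ (u, v). ennreal (norm (u - v) powr 2) \<partial>\<pi>) = ennreal (partial_cost (frontier \<Omega>) n m p x y)"
proof -
  have x: "\<And>i. i \<in> {1..n} \<Longrightarrow> x i \<in> closure \<Omega>" and y: "\<And>j. j \<in> {1..m} \<Longrightarrow> y j \<in> closure \<Omega>"
    using xs ys by auto
  have "\<forall>z. \<exists>b\<in>frontier \<Omega>. infdist z (frontier \<Omega>) = dist z b"
    using infdist_attains_inf[OF frontier_closed F] by metis
  then obtain b where b: "\<And>z. b z \<in> frontier \<Omega>" "\<And>z. infdist z (frontier \<Omega>) = dist z (b z)"
    by metis
  have bC: "b z \<in> closure \<Omega>" "b z \<notin> \<Omega>" for z
    using b(1)[of z] \<open>open \<Omega>\<close> by (auto simp: frontier_def interior_open)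
  \<comment> \<open>Three kinds of point masses: matched pairs, remainders of the first sample,
    remainders of the second.\<close>
  define K :: "((nat \<times> nat) + (nat + nat)) set" where "K = ({1..n} \<times> {1..m}) <+> ({1..n} <+> {1..m})"
  define q where "q = case_sum (\<lambda>(i,j). p i j) (case_sum (\<lambda>i. 1 / real n - (\<Sum>j=1..m. p i j))
     (\<lambda>j. 1 / real m - (\<Sum>i=1..n. p i j)))"
  define pt where "pt = case_sum (\<lambda>(i,j). (x i, y j)) (case_sum (\<lambda>i. (x i, b (x i))) (\<lambda>j. (b (y j), y j)))"
  let ?R = "restrict_space borel (closure \<Omega> \<times> closure \<Omega>) :: ('a \<times> 'a) measure"
  define \<pi> where "\<pi> = distr (point_measure K (\<lambda>k. ennreal (q k))) ?R pt"
  have [simp]: "finite K" by (simp add: K_def)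
  have q0: "0 \<le> q k" if "k \<in> K" for k
    using that p by (auto simp: K_def q_def partial_plans_def)
  have pt: "pt k \<in> closure \<Omega> \<times> closure \<Omega>" if "k \<in> K" for k
    using that x y bC by (auto simp: K_def pt_def)
  have ptm: "pt \<in> measurable (point_measure K (\<lambda>k. ennreal (q k))) ?R"
    using pt by (auto simp: space_restrict_space)
  have I: "nn_integral \<pi> g = ennreal (\<Sum>k\<in>K. q k * g' (pt k))"
    if g: "g \<in> borel_measurable ?R" and g': "\<And>z. g z = ennreal (g' z)" "\<And>z. 0 \<le> g' z" for g g'
  proof -
    have "nn_integral \<pi> g = (\<Sum>k\<in>K. ennreal (q k) * g (pt k))"
      unfolding \<pi>_def using g by (subst nn_integral_distr[OF ptm]) (simp_all add: nn_integral_point_measure_finite)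
    also have "\<dots> = (\<Sum>k\<in>K. ennreal (q k * g' (pt k)))"
      by (intro sum.cong refl) (simp add: g' q0 ennreal_mult)
    also have "\<dots> = ennreal (\<Sum>k\<in>K. q k * g' (pt k))"
      by (intro sum_ennreal) (simp add: g' q0)
    finally show ?thesis .
  qed
  have sumK: "(\<Sum>k\<in>K. g k) = (\<Sum>i=1..n. \<Sum>j=1..m. g (Inl (i,j))) + ((\<Sum>i=1..n. g (Inr (Inl i))) + (\<Sum>j=1..m. g (Inr (Inr j))))"
    for g :: "_ \<Rightarrow> real"
    unfolding K_def by (subst sum.Plus, simp, simp, subst sum.Plus) (simp_all add: sum.cartesian_product case_prod_unfold)
  have sets: "sets \<pi> = sets ?R" by (simp add: \<pi>_def)
  have fm: "fst \<in> borel_measurable ?R" "snd \<in> borel_measurable ?R"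
    by (auto intro!: measurable_restrict_space1 borel_measurable_continuous_onI continuous_intros)
  have marg: "restrict_space (distr \<pi> borel f) \<Omega> = restrict_space (empirical_measure l z) \<Omega>"
    if f: "f \<in> borel_measurable ?R" and
       *: "\<And>A. A \<subseteq> \<Omega> \<Longrightarrow> (\<Sum>k\<in>K. q k * indicator A (f (pt k))) = (\<Sum>i=1..l. 1 / real l * indicator A (z i))"
       for f :: "'a \<times> 'a \<Rightarrow> 'a" and l z
  proof (rule measure_eqI)
    show "sets (restrict_space (distr \<pi> borel f) \<Omega>) = sets (restrict_space (empirical_measure l z) \<Omega>)"
      by (simp add: sets_restrict_space empirical_measure_def)
    fix A assume "A \<in> sets (restrict_space (distr \<pi> borel f) \<Omega>)"
    then have A: "A \<in> sets borel" "A \<subseteq> \<Omega>"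
      using \<open>open \<Omega>\<close> by (auto simp: sets_restrict_space)
    have "emeasure (restrict_space (distr \<pi> borel f) \<Omega>) A = emeasure (distr \<pi> borel f) A"
      using \<open>open \<Omega>\<close> A by (intro emeasure_restrict_space) auto
    also have "\<dots> = nn_integral (distr \<pi> borel f) (indicator A)"
      using A by (simp)
    also have "\<dots> = nn_integral \<pi> (\<lambda>u. indicator A (f u))"
      using A f measurable_cong_sets[OF sets refl] by (intro nn_integral_distr) auto
    also have "\<dots> = ennreal (\<Sum>k\<in>K. q k * indicator A (f (pt k)))"
      using A f by (intro I) (auto simp: indicator_def intro: measurable_compose[OF f])
    also have "\<dots> = ennreal (1 / real l) * (\<Sum>i=1..l. ennreal (indicator A (z i)))"
      unfolding *[OF A(2)] sum_distrib_left[symmetric]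
      by (simp add: ennreal_mult[symmetric] sum_nonneg sum_ennreal)
    also have "\<dots> = emeasure (empirical_measure l z) A"
      using A by (simp add: emeasure_empirical_measure indicator_def if_distrib ennreal_of_nat_eq_real_of_nat cong: if_cong)
    also have "\<dots> = emeasure (restrict_space (empirical_measure l z) \<Omega>) A"
      using \<open>open \<Omega>\<close> A by (intro emeasure_restrict_space[symmetric]) (auto simp: empirical_measure_def)
    finally show "emeasure (restrict_space (distr \<pi> borel f) \<Omega>) A = emeasure (restrict_space (empirical_measure l z) \<Omega>) A" .
  qed
  have "\<pi> \<in> boundary_couplings \<Omega> (empirical_measure n x) (empirical_measure m y)"
    unfolding boundary_couplings_def
  proof (intro CollectI conjI sets marg fm)
    fix A assume A: "A \<subseteq> \<Omega>"
    then have bA: "indicator A (b z) = (0::real)" for z using bC by (auto simp: indicator_def)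
    show "(\<Sum>k\<in>K. q k * indicator A (fst (pt k))) = (\<Sum>i=1..n. 1 / real n * indicator A (x i))"
      unfolding sumK
      by (simp add: q_def pt_def bA left_diff_distrib sum_subtractf sum_distrib_right)
    have "(\<Sum>i=1..n. \<Sum>j=1..m. p i j * indicator A (y j)) = (\<Sum>j=1..m. \<Sum>i=1..n. p i j * indicator A (y j))"
      by (rule sum.swap)
    then show "(\<Sum>k\<in>K. q k * indicator A (snd (pt k))) = (\<Sum>i=1..m. 1 / real m * indicator A (y i))"
      unfolding sumK
      by (simp add: q_def pt_def bA left_diff_distrib sum_subtractf sum_distrib_right)
  qed
  moreover have "(\<integral>\<^sup>+ (u, v). ennreal (norm (u - v) powr 2) \<partial>\<pi>) = ennreal (partial_cost (frontier \<Omega>) n m p x y)"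
  proof -
    have cont: "(\<lambda>(u, v). ennreal (norm (u - v) powr 2)) \<in> borel_measurable ?R"
      by (intro measurable_restrict_space1) (simp add: borel_prod[symmetric])
    have "(\<integral>\<^sup>+ (u, v). ennreal (norm (u - v) powr 2) \<partial>\<pi>) = ennreal (\<Sum>k\<in>K. q k * (dist (fst (pt k)) (snd (pt k)))\<^sup>2)"
      by (rule I[OF cont]) (auto simp: dist_norm powr_numeral)
    also have "(\<Sum>k\<in>K. q k * (dist (fst (pt k)) (snd (pt k)))\<^sup>2) = partial_cost (frontier \<Omega>) n m p x y"
      unfolding sumK by (simp add: q_def pt_def partial_cost_def b dist_commute)
    finally show ?thesis .
  qed
  ultimately show ?thesis by blast
qed

text \<open>
  When sample points coincide, the mass of the common atom is split evenly among their indices.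
\<close>

lemma sum_inverse_multiplicity:
  assumes "finite I"
  shows "(\<Sum>i\<in>I. ennreal (1 / real (card {i'\<in>I. x i' = x i})) * indicator ({x i} \<inter> A) u)
    = indicator (x ` I \<inter> A) u"
proof (cases "u \<in> x ` I \<inter> A")
  case True
  then obtain i0 where i0: "i0 \<in> I" "u = x i0" by auto
  define J where "J = {i'\<in>I. x i' = u}"
  have J: "finite J" "J \<noteq> {}" "J \<subseteq> I" using i0 assms by (auto simp: J_def)
  have "(\<Sum>i\<in>I. ennreal (1 / real (card {i'\<in>I. x i' = x i})) * indicator ({x i} \<inter> A) u)
      = (\<Sum>i\<in>J. ennreal (1 / real (card {i'\<in>I. x i' = x i})) * indicator ({x i} \<inter> A) u)"
    using J assms by (intro sum.mono_neutral_right) (auto simp: J_def indicator_def)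
  also have "\<dots> = (\<Sum>i\<in>J. ennreal (1 / real (card J)))"
    using True by (intro sum.cong) (auto simp: J_def indicator_def)
  also have "\<dots> = ennreal (\<Sum>i\<in>J. 1 / real (card J))"
    by (intro sum_ennreal) auto
  also have "(\<Sum>i\<in>J. 1 / real (card J)) = 1"
    using J by simp
  finally show ?thesis using True by simp
next
  case False
  then show ?thesis by (intro trans[OF sum.neutral]) (auto simp: indicator_def)
qed

lemma projection_borel_measurable:
  assumes "sets \<pi> = sets (restrict_space borel (A \<times> B :: ('a::euclidean_space \<times> 'a) set))" and "f = fst \<or> f = snd"
  shows "f \<in> borel_measurable \<pi>"
proof -
  have "f \<in> borel_measurable (restrict_space borel (A \<times> B))"
    using assms(2) by (auto intro!: measurable_restrict_space1 borel_measurable_continuous_onI continuous_intros)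
  then show ?thesis
    using measurable_cong_sets[OF assms(1) refl, of "borel :: 'a measure"] by simp
qed

lemma boundary_coupling_marginal:
  assumes \<pi>: "sets \<pi> = sets (restrict_space borel (closure \<Omega> \<times> closure \<Omega>))"
    and eq: "restrict_space (distr \<pi> borel f) \<Omega> = restrict_space \<mu> \<Omega>"
    and f: "f = fst \<or> f = snd"
    and "open (\<Omega> :: 'a::euclidean_space set)" "sets \<mu> = sets borel"
    and A: "A \<in> sets borel" "A \<subseteq> \<Omega>"
  shows "(\<integral>\<^sup>+z. indicator A (f z) \<partial>\<pi>) = emeasure \<mu> A"
proof -
  have fm: "f \<in> borel_measurable \<pi>"
    using \<pi> f by (rule projection_borel_measurable)
  have "(\<integral>\<^sup>+z. indicator A (f z) \<partial>\<pi>) = nn_integral (distr \<pi> borel f) (indicator A)"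
    using A by (intro nn_integral_distr[symmetric] fm) auto
  also have "\<dots> = emeasure (restrict_space (distr \<pi> borel f) \<Omega>) A"
    using assms by (subst emeasure_restrict_space) auto
  also have "\<dots> = emeasure \<mu> A"
    unfolding eq using sets_eq_imp_space_eq[OF \<open>sets \<mu> = sets borel\<close>] assms by (intro emeasure_restrict_space) auto
  finally show ?thesis .
qed

text \<open>These are the two facts on a marginal of an arbitrary coupling that allow it to be split
  by indices: what each index receives, and that almost all mass sits on the sample or on the
  frontier.\<close>

lemma empirical_marginal:
  assumes \<pi>: "sets \<pi> = sets (restrict_space borel (closure \<Omega> \<times> closure \<Omega>))"
    and eq: "restrict_space (distr \<pi> borel f) \<Omega> = restrict_space (empirical_measure n x) \<Omega>"
    and f: "f = fst \<or> f = snd"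
    and "open (\<Omega> :: 'a::euclidean_space set)"
  shows "i \<in> {1..n} \<Longrightarrow> (\<integral>\<^sup>+z. ennreal (1 / real (card {i'\<in>{1..n}. x i' = x i})) * indicator ({x i} \<inter> \<Omega>) (f z) \<partial>\<pi>)
      = ennreal (1 / real n) * indicator \<Omega> (x i)"
    and "AE z in \<pi>. f z \<in> x ` {1..n} \<or> f z \<in> frontier \<Omega>"
proof -
  have fm: "f \<in> borel_measurable \<pi>"
    using \<pi> f by (rule projection_borel_measurable)
  have marg: "(\<integral>\<^sup>+z. indicator A (f z) \<partial>\<pi>) = ennreal (1 / real n) * (\<Sum>i=1..n. indicator A (x i))"
    if "A \<in> sets borel" "A \<subseteq> \<Omega>" for A
  proof -
    have "(\<integral>\<^sup>+z. indicator A (f z) \<partial>\<pi>) = emeasure (empirical_measure n x) A"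
      by (rule boundary_coupling_marginal[OF \<pi> eq f \<open>open \<Omega>\<close> _ that]) (simp add: empirical_measure_def)
    then show ?thesis using that by (simp add: emeasure_empirical_measure)
  qed
  { assume i: "i \<in> {1..n}"
    define J where "J = {i'\<in>{1..n}. x i' = x i}"
    have J: "finite J" "J \<noteq> {}" using i by (auto simp: J_def)
    have [measurable]: "{x i} \<inter> \<Omega> \<in> sets borel" using \<open>open \<Omega>\<close> by auto
    note [measurable] = fm
    have "(\<integral>\<^sup>+z. ennreal (1 / real (card J)) * indicator ({x i} \<inter> \<Omega>) (f z) \<partial>\<pi>)
      = ennreal (1 / real (card J)) * (ennreal (1 / real n) * (\<Sum>i'=1..n. indicator ({x i} \<inter> \<Omega>) (x i')))"
      by (subst nn_integral_cmult) (simp_all add: marg)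
    also have "(\<Sum>i'=1..n. indicator ({x i} \<inter> \<Omega>) (x i')) = (\<Sum>i'\<in>J. indicator \<Omega> (x i) :: ennreal)"
      unfolding J_def by (intro sum.mono_neutral_cong_right) (auto simp: indicator_def)
    also have "ennreal (1 / real (card J)) * (ennreal (1 / real n) * (\<Sum>i'\<in>J. indicator \<Omega> (x i) :: ennreal)) =
       ennreal (1 / real n) * indicator \<Omega> (x i) * (ennreal (1 / real (card J)) * ennreal (real (card J)))"
      by (simp add: mult_ac ennreal_of_nat_eq_real_of_nat)
    also have "ennreal (1 / real (card J)) * ennreal (real (card J)) = 1"
      using J by (subst ennreal_mult[symmetric]) auto
    finally show "(\<integral>\<^sup>+z. ennreal (1 / real (card {i'\<in>{1..n}. x i' = x i})) * indicator ({x i} \<inter> \<Omega>) (f z) \<partial>\<pi>)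
      = ennreal (1 / real n) * indicator \<Omega> (x i)"
      by (simp add: J_def) }
  \<comment> \<open>The part of \<open>\<Omega>\<close> away from the finite sample is Borel and has
    empirical mass zero, hence a null preimage under the projection.\<close>
  define A where "A = \<Omega> - x ` {1..n}"
  have A: "A \<in> sets borel" "A \<subseteq> \<Omega>"
    using sets.Diff[OF borel_open[OF \<open>open \<Omega>\<close>] borel_closed[OF finite_imp_closed[of "x ` {1..n}"]]]
    by (auto simp: A_def)
  have "(\<integral>\<^sup>+z. indicator A (f z) \<partial>\<pi>) = 0"
    unfolding marg[OF A] by (auto simp: A_def intro!: sum.neutral)
  then have "AE z in \<pi>. indicator A (f z) = (0::ennreal)"
    using fm A by (subst (asm) nn_integral_0_iff_AE) auto
  moreover have "space \<pi> = closure \<Omega> \<times> closure \<Omega>"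
    using sets_eq_imp_space_eq[OF \<pi>] by (simp add: space_restrict_space)
  then have "f z \<in> closure \<Omega>" if "z \<in> space \<pi>" for z
    using f that by (metis SigmaE fst_conv snd_conv)
  then have "AE z in \<pi>. f z \<in> closure \<Omega>" by (rule AE_I2)
  ultimately show "AE z in \<pi>. f z \<in> x ` {1..n} \<or> f z \<in> frontier \<Omega>"
  proof eventually_elim
    case (elim z)
    then have "f z \<notin> A" by (metis indicator_simps(1) zero_neq_one)
    then show ?case using elim \<open>open \<Omega>\<close> by (auto simp: A_def frontier_def interior_open)
  qed
qed

text \<open>The entry \<open>p i j\<close> is the mass that \<open>\<pi>\<close> moves from the
  share of index \<open>i\<close> to the share of index \<open>j\<close>. Mass exchanged with the
  frontier travels at least the distance to it. Mass moved between two frontier points, possibly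
  infinite, is dropped, which only lowers the cost.\<close>

lemma partial_plan_of_coupling:
  fixes \<Omega> :: "'a::euclidean_space set"
  assumes "open \<Omega>"
    and xs: "x ` {1..n} \<subseteq> closure \<Omega>" and ys: "y ` {1..m} \<subseteq> closure \<Omega>"
    and \<pi>: "\<pi> \<in> boundary_couplings \<Omega> (empirical_measure n x) (empirical_measure m y)"
  shows "\<exists>p\<in>partial_plans n m.
    ennreal (partial_cost (frontier \<Omega>) n m p x y) \<le> (\<integral>\<^sup>+ (u, v). ennreal (norm (u - v) powr 2) \<partial>\<pi>)"
proof -
  have x: "\<And>i. i \<in> {1..n} \<Longrightarrow> x i \<in> closure \<Omega>" and y: "\<And>j. j \<in> {1..m} \<Longrightarrow> y j \<in> closure \<Omega>"
    using xs ys by auto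
  let ?F = "frontier \<Omega>"
  have sets\<pi>: "sets \<pi> = sets (restrict_space borel (closure \<Omega> \<times> closure \<Omega>))"
    and e1: "restrict_space (distr \<pi> borel fst) \<Omega> = restrict_space (empirical_measure n x) \<Omega>"
    and e2: "restrict_space (distr \<pi> borel snd) \<Omega> = restrict_space (empirical_measure m y) \<Omega>"
    using \<pi> by (auto simp: boundary_couplings_def)
  define a :: "nat \<Rightarrow> 'a \<Rightarrow> ennreal" where "a = (\<lambda>i u. ennreal (1 / real (card {i'\<in>{1..n}. x i' = x i})) * indicator ({x i} \<inter> \<Omega>) u)"
  define b :: "nat \<Rightarrow> 'a \<Rightarrow> ennreal" where "b = (\<lambda>j u. ennreal (1 / real (card {j'\<in>{1..m}. y j' = y j})) * indicator ({y j} \<inter> \<Omega>) u)"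
  define cF :: "'a \<Rightarrow> ennreal" where "cF = indicator ?F"
  define \<kappa> where "\<kappa> = (\<lambda>z::'a\<times>'a. ennreal ((dist (fst z) (snd z))\<^sup>2))"
  have [measurable]: "fst \<in> borel_measurable \<pi>" "snd \<in> borel_measurable \<pi>"
    by (auto intro!: projection_borel_measurable[OF sets\<pi>])
  have [measurable]: "a i \<in> borel_measurable borel" "b j \<in> borel_measurable borel" "cF \<in> borel_measurable borel"
    for i j
  proof -
    have [measurable]: "{x i} \<inter> \<Omega> \<in> sets borel" "{y j} \<inter> \<Omega> \<in> sets borel" using \<open>open \<Omega>\<close> by auto
    show "a i \<in> borel_measurable borel" "b j \<in> borel_measurable borel" unfolding a_def b_def by measurable
    show "cF \<in> borel_measurable borel" by (auto simp: cF_def)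
  qed
  have [measurable]: "\<kappa> \<in> borel_measurable \<pi>"
    unfolding \<kappa>_def by measurable
  have suma: "(\<Sum>i=1..n. a i u) = indicator (x ` {1..n} \<inter> \<Omega>) u" for u
    unfolding a_def by (rule sum_inverse_multiplicity) simp
  have sumb: "(\<Sum>j=1..m. b j u) = indicator (y ` {1..m} \<inter> \<Omega>) u" for u
    unfolding b_def by (rule sum_inverse_multiplicity) simp
  have inta: "(\<integral>\<^sup>+z. a i (fst z) \<partial>\<pi>) = ennreal (1 / real n) * indicator \<Omega> (x i)" if "i \<in> {1..n}" for i
    unfolding a_def using empirical_marginal(1)[OF sets\<pi> e1 _ \<open>open \<Omega>\<close> that] by simp
  have intb: "(\<integral>\<^sup>+z. b j (snd z) \<partial>\<pi>) = ennreal (1 / real m) * indicator \<Omega> (y j)" if "j \<in> {1..m}" for j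
    unfolding b_def using empirical_marginal(1)[OF sets\<pi> e2 _ \<open>open \<Omega>\<close> that] by simp
  have ae1: "AE z in \<pi>. fst z \<in> x ` {1..n} \<or> fst z \<in> ?F"
    using empirical_marginal(2)[OF sets\<pi> e1 _ \<open>open \<Omega>\<close>] by simp
  have ae2: "AE z in \<pi>. snd z \<in> y ` {1..m} \<or> snd z \<in> ?F"
    using empirical_marginal(2)[OF sets\<pi> e2 _ \<open>open \<Omega>\<close>] by simp
  have disj: "u \<in> ?F \<Longrightarrow> u \<notin> \<Omega>" for u using \<open>open \<Omega>\<close> by (auto simp: frontier_def interior_open)
  \<comment> \<open>Matched mass, mass sent from the first sample to the frontier, and mass received
    by the second sample from the frontier.\<close>
  define P where "P = (\<lambda>i j. \<integral>\<^sup>+z. a i (fst z) * b j (snd z) \<partial>\<pi>)"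
  define S where "S = (\<lambda>i. \<integral>\<^sup>+z. a i (fst z) * cF (snd z) \<partial>\<pi>)"
  define T where "T = (\<lambda>j. \<integral>\<^sup>+z. cF (fst z) * b j (snd z) \<partial>\<pi>)"
  have in_cases: "u \<in> \<Omega> \<or> u \<in> ?F" if "u \<in> closure \<Omega>" for u
    using that \<open>open \<Omega>\<close> by (auto simp: frontier_def interior_open)
  have xc: "u \<in> \<Omega> \<or> u \<in> ?F" if "u \<in> x ` {1..n} \<or> u \<in> ?F" for u
    using that x in_cases by blast
  have yc: "u \<in> \<Omega> \<or> u \<in> ?F" if "u \<in> y ` {1..m} \<or> u \<in> ?F" for u
    using that y in_cases by blast
  have row: "(\<Sum>j=1..m. P i j) + S i = ennreal (1 / real n) * indicator \<Omega> (x i)" if "i \<in> {1..n}" for i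
  proof -
    have "(\<Sum>j=1..m. P i j) + S i = (\<integral>\<^sup>+z. (\<Sum>j=1..m. a i (fst z) * b j (snd z)) + a i (fst z) * cF (snd z) \<partial>\<pi>)"
      unfolding P_def S_def by (subst nn_integral_add) (auto simp: nn_integral_sum)
    also have "\<dots> = (\<integral>\<^sup>+z. a i (fst z) \<partial>\<pi>)"
      using ae2
    proof (intro nn_integral_cong_AE, eventually_elim)
      case (elim z)
      then have "(snd z \<in> y ` {1..m} \<inter> \<Omega> \<and> snd z \<notin> ?F) \<or> (snd z \<notin> \<Omega> \<and> snd z \<in> ?F)"
        using disj yc by blast
      then have "indicator (y ` {1..m} \<inter> \<Omega>) (snd z) + cF (snd z) = 1"
        unfolding cF_def by (elim disjE conjE) simp_all
      then show ?case
        unfolding sum_distrib_left[symmetric] sumb by (metis distrib_left mult.right_neutral)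
    qed
    finally show ?thesis using inta that by simp
  qed
  have col: "(\<Sum>i=1..n. P i j) + T j = ennreal (1 / real m) * indicator \<Omega> (y j)" if "j \<in> {1..m}" for j
  proof -
    have "(\<Sum>i=1..n. P i j) + T j = (\<integral>\<^sup>+z. (\<Sum>i=1..n. a i (fst z) * b j (snd z)) + cF (fst z) * b j (snd z) \<partial>\<pi>)"
      unfolding P_def T_def by (subst nn_integral_add) (auto simp: nn_integral_sum)
    also have "\<dots> = (\<integral>\<^sup>+z. b j (snd z) \<partial>\<pi>)"
      using ae1
    proof (intro nn_integral_cong_AE, eventually_elim)
      case (elim z)
      then have "(fst z \<in> x ` {1..n} \<inter> \<Omega> \<and> fst z \<notin> ?F) \<or> (fst z \<notin> \<Omega> \<and> fst z \<in> ?F)"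
        using disj xc by blast
      then have "indicator (x ` {1..n} \<inter> \<Omega>) (fst z) + cF (fst z) = 1"
        unfolding cF_def by (elim disjE conjE) simp_all
      then show ?case
        unfolding sum_distrib_right[symmetric] suma by (metis distrib_right mult.left_neutral)
    qed
    finally show ?thesis using intb that by simp
  qed
  have cost: "(\<Sum>i=1..n. \<Sum>j=1..m. P i j * ennreal ((dist (x i) (y j))\<^sup>2)) + (\<Sum>i=1..n. S i * ennreal ((infdist (x i) ?F)\<^sup>2))
      + (\<Sum>j=1..m. T j * ennreal ((infdist (y j) ?F)\<^sup>2)) \<le> (\<integral>\<^sup>+z. \<kappa> z \<partial>\<pi>)"
  proof -
    have "(\<Sum>i=1..n. \<Sum>j=1..m. P i j * ennreal ((dist (x i) (y j))\<^sup>2)) + (\<Sum>i=1..n. S i * ennreal ((infdist (x i) ?F)\<^sup>2))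
      + (\<Sum>j=1..m. T j * ennreal ((infdist (y j) ?F)\<^sup>2))
      = (\<integral>\<^sup>+z. (\<Sum>i=1..n. \<Sum>j=1..m. a i (fst z) * b j (snd z) * ennreal ((dist (x i) (y j))\<^sup>2))
        + (\<Sum>i=1..n. a i (fst z) * cF (snd z) * ennreal ((infdist (x i) ?F)\<^sup>2))
        + (\<Sum>j=1..m. cF (fst z) * b j (snd z) * ennreal ((infdist (y j) ?F)\<^sup>2)) \<partial>\<pi>)"
      unfolding P_def S_def T_def
      by (simp add: nn_integral_add nn_integral_sum nn_integral_multc)
    also have "\<dots> \<le> (\<integral>\<^sup>+z. \<kappa> z \<partial>\<pi>)"
    proof (rule nn_integral_mono)
      fix z :: "'a \<times> 'a"
      have 1: "a i (fst z) * b j (snd z) * ennreal ((dist (x i) (y j))\<^sup>2) \<le> a i (fst z) * b j (snd z) * \<kappa> z" for i j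
        by (auto simp: a_def b_def \<kappa>_def indicator_def)
      have 2: "a i (fst z) * cF (snd z) * ennreal ((infdist (x i) ?F)\<^sup>2) \<le> a i (fst z) * cF (snd z) * \<kappa> z" for i
        by (auto simp: a_def cF_def \<kappa>_def indicator_def
            intro!: mult_left_mono ennreal_leI power_mono infdist_le infdist_nonneg)
      have 3: "cF (fst z) * b j (snd z) * ennreal ((infdist (y j) ?F)\<^sup>2) \<le> cF (fst z) * b j (snd z) * \<kappa> z" for j
        by (auto simp: b_def cF_def \<kappa>_def indicator_def dist_commute[of "fst z"]
            intro!: mult_left_mono ennreal_leI power_mono infdist_le infdist_nonneg)
      have "(\<Sum>i=1..n. \<Sum>j=1..m. a i (fst z) * b j (snd z) * ennreal ((dist (x i) (y j))\<^sup>2))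
        + (\<Sum>i=1..n. a i (fst z) * cF (snd z) * ennreal ((infdist (x i) ?F)\<^sup>2))
        + (\<Sum>j=1..m. cF (fst z) * b j (snd z) * ennreal ((infdist (y j) ?F)\<^sup>2))
        \<le> (\<Sum>i=1..n. \<Sum>j=1..m. a i (fst z) * b j (snd z) * \<kappa> z)
        + (\<Sum>i=1..n. a i (fst z) * cF (snd z) * \<kappa> z)
        + (\<Sum>j=1..m. cF (fst z) * b j (snd z) * \<kappa> z)"
        by (intro add_mono sum_mono 1 2 3)
      also have "\<dots> = ((\<Sum>i=1..n. a i (fst z)) * (\<Sum>j=1..m. b j (snd z)) + (\<Sum>i=1..n. a i (fst z)) * cF (snd z)
          + cF (fst z) * (\<Sum>j=1..m. b j (snd z))) * \<kappa> z"
        by (simp only: sum_product distrib_right sum_distrib_right sum_distrib_left[of "cF (fst z)"])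
          (simp only: sum_distrib_left sum_distrib_right)
      \<comment> \<open>The three products are indicators of disjoint sets of pairs, so their sum is
        at most one.\<close>
      also have "\<dots> \<le> 1 * \<kappa> z"
        unfolding suma sumb cF_def using disj
        by (intro mult_right_mono) (auto simp: indicator_def)
      finally show "(\<Sum>i=1..n. \<Sum>j=1..m. a i (fst z) * b j (snd z) * ennreal ((dist (x i) (y j))\<^sup>2))
        + (\<Sum>i=1..n. a i (fst z) * cF (snd z) * ennreal ((infdist (x i) ?F)\<^sup>2))
        + (\<Sum>j=1..m. cF (fst z) * b j (snd z) * ennreal ((infdist (y j) ?F)\<^sup>2)) \<le> \<kappa> z"
        by simp
    qed
    finally show ?thesis .
  qed
  define p where "p = (\<lambda>i j. enn2real (P i j))"
  have rowle: "(\<Sum>j=1..m. P i j) + S i \<le> ennreal (1 / real n)" if "i \<in> {1..n}" for i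
    unfolding row[OF that] by (auto simp: indicator_def)
  have colle: "(\<Sum>i=1..n. P i j) + T j \<le> ennreal (1 / real m)" if "j \<in> {1..m}" for j
    unfolding col[OF that] by (auto simp: indicator_def)
  have Pfin: "P i j = ennreal (p i j)" if "i \<in> {1..n}" "j \<in> {1..m}" for i j
  proof -
    have "P i j \<le> (\<Sum>j=1..m. P i j)" using that by (intro member_le_sum) auto
    also have "\<dots> \<le> ennreal (1 / real n)" using rowle[OF that(1)] by (rule order_trans[rotated]) simp
    finally have "P i j < top" by (auto simp: less_top[symmetric] top_unique)
    then show ?thesis by (simp add: p_def)
  qed
  have p0: "0 \<le> p i j" for i j by (simp add: p_def)
  have Prow: "(\<Sum>j=1..m. P i j) = ennreal (\<Sum>j=1..m. p i j)" if "i \<in> {1..n}" for i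
    using that by (subst sum_ennreal[symmetric]) (auto simp: p0 Pfin)
  have Pcol: "(\<Sum>i=1..n. P i j) = ennreal (\<Sum>i=1..n. p i j)" if "j \<in> {1..m}" for j
    using that by (subst sum_ennreal[symmetric]) (auto simp: p0 Pfin)
  have Psum: "(\<Sum>i=1..n. \<Sum>j=1..m. P i j * ennreal ((dist (x i) (y j))\<^sup>2)) = ennreal (\<Sum>i=1..n. \<Sum>j=1..m. p i j * (dist (x i) (y j))\<^sup>2)"
  proof -
    have "(\<Sum>i=1..n. \<Sum>j=1..m. P i j * ennreal ((dist (x i) (y j))\<^sup>2)) = (\<Sum>i=1..n. \<Sum>j=1..m. ennreal (p i j * (dist (x i) (y j))\<^sup>2))"
      by (intro sum.cong refl) (simp add: Pfin p0 ennreal_mult)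
    also have "\<dots> = (\<Sum>i=1..n. ennreal (\<Sum>j=1..m. p i j * (dist (x i) (y j))\<^sup>2))"
      by (intro sum.cong refl sum_ennreal) (simp add: p0)
    also have "\<dots> = ennreal (\<Sum>i=1..n. \<Sum>j=1..m. p i j * (dist (x i) (y j))\<^sup>2)"
      by (intro sum_ennreal sum_nonneg) (simp add: p0)
    finally show ?thesis .
  qed
  have rowp: "(\<Sum>j=1..m. p i j) \<le> 1 / real n" if "i \<in> {1..n}" for i
  proof -
    have "ennreal (\<Sum>j=1..m. p i j) \<le> ennreal (1 / real n)"
      unfolding Prow[OF that, symmetric] using rowle[OF that] by (rule order_trans[rotated]) simp
    then show ?thesis by (simp add: ennreal_le_iff)
  qed
  have colp: "(\<Sum>i=1..n. p i j) \<le> 1 / real m" if "j \<in> {1..m}" for j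
  proof -
    have "ennreal (\<Sum>i=1..n. p i j) \<le> ennreal (1 / real m)"
      unfolding Pcol[OF that, symmetric] using colle[OF that] by (rule order_trans[rotated]) simp
    then show ?thesis by (simp add: ennreal_le_iff)
  qed
  \<comment> \<open>A sample point on the frontier has no mass in \<open>\<Omega>\<close>, while the
    partial cost assigns it a remainder. The two costs agree because its distance to the frontier is
    zero.\<close>
  have slack: "s * ennreal ((infdist z ?F)\<^sup>2) = ennreal ((c - r) * (infdist z ?F)\<^sup>2)"
    if "ennreal r + s = ennreal c * indicator \<Omega> z" "0 \<le> r" "r \<le> c" "z \<in> closure \<Omega>" for r s c z
  proof (cases "z \<in> \<Omega>")
    case True
    then have "ennreal r + s = ennreal c" using that by simp
    then have "s = ennreal c - ennreal r"
      using ennreal_add_diff_cancel_left[of "ennreal r" s] by simp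
    then have "s = ennreal (c - r)" using that by (simp add: ennreal_minus)
    then show ?thesis using that by (simp add: ennreal_mult)
  next
    case False
    then have "z \<in> ?F" using in_cases[of z] that(4) by blast
    then have "infdist z ?F = 0" by simp
    then show ?thesis by simp
  qed
  have Ssum: "(\<Sum>i=1..n. S i * ennreal ((infdist (x i) ?F)\<^sup>2)) = ennreal (\<Sum>i=1..n. (1 / real n - (\<Sum>j=1..m. p i j)) * (infdist (x i) ?F)\<^sup>2)"
  proof -
    have "(\<Sum>i=1..n. S i * ennreal ((infdist (x i) ?F)\<^sup>2)) = (\<Sum>i=1..n. ennreal ((1 / real n - (\<Sum>j=1..m. p i j)) * (infdist (x i) ?F)\<^sup>2))"
      by (intro sum.cong refl slack) (simp_all add: Prow[symmetric] row rowp x sum_nonneg p0 del: One_nat_def)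
    also have "\<dots> = ennreal (\<Sum>i=1..n. (1 / real n - (\<Sum>j=1..m. p i j)) * (infdist (x i) ?F)\<^sup>2)"
      by (intro sum_ennreal mult_nonneg_nonneg) (simp_all add: rowp del: One_nat_def)
    finally show ?thesis .
  qed
  have Tsum: "(\<Sum>j=1..m. T j * ennreal ((infdist (y j) ?F)\<^sup>2)) = ennreal (\<Sum>j=1..m. (1 / real m - (\<Sum>i=1..n. p i j)) * (infdist (y j) ?F)\<^sup>2)"
  proof -
    have "(\<Sum>j=1..m. T j * ennreal ((infdist (y j) ?F)\<^sup>2)) = (\<Sum>j=1..m. ennreal ((1 / real m - (\<Sum>i=1..n. p i j)) * (infdist (y j) ?F)\<^sup>2))"
      by (intro sum.cong refl slack) (simp_all add: Pcol[symmetric] col colp y sum_nonneg p0 del: One_nat_def)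
    also have "\<dots> = ennreal (\<Sum>j=1..m. (1 / real m - (\<Sum>i=1..n. p i j)) * (infdist (y j) ?F)\<^sup>2)"
      by (intro sum_ennreal mult_nonneg_nonneg) (simp_all add: colp del: One_nat_def)
    finally show ?thesis .
  qed
  have "p \<in> partial_plans n m"
    using p0 rowp colp by (simp add: partial_plans_def del: One_nat_def)
  moreover have "ennreal (partial_cost ?F n m p x y) \<le> (\<integral>\<^sup>+z. \<kappa> z \<partial>\<pi>)"
  proof -
    have "0 \<le> (\<Sum>i=1..n. \<Sum>j=1..m. p i j * (dist (x i) (y j))\<^sup>2)"
      and "0 \<le> (\<Sum>i=1..n. (1 / real n - (\<Sum>j=1..m. p i j)) * (infdist (x i) ?F)\<^sup>2)"
      and "0 \<le> (\<Sum>j=1..m. (1 / real m - (\<Sum>i=1..n. p i j)) * (infdist (y j) ?F)\<^sup>2)"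
      using rowp colp by (auto intro!: sum_nonneg mult_nonneg_nonneg p0)
    then show ?thesis
      using cost unfolding Psum Ssum Tsum partial_cost_def by (simp only: ennreal_plus add_nonneg_nonneg)
  qed
  moreover have "(\<integral>\<^sup>+z. \<kappa> z \<partial>\<pi>) = (\<integral>\<^sup>+ (u, v). ennreal (norm (u - v) powr 2) \<partial>\<pi>)"
    by (intro nn_integral_cong) (auto simp: \<kappa>_def dist_norm powr_numeral)
  ultimately show ?thesis by auto
qed

section \<open>Finite-dimensional form of the cost and weak duality\<close>

lemma Wb_power2: "(Wb \<Omega> 2 \<mu> \<nu>)\<^sup>2 =
    enn2real (INF \<pi> \<in> boundary_couplings \<Omega> \<mu> \<nu>. (\<integral>\<^sup>+ (x, y). ennreal (norm (x - y) powr 2) \<partial>\<pi>))"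
  unfolding Wb_def by (simp add: powr_half_sqrt)

text \<open>An infimum over measures becomes one over real matrices: duality turns into a
  rearrangement of finite sums, and the cost into an infimum of continuous functions of the
  sample.\<close>

lemma boundary_cost_eq_partial_cost:
  fixes \<Omega> :: "'a::euclidean_space set"
  assumes "open \<Omega>" "frontier \<Omega> \<noteq> {}"
    and "x ` {1..n} \<subseteq> closure \<Omega>" "y ` {1..m} \<subseteq> closure \<Omega>"
  shows "(INF \<pi> \<in> boundary_couplings \<Omega> (empirical_measure n x) (empirical_measure m y).
      (\<integral>\<^sup>+ (u, v). ennreal (norm (u - v) powr 2) \<partial>\<pi>)) =
    (INF p \<in> partial_plans n m. ennreal (partial_cost (frontier \<Omega>) n m p x y))"
proof (rule antisym)
  show "(INF \<pi> \<in> boundary_couplings \<Omega> (empirical_measure n x) (empirical_measure m y).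
      (\<integral>\<^sup>+ (u, v). ennreal (norm (u - v) powr 2) \<partial>\<pi>)) \<le>
    (INF p \<in> partial_plans n m. ennreal (partial_cost (frontier \<Omega>) n m p x y))"
  proof (rule INF_greatest)
    fix p assume "p \<in> partial_plans n m"
    from coupling_of_partial_plan[OF assms this] obtain \<pi>
      where "\<pi> \<in> boundary_couplings \<Omega> (empirical_measure n x) (empirical_measure m y)"
        "(\<integral>\<^sup>+ (u, v). ennreal (norm (u - v) powr 2) \<partial>\<pi>) = ennreal (partial_cost (frontier \<Omega>) n m p x y)" by blast
    then show "(INF \<pi> \<in> boundary_couplings \<Omega> (empirical_measure n x) (empirical_measure m y).
      (\<integral>\<^sup>+ (u, v). ennreal (norm (u - v) powr 2) \<partial>\<pi>)) \<le> ennreal (partial_cost (frontier \<Omega>) n m p x y)"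
      by (intro INF_lower2) auto
  qed
  show "(INF p \<in> partial_plans n m. ennreal (partial_cost (frontier \<Omega>) n m p x y)) \<le>
    (INF \<pi> \<in> boundary_couplings \<Omega> (empirical_measure n x) (empirical_measure m y).
      (\<integral>\<^sup>+ (u, v). ennreal (norm (u - v) powr 2) \<partial>\<pi>))"
  proof (rule INF_greatest)
    fix \<pi> assume "\<pi> \<in> boundary_couplings \<Omega> (empirical_measure n x) (empirical_measure m y)"
    from partial_plan_of_coupling[OF assms(1,3,4) this] obtain p where "p \<in> partial_plans n m"
      "ennreal (partial_cost (frontier \<Omega>) n m p x y) \<le> (\<integral>\<^sup>+ (u, v). ennreal (norm (u - v) powr 2) \<partial>\<pi>)" by blast
    then show "(INF p \<in> partial_plans n m. ennreal (partial_cost (frontier \<Omega>) n m p x y))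
      \<le> (\<integral>\<^sup>+ (u, v). ennreal (norm (u - v) powr 2) \<partial>\<pi>)"
      by (intro INF_lower2)
  qed
qed

lemma Wb_power2_eq_partial_cost:
  fixes \<Omega> :: "'a::euclidean_space set"
  assumes "open \<Omega>" "frontier \<Omega> \<noteq> {}"
    and "x ` {1..n} \<subseteq> closure \<Omega>" "y ` {1..m} \<subseteq> closure \<Omega>"
  shows "(Wb \<Omega> 2 (empirical_measure n x) (empirical_measure m y))\<^sup>2 =
    enn2real (INF p \<in> partial_plans n m. ennreal (partial_cost (frontier \<Omega>) n m p x y))"
  unfolding Wb_power2 boundary_cost_eq_partial_cost[OF assms] ..

text \<open>The frontier acts as a reservoir with dual value zero, whence the two one-sided
  constraints. The mass of each point is split into its matched part, tested with
  \<open>f i + g j\<close>, and its remainder, tested with \<open>f i\<close> or \<open>g j\<close>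
  alone.\<close>

lemma Wb_power2_dual:
  fixes \<Omega> :: "'a::euclidean_space set"
  assumes "open \<Omega>" "frontier \<Omega> \<noteq> {}"
    and "x ` {1..n} \<subseteq> closure \<Omega>" "y ` {1..m} \<subseteq> closure \<Omega>"
    and fg: "\<And>i j. i \<in> {1..n} \<Longrightarrow> j \<in> {1..m} \<Longrightarrow> f i + g j \<le> (dist (x i) (y j))\<^sup>2"
    and f: "\<And>i. i \<in> {1..n} \<Longrightarrow> f i \<le> (infdist (x i) (frontier \<Omega>))\<^sup>2"
    and g: "\<And>j. j \<in> {1..m} \<Longrightarrow> g j \<le> (infdist (y j) (frontier \<Omega>))\<^sup>2"
  shows "(\<Sum>i=1..n. 1 / real n * f i) + (\<Sum>j=1..m. 1 / real m * g j)
    \<le> (Wb \<Omega> 2 (empirical_measure n x) (empirical_measure m y))\<^sup>2"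
proof -
  let ?I = "INF p \<in> partial_plans n m. ennreal (partial_cost (frontier \<Omega>) n m p x y)"
  \<comment> \<open>The plan without matches has finite cost, which keeps \<open>enn2real\<close>
    away from its default value 0 at infinity.\<close>
  have "?I \<le> ennreal (partial_cost (frontier \<Omega>) n m (\<lambda>_ _. 0) x y)"
    by (intro INF_lower zero_in_partial_plans)
  then have fin: "?I < top" by (auto simp: less_top[symmetric] top_unique)
  have "ennreal ((\<Sum>i=1..n. 1 / real n * f i) + (\<Sum>j=1..m. 1 / real m * g j)) \<le> ?I"
  proof (intro INF_greatest ennreal_leI)
    fix p assume p: "p \<in> partial_plans n m"
    have p0: "\<And>i j. i \<in> {1..n} \<Longrightarrow> j \<in> {1..m} \<Longrightarrow> 0 \<le> p i j"
      and r: "\<And>i. i \<in> {1..n} \<Longrightarrow> 0 \<le> 1 / real n - (\<Sum>j=1..m. p i j)"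
      and c: "\<And>j. j \<in> {1..m} \<Longrightarrow> 0 \<le> 1 / real m - (\<Sum>i=1..n. p i j)"
      using p by (auto simp: partial_plans_def)
    have "(\<Sum>i=1..n. 1 / real n * f i) + (\<Sum>j=1..m. 1 / real m * g j) =
      (\<Sum>i=1..n. \<Sum>j=1..m. p i j * (f i + g j)) + (\<Sum>i=1..n. (1 / real n - (\<Sum>j=1..m. p i j)) * f i)
      + (\<Sum>j=1..m. (1 / real m - (\<Sum>i=1..n. p i j)) * g j)"
      using sum.swap[of "\<lambda>i j. p i j * g j" "{1..m}" "{1..n}"]
      by (simp add: left_diff_distrib sum_subtractf distrib_left sum.distrib sum_distrib_right)
    also have "\<dots> \<le> partial_cost (frontier \<Omega>) n m p x y"
      unfolding partial_cost_def by (intro add_mono sum_mono mult_left_mono fg f g p0 r c)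
    finally show "(\<Sum>i=1..n. 1 / real n * f i) + (\<Sum>j=1..m. 1 / real m * g j) \<le> \<dots>" .
  qed
  then show ?thesis
    unfolding Wb_power2_eq_partial_cost[OF assms(1-4)]
    using fin by (cases ?I rule: ennreal_cases) (auto simp: ennreal_le_iff2)
qed

section \<open>Boundedness and measurability of the cost\<close>

lemma Wb_power2_le:
  fixes \<Omega> :: "'a::euclidean_space set"
  assumes "open \<Omega>" "frontier \<Omega> \<noteq> {}" "bounded \<Omega>"
    and "x ` {1..n} \<subseteq> closure \<Omega>" "y ` {1..m} \<subseteq> closure \<Omega>"
  shows "(Wb \<Omega> 2 (empirical_measure n x) (empirical_measure m y))\<^sup>2 \<le> 2 * (diameter (closure \<Omega>))\<^sup>2"
proof -
  let ?I = "INF p \<in> partial_plans n m. ennreal (partial_cost (frontier \<Omega>) n m p x y)"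
  let ?D = "(diameter (closure \<Omega>))\<^sup>2"
  obtain b where b: "b \<in> frontier \<Omega>" using assms(2) by auto
  have d: "(infdist z (frontier \<Omega>))\<^sup>2 \<le> ?D" if "z \<in> closure \<Omega>" for z
  proof -
    have "infdist z (frontier \<Omega>) \<le> dist z b" using b by (rule infdist_le)
    also have "\<dots> \<le> diameter (closure \<Omega>)"
      using assms(3) b that by (intro diameter_bounded_bound) (auto simp: frontier_def)
    finally show ?thesis by (intro power_mono infdist_nonneg)
  qed
  have av: "(\<Sum>i=1..k. 1 / real k * (infdist (z i) (frontier \<Omega>))\<^sup>2) \<le> ?D"
    if "z ` {1..k} \<subseteq> closure \<Omega>" for z k
  proof -
    have "(\<Sum>i=1..k. 1 / real k * (infdist (z i) (frontier \<Omega>))\<^sup>2) \<le> (\<Sum>i=1..k. 1 / real k * ?D)"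
      using that by (intro sum_mono mult_left_mono d) auto
    also have "\<dots> \<le> ?D" by (cases "k = 0") auto
    finally show ?thesis .
  qed
  have "?I \<le> ennreal (partial_cost (frontier \<Omega>) n m (\<lambda>_ _. 0) x y)"
    by (intro INF_lower zero_in_partial_plans)
  also have "\<dots> \<le> ennreal (2 * ?D)"
    using av[OF assms(4)] av[OF assms(5)] by (intro ennreal_leI) (simp add: partial_cost_def)
  finally show ?thesis
    unfolding Wb_power2_eq_partial_cost[OF assms(1,2,4,5)]
    by (intro enn2real_leI) auto
qed

text \<open>
  On a null event the sample may leave \<open>\<Omega>\<close>. The cost must be measurable there as well, because the
  expectation of a non-measurable function is \<open>0\<close>. Moving the stray points to the boundary changes nothing.
\<close>

lemma boundary_couplings_move_outside:
  fixes \<Omega> :: "'a::euclidean_space set"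
  assumes "open \<Omega>" "b \<notin> \<Omega>"
  defines "r \<equiv> \<lambda>z. if z \<in> \<Omega> then z else b"
  shows "boundary_couplings \<Omega> (empirical_measure n x) (empirical_measure m y) =
    boundary_couplings \<Omega> (empirical_measure n (\<lambda>i. r (x i))) (empirical_measure m (\<lambda>j. r (y j)))"
proof -
  have "restrict_space (empirical_measure k z) \<Omega> = restrict_space (empirical_measure k (\<lambda>i. r (z i))) \<Omega>" for k and z :: "nat \<Rightarrow> 'a"
  proof (rule measure_eqI)
    show "sets (restrict_space (empirical_measure k z) \<Omega>) = sets (restrict_space (empirical_measure k (\<lambda>i. r (z i))) \<Omega>)"
      by (simp add: sets_restrict_space empirical_measure_def)
    fix A assume "A \<in> sets (restrict_space (empirical_measure k z) \<Omega>)"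
    then have A: "A \<in> sets borel" "A \<subseteq> \<Omega>"
      using \<open>open \<Omega>\<close> by (auto simp: sets_restrict_space empirical_measure_def)
    have "indicator A (r (z i)) = (indicator A (z i) :: ennreal)" for i
      using A assms by (auto simp: r_def indicator_def)
    then have "emeasure (empirical_measure k z) A = emeasure (empirical_measure k (\<lambda>i. r (z i))) A"
      using A by (simp add: emeasure_empirical_measure)
    then show "emeasure (restrict_space (empirical_measure k z) \<Omega>) A = emeasure (restrict_space (empirical_measure k (\<lambda>i. r (z i))) \<Omega>) A"
      using \<open>open \<Omega>\<close> A by (subst (1 2) emeasure_restrict_space) (auto simp: empirical_measure_def)
  qed
  then show ?thesis unfolding boundary_couplings_def by metis
qed

text \<open>
  An infimum of continuous functions is upper semicontinuous, so uncountably many plans do no harm.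
\<close>

lemma borel_measurable_partial_cost_INF:
  "(\<lambda>z. INF p \<in> partial_plans n m. ennreal (partial_cost F n m p (\<lambda>i. z (Inl i)) (\<lambda>j. z (Inr j))))
    \<in> borel_measurable (borel :: (nat + nat \<Rightarrow> 'a::euclidean_space) measure)"
proof (rule borel_measurableI_less)
  fix a :: ennreal
  have "{z :: nat + nat \<Rightarrow> 'a. (INF p \<in> partial_plans n m. ennreal (partial_cost F n m p (\<lambda>i. z (Inl i)) (\<lambda>j. z (Inr j)))) < a}
     = (\<Union>p\<in>partial_plans n m. {z. ennreal (partial_cost F n m p (\<lambda>i. z (Inl i)) (\<lambda>j. z (Inr j))) < a})"
    by (auto simp: INF_less_iff)
  also have "open \<dots>"
    unfolding partial_cost_def
    by (intro open_UN ballI open_Collect_less continuous_on_ennreal continuous_intros continuous_on_product_coordinates)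
  finally show "{z \<in> space borel. (INF p \<in> partial_plans n m. ennreal (partial_cost F n m p (\<lambda>i. z (Inl i)) (\<lambda>j. z (Inr j)))) < a}
     \<in> sets (borel :: (nat + nat \<Rightarrow> 'a) measure)"
    by simp
qed

lemma borel_measurable_Wb_power2:
  fixes \<Omega> :: "'a::euclidean_space set"
  assumes "open \<Omega>" "frontier \<Omega> \<noteq> {}"
    and X: "\<And>i. i \<in> {1..n} \<Longrightarrow> X i \<in> borel_measurable M" and Y: "\<And>j. j \<in> {1..m} \<Longrightarrow> Y j \<in> borel_measurable M"
  shows "(\<lambda>s. (Wb \<Omega> 2 (empirical_measure n (\<lambda>i. X i s)) (empirical_measure m (\<lambda>j. Y j s)))\<^sup>2) \<in> borel_measurable M"
    and "bounded \<Omega> \<Longrightarrow> (Wb \<Omega> 2 (empirical_measure n (\<lambda>i. X i s)) (empirical_measure m (\<lambda>j. Y j s)))\<^sup>2 \<le> 2 * (diameter (closure \<Omega>))\<^sup>2"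
proof -
  obtain b where b: "b \<in> frontier \<Omega>" using assms(2) by auto
  then have b': "b \<notin> \<Omega>" "b \<in> closure \<Omega>" using \<open>open \<Omega>\<close> by (auto simp: frontier_def interior_open)
  define r where "r = (\<lambda>z. if z \<in> \<Omega> then z else b)"
  have r: "r z \<in> closure \<Omega>" for z using b' closure_subset[of \<Omega>] by (auto simp: r_def)
  have [measurable]: "\<Omega> \<in> sets borel" using \<open>open \<Omega>\<close> by simp
  have [measurable]: "r \<in> borel_measurable borel" unfolding r_def by measurable
  \<comment> \<open>Coordinates outside the two samples are filled with the frontier point, as
    measurability is assumed only for indices up to \<open>n\<close> and \<open>m\<close>; the map
    into the full product is then measurable coordinatewise.\<close>
  define Z where "Z = (\<lambda>s k. case k of Inl i \<Rightarrow> if i \<in> {1..n} then r (X i s) else b | Inr j \<Rightarrow> if j \<in> {1..m} then r (Y j s) else b)"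
  have [measurable]: "Z \<in> borel_measurable M"
  proof (rule measurable_coordinatewise_then_product)
    have "(\<lambda>s. if i \<in> {1..n} then r (X i s) else b) \<in> borel_measurable M" for i
      using measurable_compose[OF X \<open>r \<in> borel_measurable borel\<close>] by (cases "i \<in> {1..n}") (simp_all del: atLeastAtMost_iff)
    moreover have "(\<lambda>s. if j \<in> {1..m} then r (Y j s) else b) \<in> borel_measurable M" for j
      using measurable_compose[OF Y \<open>r \<in> borel_measurable borel\<close>] by (cases "j \<in> {1..m}") (simp_all del: atLeastAtMost_iff)
    ultimately show "(\<lambda>s. Z s k) \<in> borel_measurable M" for k
      by (cases k) (simp_all add: Z_def)
  qed
  have move: "(Wb \<Omega> 2 (empirical_measure n (\<lambda>i. X i s)) (empirical_measure m (\<lambda>j. Y j s)))\<^sup>2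
    = (Wb \<Omega> 2 (empirical_measure n (\<lambda>i. r (X i s))) (empirical_measure m (\<lambda>j. r (Y j s))))\<^sup>2" for s
    by (subst (1 2) Wb_power2, subst boundary_couplings_move_outside[OF \<open>open \<Omega>\<close> b'(1)]) (simp only: r_def)
  have "partial_cost (frontier \<Omega>) n m p (\<lambda>i. r (X i s)) (\<lambda>j. r (Y j s))
      = partial_cost (frontier \<Omega>) n m p (\<lambda>i. Z s (Inl i)) (\<lambda>j. Z s (Inr j))" for p s
    by (simp add: partial_cost_def Z_def)
  then have eq: "(Wb \<Omega> 2 (empirical_measure n (\<lambda>i. X i s)) (empirical_measure m (\<lambda>j. Y j s)))\<^sup>2
    = enn2real (INF p \<in> partial_plans n m. ennreal (partial_cost (frontier \<Omega>) n m p (\<lambda>i. Z s (Inl i)) (\<lambda>j. Z s (Inr j))))" for s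
    by (subst move, subst Wb_power2_eq_partial_cost[OF assms(1,2)]) (auto simp: r)
  show "(\<lambda>s. (Wb \<Omega> 2 (empirical_measure n (\<lambda>i. X i s)) (empirical_measure m (\<lambda>j. Y j s)))\<^sup>2) \<in> borel_measurable M"
    unfolding eq
    by (rule borel_measurable_enn2real)
       (rule measurable_compose[OF \<open>Z \<in> borel_measurable M\<close> borel_measurable_partial_cost_INF])
  show "(Wb \<Omega> 2 (empirical_measure n (\<lambda>i. X i s)) (empirical_measure m (\<lambda>j. Y j s)))\<^sup>2 \<le> 2 * (diameter (closure \<Omega>))\<^sup>2" if "bounded \<Omega>"
    by (subst move, rule Wb_power2_le[OF assms(1,2) that]) (auto simp: r)
qed

section \<open>Truncated Green function\<close>

definition freq :: "nat \<Rightarrow> real" where "freq a = 2 * pi * real a"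

text \<open>
  \<open>kern N p q\<close> below is the derivative of order \<open>p\<close> in the first and \<open>q\<close> in the second variable of the
  truncated Green function with coefficients \<open>4 / \<lambda>\<^sub>k\<close>, where \<open>\<lambda>\<^sub>k = 4 \<pi>\<^sup>2 (k\<^sub>1\<^sup>2 + k\<^sub>2\<^sup>2)\<close>.
  Each derivative of a cosine multiplies by the frequency and shifts the phase by \<open>\<pi> / 2\<close>.
\<close>

definition kcoef :: "nat \<Rightarrow> nat \<Rightarrow> nat \<times> nat \<Rightarrow> real" where
  "kcoef p q k = 4 * freq (fst k) ^ p * freq (snd k) ^ q / ((freq (fst k))\<^sup>2 + (freq (snd k))\<^sup>2)"

text \<open>A pair of positive integers stands for the four torus frequencies with the same absolute
  values, whence the coefficient 4. Frequencies on the axes are left out; they would add only a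
  bounded amount to the value at the origin.\<close>

definition modes :: "nat \<Rightarrow> (nat \<times> nat) set" where "modes N = {1..N} \<times> {1..N}"

definition mode :: "nat \<Rightarrow> nat \<Rightarrow> nat \<times> nat \<Rightarrow> real \<times> real \<Rightarrow> real" where
  "mode p q k z = cos (freq (fst k) * fst z + real p * (pi / 2)) * cos (freq (snd k) * snd z + real q * (pi / 2))"

definition kern :: "nat \<Rightarrow> nat \<Rightarrow> nat \<Rightarrow> real \<times> real \<Rightarrow> real" where
  "kern N p q z = (\<Sum>k\<in>modes N. kcoef p q k * mode p q k z)"

lemma finite_modes [simp]: "finite (modes N)" by (simp add: modes_def)

lemma card_modes: "card (modes N) = N\<^sup>2" by (simp add: modes_def power2_eq_square)

lemma freq_ge_1: "1 \<le> a \<Longrightarrow> 1 \<le> freq a"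
proof -
  assume "1 \<le> a"
  then have "1 * 1 \<le> (2 * pi) * real a" using pi_gt3 by (intro mult_mono) auto
  then show ?thesis by (simp add: freq_def)
qed

lemma abs_mode_le: "\<bar>mode p q k z\<bar> \<le> 1"
  unfolding mode_def abs_mult by (intro mult_le_one) auto

lemma continuous_on_kern: "continuous_on A (kern N p q)"
  unfolding kern_def mode_def by (intro continuous_intros)

lemma kcoef_nonneg: "0 \<le> kcoef p q k"
  by (simp add: kcoef_def freq_def)

text \<open>Frequencies are at least 1, so every monomial of degree at most two in them is dominated
  by the sum of their squares. Up to second derivatives the kernel thus grows no faster than the
  number of modes.\<close>

lemma kcoef_le:
  assumes "k \<in> modes N" "p + q \<le> 2"
  shows "kcoef p q k \<le> 4"
proof -
  define u v where "u = freq (fst k)" and "v = freq (snd k)"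
  have uv: "1 \<le> u" "1 \<le> v" using assms by (auto simp: u_def v_def modes_def intro!: freq_ge_1)
  then have "u * 1 \<le> u * u" "v * 1 \<le> v * v" "0 \<le> u * v" by (auto intro!: mult_left_mono mult_nonneg_nonneg)
  then have sq: "1 \<le> u\<^sup>2" "1 \<le> v\<^sup>2" "u \<le> u\<^sup>2" "v \<le> v\<^sup>2" and uvs: "u * v \<le> u\<^sup>2 + v\<^sup>2"
    using uv sum_squares_bound[of u v] unfolding power2_eq_square by linarith+
  have "(p, q) \<in> {(0,0),(1,0),(0,1),(2,0),(1,1),(0,2)}" using assms(2) by (cases p; cases q) (auto simp: numeral_2_eq_2)
  then have "u ^ p * v ^ q \<le> u\<^sup>2 + v\<^sup>2" using sq uvs by auto
  moreover have "0 < u\<^sup>2 + v\<^sup>2" using sq by linarith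
  ultimately show ?thesis unfolding kcoef_def u_def[symmetric] v_def[symmetric] by (simp add: divide_le_eq)
qed

lemma abs_kern_le:
  assumes "p + q \<le> 2"
  shows "\<bar>kern N p q z\<bar> \<le> 4 * (real N)\<^sup>2"
proof -
  have "\<bar>kern N p q z\<bar> \<le> (\<Sum>k\<in>modes N. \<bar>kcoef p q k * mode p q k z\<bar>)"
    unfolding kern_def by (rule sum_abs)
  also have "\<dots> \<le> (\<Sum>k\<in>modes N. 4 * 1)"
    unfolding abs_mult using kcoef_le[OF _ assms] kcoef_nonneg
    by (intro sum_mono mult_mono abs_mode_le) (auto simp: abs_of_nonneg)
  finally show ?thesis by (simp add: card_modes)
qed

lemma abs_cos_diff_le: "\<bar>cos x - cos y\<bar> \<le> \<bar>x - y\<bar>" for x y :: real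
proof -
  have "norm (cos x - cos y) \<le> 1 * norm (x - y)"
    by (rule field_differentiable_bound[of UNIV _ "\<lambda>x. - sin x"]) (auto intro!: derivative_eq_intros)
  then show ?thesis by simp
qed

text \<open>This transfers bounds from a grid to the whole square. Growth of order
  \<open>N ^ 3\<close> is harmless, since the grid is polynomially fine in \<open>n\<close>.\<close>

lemma kern_lipschitz:
  assumes "p + q \<le> 2"
  shows "\<bar>kern N p q z - kern N p q z'\<bar> \<le> 8 * pi * real N ^ 3 * (\<bar>fst z - fst z'\<bar> + \<bar>snd z - snd z'\<bar>)"
proof -
  have m: "\<bar>mode p q k z - mode p q k z'\<bar> \<le> 2 * pi * real N * (\<bar>fst z - fst z'\<bar> + \<bar>snd z - snd z'\<bar>)"
    if "k \<in> modes N" for k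
  proof -
    define A A' B B' where "A = cos (freq (fst k) * fst z + real p * (pi / 2))" and "A' = cos (freq (fst k) * fst z' + real p * (pi / 2))"
      and "B = cos (freq (snd k) * snd z + real q * (pi / 2))" and "B' = cos (freq (snd k) * snd z' + real q * (pi / 2))"
    have f: "freq (fst k) \<le> 2 * pi * real N" "freq (snd k) \<le> 2 * pi * real N" "0 \<le> freq (fst k)" "0 \<le> freq (snd k)"
      using that by (auto simp: freq_def modes_def)
    have "\<bar>A - A'\<bar> \<le> \<bar>freq (fst k) * fst z - freq (fst k) * fst z'\<bar>"
      using abs_cos_diff_le[of "freq (fst k) * fst z + real p * (pi / 2)" "freq (fst k) * fst z' + real p * (pi / 2)"]
      by (simp add: A_def A'_def)
    also have "\<dots> \<le> 2 * pi * real N * \<bar>fst z - fst z'\<bar>"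
      unfolding right_diff_distrib[symmetric] abs_mult using f by (intro mult_right_mono) auto
    finally have 1: "\<bar>A - A'\<bar> \<le> 2 * pi * real N * \<bar>fst z - fst z'\<bar>" .
    have "\<bar>B - B'\<bar> \<le> \<bar>freq (snd k) * snd z - freq (snd k) * snd z'\<bar>"
      using abs_cos_diff_le[of "freq (snd k) * snd z + real q * (pi / 2)" "freq (snd k) * snd z' + real q * (pi / 2)"]
      by (simp add: B_def B'_def)
    also have "\<dots> \<le> 2 * pi * real N * \<bar>snd z - snd z'\<bar>"
      unfolding right_diff_distrib[symmetric] abs_mult using f by (intro mult_right_mono) auto
    finally have 2: "\<bar>B - B'\<bar> \<le> 2 * pi * real N * \<bar>snd z - snd z'\<bar>" .
    have "\<bar>A * B - A' * B'\<bar> = \<bar>(A - A') * B + A' * (B - B')\<bar>" by (simp add: algebra_simps)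
    also have "\<dots> \<le> \<bar>A - A'\<bar> * \<bar>B\<bar> + \<bar>A'\<bar> * \<bar>B - B'\<bar>" by (metis abs_mult abs_triangle_ineq)
    also have "\<dots> \<le> \<bar>A - A'\<bar> * 1 + 1 * \<bar>B - B'\<bar>"
      by (intro add_mono mult_mono) (auto simp: A'_def B_def)
    finally show ?thesis using 1 2 unfolding mode_def A_def[symmetric] A'_def[symmetric] B_def[symmetric] B'_def[symmetric]
      by (simp add: distrib_left)
  qed
  have "\<bar>kern N p q z - kern N p q z'\<bar> = \<bar>\<Sum>k\<in>modes N. kcoef p q k * (mode p q k z - mode p q k z')\<bar>"
    by (simp add: kern_def sum_subtractf right_diff_distrib)
  also have "\<dots> \<le> (\<Sum>k\<in>modes N. \<bar>kcoef p q k * (mode p q k z - mode p q k z')\<bar>)" by (rule sum_abs)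
  also have "\<dots> \<le> (\<Sum>k\<in>modes N. 4 * (2 * pi * real N * (\<bar>fst z - fst z'\<bar> + \<bar>snd z - snd z'\<bar>)))"
    unfolding abs_mult using kcoef_le[OF _ assms] kcoef_nonneg
    by (intro sum_mono mult_mono m) (auto simp: abs_of_nonneg)
  finally show ?thesis by (simp add: card_modes power2_eq_square power3_eq_cube algebra_simps)
qed

lemma kern_has_derivative:
  "(kern N p q has_derivative (\<lambda>v. kern N (Suc p) q z * fst v + kern N p (Suc q) z * snd v)) (at z)"
proof -
  have s: "cos (x + real (Suc p) * (pi / 2)) = - sin (x + real p * (pi / 2))" for x p
  proof -
    have "x + real (Suc p) * (pi / 2) = (x + real p * (pi / 2)) + pi / 2" by (simp add: algebra_simps add_divide_distrib)
    then show ?thesis by (simp only: cos_add) simp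
  qed
  have c: "kcoef (Suc p) q k = kcoef p q k * freq (fst k)" "kcoef p (Suc q) k = kcoef p q k * freq (snd k)" for k
    by (simp_all add: kcoef_def)
  have m: "((\<lambda>z. kcoef p q k * mode p q k z) has_derivative
     (\<lambda>v. kcoef (Suc p) q k * mode (Suc p) q k z * fst v + kcoef p (Suc q) k * mode p (Suc q) k z * snd v)) (at z)" for k
    unfolding mode_def s c
    by (auto intro!: derivative_eq_intros simp: fun_eq_iff algebra_simps)
  have "((\<lambda>z. \<Sum>k\<in>modes N. kcoef p q k * mode p q k z) has_derivative
     (\<lambda>v. \<Sum>k\<in>modes N. kcoef (Suc p) q k * mode (Suc p) q k z * fst v + kcoef p (Suc q) k * mode p (Suc q) k z * snd v)) (at z)"
    by (rule has_derivative_sum) (rule m)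
  then show ?thesis
    by (simp add: kern_def[abs_def] sum.distrib sum_distrib_right)
qed

section \<open>Logarithmic growth of the Green function at the origin\<close>

definition green_sum :: "nat \<Rightarrow> real" where
  "green_sum N = (\<Sum>k\<in>modes N. 4 / ((freq (fst k))\<^sup>2 + (freq (snd k))\<^sup>2))"

lemma kern_at_0: "kern N 0 0 0 = green_sum N" "kern N 1 0 0 = 0" "kern N 0 1 0 = 0"
  by (simp_all add: kern_def mode_def kcoef_def green_sum_def)

lemma green_sum_le: "green_sum N \<le> 4 * (real N)\<^sup>2"
  using abs_kern_le[of 0 0 N 0] by (simp add: kern_at_0)

lemma green_sum_nonneg: "0 \<le> green_sum N"
  unfolding green_sum_def by (intro sum_nonneg) simp

lemma sum_inverse_squares_le: "(\<Sum>a=1..N. 1 / (real a)\<^sup>2) \<le> 2"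
proof -
  have "(\<Sum>a=1..N. 1 / (real a)\<^sup>2) \<le> 2 - 1 / real N" if "1 \<le> N"
    using that
  proof (induction N rule: dec_induct)
    case (step N)
    have "1 / (real (Suc N))\<^sup>2 \<le> 1 / real N - 1 / real (Suc N)"
      using step(1) by (simp add: divide_simps power2_eq_square)
    then show ?case using step by simp
  qed simp
  then show ?thesis by (cases "1 \<le> N") (auto intro: order_trans)
qed

lemma arctan_diff_le:
  assumes "0 \<le> u" "u \<le> v"
  shows "arctan v - arctan u \<le> (v - u) / (1 + u\<^sup>2)"
proof (cases "u = v")
  case False
  then have "u < v" using assms by simp
  then obtain z where z: "u < z" "z < v" "arctan v - arctan u = (v - u) * inverse (1 + z\<^sup>2)"
    using MVT2[of u v arctan "\<lambda>x. inverse (1 + x\<^sup>2)"] DERIV_arctan by blast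
  have "u\<^sup>2 \<le> z\<^sup>2" using z assms by (intro power_mono) auto
  then have "inverse (1 + z\<^sup>2) \<le> inverse (1 + u\<^sup>2)" by (intro le_imp_inverse_le) (auto intro: add_pos_nonneg)
  then have "(v - u) * inverse (1 + z\<^sup>2) \<le> (v - u) * inverse (1 + u\<^sup>2)" using assms by (intro mult_left_mono) auto
  then show ?thesis using z by (simp add: divide_inverse)
qed simp

text \<open>
  The inner sum is compared with \<open>\<integral> db / (a\<^sup>2 + b\<^sup>2)\<close>, i.e. with increments of \<open>arctan (b / a) / a\<close>; the total
  angle \<open>\<pi> / 2\<close> of the quadrant is the source of the constant \<open>1 / (4 \<pi>)\<close>.
\<close>

lemma green_sum_ge: "(pi / 2 * ln (real N + 1) - 3) / pi\<^sup>2 \<le> green_sum N"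
proof -
  have row: "(\<Sum>b=1..N. 1 / ((real a)\<^sup>2 + (real b)\<^sup>2)) \<ge> pi / 2 * (1 / real a) - 1 / (real N + 1) - 1 / (real a)\<^sup>2"
    if "1 \<le> a" for a
  proof -
    have a0: "0 < real a" using that by simp
    have "1 / real a * (arctan (real (Suc b) / real a) - arctan (real b / real a)) \<le> 1 / ((real a)\<^sup>2 + (real b)\<^sup>2)" for b
    proof -
      have "arctan (real (Suc b) / real a) - arctan (real b / real a) \<le> (real (Suc b) / real a - real b / real a) / (1 + (real b / real a)\<^sup>2)"
        using a0 by (intro arctan_diff_le) (auto simp: divide_right_mono)
      also have "real (Suc b) / real a - real b / real a = 1 / real a"
        by (simp add: diff_divide_distrib[symmetric])
      also have "1 / real a / (1 + (real b / real a)\<^sup>2) = real a / ((real a)\<^sup>2 + (real b)\<^sup>2)"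
        using a0 by (simp add: field_simps power2_eq_square)
      finally have "1 / real a * (arctan (real (Suc b) / real a) - arctan (real b / real a)) \<le> 1 / real a * (real a / ((real a)\<^sup>2 + (real b)\<^sup>2))"
        using a0 by (intro mult_left_mono) auto
      then show ?thesis using a0 by simp
    qed
    then have "(\<Sum>b=1..N. 1 / ((real a)\<^sup>2 + (real b)\<^sup>2)) \<ge> (\<Sum>b=1..N. 1 / real a * (arctan (real (Suc b) / real a) - arctan (real b / real a)))"
      by (intro sum_mono)
    also have "(\<Sum>b=1..N. 1 / real a * (arctan (real (Suc b) / real a) - arctan (real b / real a)))
      = 1 / real a * (arctan (real (Suc N) / real a) - arctan (real 1 / real a))"
      unfolding sum_distrib_left[symmetric] by (subst sum_Suc_diff) auto
    finally have 1: "1 / real a * (arctan (real (Suc N) / real a) - arctan (real 1 / real a)) \<le> (\<Sum>b=1..N. 1 / ((real a)\<^sup>2 + (real b)\<^sup>2))" .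
    note t = arctan_le_self
    \<comment> \<open>Reflection turns the missing tail beyond \<open>N\<close> into an angle of at
      most \<open>a / (N + 1)\<close>.\<close>
    have "arctan (real (Suc N) / real a) = pi / 2 - arctan (real a / real (Suc N))"
      using arctan_inverse[of "real a / real (Suc N)"] a0 by (simp add: field_simps)
    also have "\<dots> \<ge> pi / 2 - real a / real (Suc N)"
      using t[of "real a / real (Suc N)"] by simp
    finally have "1 / real a * (pi / 2 - real a / real (Suc N) - 1 / real a) \<le> 1 / real a * (arctan (real (Suc N) / real a) - arctan (real 1 / real a))"
      using t[of "1 / real a"] a0 by (intro mult_left_mono) auto
    also have "1 / real a * (pi / 2 - real a / real (Suc N) - 1 / real a) = pi / 2 * (1 / real a) - 1 / (real N + 1) - 1 / (real a)\<^sup>2"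
      using a0 by (simp add: right_diff_distrib power2_eq_square add.commute)
    finally show ?thesis using 1 by linarith
  qed
  \<comment> \<open>The 3 is 1 for the tails of all rows beyond \<open>N\<close> plus 2, the bound
    for the sum of inverse squares, for the angles lost by starting each row at
    \<open>b = 1\<close>.\<close>
  have "pi / 2 * ln (real N + 1) - 3 \<le> pi / 2 * harm N - 1 - 2"
    using ln_le_harm[of N] by simp
  also have "\<dots> \<le> pi / 2 * (\<Sum>a=1..N. 1 / real a) - (\<Sum>a=1..N. 1 / (real N + 1)) - (\<Sum>a=1..N. 1 / (real a)\<^sup>2)"
  proof -
    have "(\<Sum>a=1..N. 1 / (real N + 1)) \<le> 1" by (simp add: divide_le_eq)
    then show ?thesis
      using sum_inverse_squares_le[of N] unfolding harm_def inverse_eq_divide by linarith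
  qed
  also have "\<dots> = (\<Sum>a=1..N. pi / 2 * (1 / real a) - 1 / (real N + 1) - 1 / (real a)\<^sup>2)"
    by (simp add: sum_subtractf sum_distrib_left)
  also have "\<dots> \<le> (\<Sum>a=1..N. \<Sum>b=1..N. 1 / ((real a)\<^sup>2 + (real b)\<^sup>2))"
    by (intro sum_mono row) auto
  also have "\<dots> = pi\<^sup>2 * green_sum N"
  proof -
    have "pi\<^sup>2 * (4 / ((freq a)\<^sup>2 + (freq b)\<^sup>2)) = 1 / ((real a)\<^sup>2 + (real b)\<^sup>2)" for a b
    proof -
      have "(freq a)\<^sup>2 + (freq b)\<^sup>2 = 4 * pi\<^sup>2 * ((real a)\<^sup>2 + (real b)\<^sup>2)"
        by (simp add: freq_def power_mult_distrib distrib_left)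
      then show ?thesis by simp
    qed
    then show ?thesis
      by (simp add: green_sum_def modes_def sum.cartesian_product sum_distrib_left case_prod_unfold)
  qed
  finally show ?thesis by (simp add: divide_le_eq mult.commute)
qed

section \<open>Orthogonality of the modes under the uniform law\<close>

abbreviation unif_interval :: "real measure" where
  "unif_interval \<equiv> uniform_measure lborel {0<..<1}"

abbreviation unif_square :: "(real \<times> real) measure" where
  "unif_square \<equiv> uniform_measure lborel ({0<..<1} \<times> {0<..<1})"

lemma prob_space_unif_interval: "prob_space unif_interval"
  by (rule prob_space_uniform_measure) auto

lemma unif_square_eq_pair: "unif_square = unif_interval \<Otimes>\<^sub>M unif_interval"
proof -
  interpret U: prob_space unif_interval by (rule prob_space_unif_interval)
  have "unif_interval \<Otimes>\<^sub>M unif_interval =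
      density (lborel \<Otimes>\<^sub>M lborel) (\<lambda>(x,y). indicator {0<..<1::real} x * indicator {0<..<1::real} y :: ennreal)"
    using U.sigma_finite_measure_axioms unfolding uniform_measure_def
    by (subst pair_measure_density) (auto intro: sigma_finite_lborel simp: divide_ennreal_def)
  also have "\<dots> = unif_square"
    unfolding lborel_prod uniform_measure_def
    using lborel_prod[symmetric, where 'a = real and 'b = real]
    by (intro arg_cong2[where f = density] refl ext)
      (auto simp: lborel_prod[symmetric] lborel.emeasure_pair_measure_Times indicator_def)
  finally show ?thesis ..
qed

lemma prob_space_unif_square: "prob_space unif_square"
proof -
  interpret U: prob_space unif_interval by (rule prob_space_unif_interval)
  interpret UU: pair_prob_space unif_interval unif_interval ..
  show ?thesis unfolding unif_square_eq_pair by (rule UU.prob_space_axioms)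
qed

lemma integrable_unif_square:
  fixes f :: "real \<times> real \<Rightarrow> real"
  assumes "f \<in> borel_measurable borel" "\<And>z. \<bar>f z\<bar> \<le> B"
  shows "integrable unif_square f"
proof -
  interpret prob_space unif_square by (rule prob_space_unif_square)
  show ?thesis using assms by (intro integrable_const_bound[where B = B]) auto
qed

lemma integral_unif_square_times:
  fixes f g :: "real \<Rightarrow> real"
  assumes f: "f \<in> borel_measurable borel" "\<And>z. \<bar>f z\<bar> \<le> B" and g: "g \<in> borel_measurable borel" "\<And>z. \<bar>g z\<bar> \<le> B"
  shows "(\<integral>z. f (fst z) * g (snd z) \<partial>unif_square) = (\<integral>x. f x \<partial>unif_interval) * (\<integral>y. g y \<partial>unif_interval)"
proof -
  interpret U: prob_space unif_interval by (rule prob_space_unif_interval)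
  interpret UU: pair_prob_space unif_interval unif_interval ..
  note [measurable] = f(1) g(1)
  have "\<bar>f (fst z) * g (snd z)\<bar> \<le> B * B" for z
    unfolding abs_mult using f(2)[of 0] by (intro mult_mono f g) auto
  then have int: "integrable (unif_interval \<Otimes>\<^sub>M unif_interval) (\<lambda>z. f (fst z) * g (snd z))"
    by (intro UU.integrable_const_bound[where B = "B * B"]) auto
  show ?thesis
    unfolding unif_square_eq_pair UU.integral_fst'[OF int, symmetric] by simp
qed

lemma integral_unif_interval_FTC:
  assumes F: "\<And>x::real. (F has_real_derivative f x) (at x)" and f: "continuous_on UNIV f"
  shows "(\<integral>x. f x \<partial>unif_interval) = F 1 - F 0"
proof -
  have [measurable]: "f \<in> borel_measurable borel" using f by (rule borel_measurable_continuous_onI)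
  have "(\<integral>x. f x \<partial>unif_interval) = (\<integral>x. indicator {0<..<1} x * f x \<partial>lborel)"
  proof -
    have "unif_interval = density lborel (\<lambda>x. ennreal (indicator {0<..<1} x))"
      unfolding uniform_measure_def by (intro arg_cong2[where f = density] refl ext) (simp add: ennreal_indicator divide_ennreal_def)
    then show ?thesis by (simp add: integral_density)
  qed
  also have "\<dots> = (\<integral>x. f x * indicator {0..1} x \<partial>lborel)"
  proof (rule integral_cong_AE)
    show "AE x in lborel. indicator {0<..<1} x * f x = f x * indicator {0..1} x"
      using AE_lborel_singleton[of "0::real"] AE_lborel_singleton[of "1::real"]
      by eventually_elim (auto simp: indicator_def)
  qed auto
  also have "\<dots> = F 1 - F 0"
    using F f by (intro integral_FTC_Icc_real) (auto simp: continuous_on_eq_continuous_at)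
  finally show ?thesis .
qed

text \<open>By periodicity the base point \<open>x\<close> disappears from the result. This is the
  source of the stationarity of the random potential.\<close>

lemma integral_unif_interval_cos:
  fixes k :: int
  shows "(\<integral>z. cos (2 * pi * real_of_int k * (x - z) + \<phi>) \<partial>unif_interval) = (if k = 0 then cos \<phi> else 0)"
proof (cases "k = 0")
  case True
  interpret U: prob_space unif_interval by (rule prob_space_unif_interval)
  show ?thesis using True by (simp add: U.prob_space)
next
  case False
  define w where "w = 2 * pi * real_of_int k"
  have w: "w \<noteq> 0" "sin w = 0" "cos w = 1" using False by (simp_all add: w_def)
  have "(\<integral>z. cos (w * (x - z) + \<phi>) \<partial>unif_interval) = - sin (w * (x - 1) + \<phi>) / w - - sin (w * (x - 0) + \<phi>) / w"
    using w by (intro integral_unif_interval_FTC) (auto intro!: derivative_eq_intros continuous_intros)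
  also have "sin (w * (x - 1) + \<phi>) = sin ((w * x + \<phi>) - w)" by (simp add: algebra_simps)
  also have "\<dots> = sin (w * x + \<phi>)" using w by (simp add: sin_diff)
  finally show ?thesis using False by (simp add: w_def)
qed

text \<open>The product is half the sum of the cosines with frequencies \<open>a - b\<close> and
  \<open>a + b\<close>; the latter is never zero, and the former carries no phase, so the value is
  independent of \<open>\<phi>\<close>.\<close>

lemma integral_unif_interval_cos_cos:
  assumes "1 \<le> a" "1 \<le> b"
  shows "(\<integral>z. cos (freq a * (x - z) + \<phi>) * cos (freq b * (x - z) + \<phi>) \<partial>unif_interval) = (if a = b then 1 / 2 else 0)"
proof -
  interpret U: prob_space unif_interval by (rule prob_space_unif_interval)
  define k l where "k = int a - int b" and "l = int a + int b"
  have eq: "cos (freq a * (x - z) + \<phi>) * cos (freq b * (x - z) + \<phi>) =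
    cos (2 * pi * real_of_int k * (x - z) + 0) / 2 + cos (2 * pi * real_of_int l * (x - z) + 2 * \<phi>) / 2" for z
    unfolding cos_times_cos freq_def k_def l_def by (simp add: algebra_simps add_divide_distrib)
  have i: "integrable unif_interval (\<lambda>z. cos (2 * pi * real_of_int k * (x - z) + c) / 2)" for k c
    by (intro integrable_divide U.integrable_const_bound[where B = 1]) auto
  have "(\<integral>z. cos (freq a * (x - z) + \<phi>) * cos (freq b * (x - z) + \<phi>) \<partial>unif_interval) =
    (\<integral>z. cos (2 * pi * real_of_int k * (x - z) + 0) \<partial>unif_interval) / 2
    + (\<integral>z. cos (2 * pi * real_of_int l * (x - z) + 2 * \<phi>) \<partial>unif_interval) / 2"
    unfolding eq by (subst Bochner_Integration.integral_add[OF i i]) simp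
  also have "\<dots> = (if a = b then 1 / 2 else 0)"
    unfolding integral_unif_interval_cos using assms by (auto simp: k_def l_def)
  finally show ?thesis .
qed

lemma borel_measurable_kern [measurable]: "kern N p q \<in> borel_measurable borel"
  by (intro borel_measurable_continuous_onI continuous_on_kern)

lemma integral_mode:
  assumes "k \<in> modes N"
  shows "(\<integral>z. mode p q k (x - z) \<partial>unif_square) = 0"
proof -
  have "(\<integral>z. cos (freq (fst k) * (fst x - fst z) + real p * (pi / 2)) * cos (freq (snd k) * (snd x - snd z) + real q * (pi / 2)) \<partial>unif_square)
    = (\<integral>z. cos (freq (fst k) * (fst x - z) + real p * (pi / 2)) \<partial>unif_interval) *
      (\<integral>z. cos (freq (snd k) * (snd x - z) + real q * (pi / 2)) \<partial>unif_interval)"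
    by (rule integral_unif_square_times[where B = 1]) auto
  also have "(\<integral>z. cos (freq (fst k) * (fst x - z) + real p * (pi / 2)) \<partial>unif_interval) = 0"
    using integral_unif_interval_cos[of "int (fst k)" "fst x" "real p * (pi / 2)"] assms by (auto simp: freq_def modes_def)
  finally show ?thesis by (simp add: mode_def)
qed

lemma integral_mode_mode:
  assumes "k \<in> modes N" "l \<in> modes N"
  shows "(\<integral>z. mode p q k (x - z) * mode p q l (x - z) \<partial>unif_square) = (if k = l then 1 / 4 else 0)"
proof -
  have "(\<integral>z. (cos (freq (fst k) * (fst x - fst z) + real p * (pi / 2)) * cos (freq (fst l) * (fst x - fst z) + real p * (pi / 2)))
      * (cos (freq (snd k) * (snd x - snd z) + real q * (pi / 2)) * cos (freq (snd l) * (snd x - snd z) + real q * (pi / 2))) \<partial>unif_square)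
    = (\<integral>z. cos (freq (fst k) * (fst x - z) + real p * (pi / 2)) * cos (freq (fst l) * (fst x - z) + real p * (pi / 2)) \<partial>unif_interval) *
      (\<integral>z. cos (freq (snd k) * (snd x - z) + real q * (pi / 2)) * cos (freq (snd l) * (snd x - z) + real q * (pi / 2)) \<partial>unif_interval)"
    by (rule integral_unif_square_times[where B = 1]) (auto simp: abs_mult intro!: mult_le_one)
  also have "\<dots> = (if k = l then 1 / 4 else 0)"
    using assms by (subst (1 2) integral_unif_interval_cos_cos) (auto simp: modes_def prod_eq_iff)
  finally show ?thesis by (simp add: mode_def mult_ac)
qed

lemma borel_measurable_mode [measurable]: "mode p q k \<in> borel_measurable borel"
  unfolding mode_def[abs_def] by (intro borel_measurable_continuous_onI continuous_intros)

lemma integral_kern: "(\<integral>z. kern N p q (x - z) \<partial>unif_square) = 0"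
proof -
  have i: "integrable unif_square (\<lambda>z. mode p q k (x - z))" for k
    by (rule integrable_unif_square[where B = 1]) (auto intro: abs_mode_le)
  show ?thesis
    unfolding kern_def using i integral_mode by (subst Bochner_Integration.integral_sum) (auto intro!: sum.neutral)
qed

text \<open>The squared L2 norm of \<open>kern N p q\<close> by Parseval; \<open>1 / 4\<close> is
  the mean square of a product of two cosines.\<close>

definition kern_energy :: "nat \<Rightarrow> nat \<Rightarrow> nat \<Rightarrow> real" where
  "kern_energy N p q = (\<Sum>k\<in>modes N. (kcoef p q k)\<^sup>2 / 4)"

lemma integral_kern_power2:
  "(\<integral>z. (kern N p q (x - z))\<^sup>2 \<partial>unif_square) = kern_energy N p q"
proof -
  have i: "integrable unif_square (\<lambda>z. kcoef p q k * kcoef p q l * (mode p q k (x - z) * mode p q l (x - z)))" for k l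
    by (intro integrable_mult_right integrable_unif_square[where B = 1])
       (auto simp: abs_mult intro!: mult_le_one abs_mode_le)
  have "(\<integral>z. (kern N p q (x - z))\<^sup>2 \<partial>unif_square) =
     (\<integral>z. (\<Sum>k\<in>modes N. \<Sum>l\<in>modes N. kcoef p q k * kcoef p q l * (mode p q k (x - z) * mode p q l (x - z))) \<partial>unif_square)"
    by (simp add: kern_def power2_eq_square sum_product mult_ac)
  also have "\<dots> = (\<Sum>k\<in>modes N. \<Sum>l\<in>modes N. kcoef p q k * kcoef p q l * (if k = l then 1 / 4 else 0))"
    using i by (subst Bochner_Integration.integral_sum, simp, intro sum.cong refl)
      (subst Bochner_Integration.integral_sum, auto simp: integral_mode_mode intro!: sum.cong)
  also have "\<dots> = kern_energy N p q"
    unfolding kern_energy_def by (intro sum.cong refl) (simp add: power2_eq_square if_distrib sum.delta' cong: if_cong)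
  finally show ?thesis .
qed

lemma kern_energy_le:
  assumes "p + q \<le> 2"
  shows "kern_energy N p q \<le> 4 * (real N)\<^sup>2"
proof -
  have "(kcoef p q k)\<^sup>2 / 4 \<le> 4" if "k \<in> modes N" for k
    using power_mono[OF kcoef_le[OF that assms] kcoef_nonneg, of 2] by simp
  then have "(\<Sum>k\<in>modes N. (kcoef p q k)\<^sup>2 / 4) \<le> (\<Sum>k\<in>modes N. 4)" by (rule sum_mono)
  then show ?thesis unfolding kern_energy_def by (simp add: card_modes)
qed

text \<open>Green's identity, read off mode by mode. It makes the pairing and the gradient energy
  agree to leading order, so that twice the first minus the second leaves exactly one copy of
  \<open>green_sum N\<close>.\<close>

lemma kern_energy_gradient:
  "kern_energy N 1 0 + kern_energy N 0 1 = green_sum N"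
  unfolding kern_energy_def green_sum_def sum.distrib[symmetric]
proof (intro sum.cong refl)
  fix k assume "k \<in> modes N"
  define u v where "u = freq (fst k)" and "v = freq (snd k)"
  have "1 \<le> u" using \<open>k \<in> modes N\<close> by (auto simp: u_def modes_def intro!: freq_ge_1)
  define s where "s = u\<^sup>2 + v\<^sup>2"
  have "0 < s" using \<open>1 \<le> u\<close> unfolding s_def by (intro add_pos_nonneg) auto
  have "(4 * u / s)\<^sup>2 / 4 + (4 * v / s)\<^sup>2 / 4 = 4 * s / s\<^sup>2"
    unfolding s_def power_divide by (simp add: power_mult_distrib add_divide_distrib distrib_left)
  then show "(kcoef 1 0 k)\<^sup>2 / 4 + (kcoef 0 1 k)\<^sup>2 / 4 = 4 / ((freq (fst k))\<^sup>2 + (freq (snd k))\<^sup>2)"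
    unfolding kcoef_def u_def[symmetric] v_def[symmetric] s_def[symmetric] using \<open>0 < s\<close>
    by (simp add: power2_eq_square)
qed

text \<open>Since \<open>a\<^sup>2 + b\<^sup>2\<close> is at least \<open>2 * a * b\<close>, the
  squared coefficients are dominated by a product of two convergent series. Independence of
  \<open>N\<close> is the point: it keeps the derivative of the cutoff from producing a
  logarithm.\<close>

lemma kern_energy_0_le: "kern_energy N 0 0 \<le> 4"
proof -
  have "(kcoef 0 0 k)\<^sup>2 / 4 \<le> 1 / (real (fst k))\<^sup>2 * (1 / (real (snd k))\<^sup>2)" if "k \<in> modes N" for k
  proof -
    define a b where "a = real (fst k)" and "b = real (snd k)"
    have ab: "1 \<le> a" "1 \<le> b" using that by (auto simp: a_def b_def modes_def)
    have "1 \<le> pi * pi" using pi_gt3 by (intro mult_ge1_I) auto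
    \<comment> \<open>Replacing \<open>4 * pi\<^sup>2\<close> by the crude factor 2 turns the bound
      on \<open>kcoef\<close> into exactly \<open>1 / (a * b)\<close>.\<close>
    then have "2 * a * b * (1 * 2) \<le> (a\<^sup>2 + b\<^sup>2) * (pi * pi * 4)"
      using ab sum_squares_bound[of a b] by (intro mult_mono) auto
    also have "\<dots> = (freq (fst k))\<^sup>2 + (freq (snd k))\<^sup>2"
      by (simp add: freq_def a_def b_def power2_eq_square algebra_simps)
    finally have "kcoef 0 0 k \<le> 4 / (2 * a * b * (1 * 2))"
      using ab frac_le[of 4 4 "2 * a * b * (1 * 2)" "(freq (fst k))\<^sup>2 + (freq (snd k))\<^sup>2"] by (simp add: kcoef_def)
    then have "(kcoef 0 0 k)\<^sup>2 \<le> (4 / (2 * a * b * (1 * 2)))\<^sup>2"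
      using kcoef_nonneg by (intro power_mono) auto
    also have "\<dots> = 1 / a\<^sup>2 * (1 / b\<^sup>2)" by (simp add: power2_eq_square)
    finally have "(kcoef 0 0 k)\<^sup>2 \<le> 1 / a\<^sup>2 * (1 / b\<^sup>2)" .
    then show ?thesis unfolding a_def b_def using zero_le_power2[of "kcoef 0 0 k"] by linarith
  qed
  then have "(\<Sum>k\<in>modes N. (kcoef 0 0 k)\<^sup>2 / 4) \<le> (\<Sum>k\<in>modes N. 1 / (real (fst k))\<^sup>2 * (1 / (real (snd k))\<^sup>2))"
    by (rule sum_mono)
  also have "\<dots> = (\<Sum>a=1..N. 1 / (real a)\<^sup>2) * (\<Sum>b=1..N. 1 / (real b)\<^sup>2)"
    unfolding modes_def sum_product sum.cartesian_product by (simp add: case_prod_unfold)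
  also have "\<dots> \<le> 2 * 2"
    by (intro mult_mono sum_inverse_squares_le sum_nonneg) auto
  finally show ?thesis unfolding kern_energy_def by simp
qed

section \<open>Dual potentials\<close>

text \<open>
  The second-order vanishing of \<open>\<psi>\<close> at the endpoints makes both the potential \<open>F\<close> and its gradient vanish
  on the boundary of the square. This is what the free exchange of mass with the boundary requires of
  a dual potential.
\<close>

locale cutoff =
  fixes \<psi> \<psi>' \<psi>'' :: "real \<Rightarrow> real" and C :: real
  assumes deriv: "(\<psi> has_real_derivative \<psi>' t) (at t)" "(\<psi>' has_real_derivative \<psi>'' t) (at t)"
    and boundary: "\<psi> 0 = 0" "\<psi> 1 = 0" "\<psi>' 0 = 0" "\<psi>' 1 = 0"
    and range: "0 \<le> t \<Longrightarrow> t \<le> 1 \<Longrightarrow> 0 \<le> \<psi> t" "0 \<le> t \<Longrightarrow> t \<le> 1 \<Longrightarrow> \<psi> t \<le> 1"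
    and bound: "0 \<le> t \<Longrightarrow> t \<le> 1 \<Longrightarrow> \<bar>\<psi>' t\<bar> \<le> C" "0 \<le> t \<Longrightarrow> t \<le> 1 \<Longrightarrow> \<bar>\<psi>'' t\<bar> \<le> C" "1 \<le> C"

text \<open>The outer square gives the double zeros at the endpoints, and for a polynomial
  smoothness and bounds on the compact interval are automatic. As \<open>k\<close> grows, the
  function tends to 1 inside the interval.\<close>

lemma exists_cutoff:
  fixes k :: nat
  shows "\<exists>\<psi>' \<psi>'' C. cutoff (\<lambda>t. (1 - (2 * t - 1) ^ (2 * k))\<^sup>2) \<psi>' \<psi>'' C"
proof -
  define q :: "real poly" where "q = 1 - [:-1, 2:] ^ (2 * k)"
  have q: "poly q t = 1 - (2 * t - 1) ^ (2 * k)" for t by (simp add: q_def algebra_simps)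
  define p where "p = q\<^sup>2"
  have p: "poly p t = (1 - (2 * t - 1) ^ (2 * k))\<^sup>2" for t by (simp add: p_def q)
  have p': "poly (pderiv p) t = 2 * poly q t * poly (pderiv q) t" for t
    by (simp add: p_def power2_eq_square pderiv_mult)
  have "\<exists>B. \<forall>t\<in>{0..1}. \<bar>poly r t\<bar> \<le> B" for r :: "real poly"
  proof -
    have "compact ((\<lambda>t. \<bar>poly r t\<bar>) ` {0..1})"
      by (intro compact_continuous_image continuous_intros) auto
    then have "bdd_above ((\<lambda>t. \<bar>poly r t\<bar>) ` {0..1})"
      by (intro bounded_imp_bdd_above compact_imp_bounded)
    then show ?thesis by (auto simp: bdd_above_def)
  qed
  then obtain B1 B2 where B: "\<And>t. 0 \<le> t \<Longrightarrow> t \<le> 1 \<Longrightarrow> \<bar>poly (pderiv p) t\<bar> \<le> B1"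
      "\<And>t. 0 \<le> t \<Longrightarrow> t \<le> 1 \<Longrightarrow> \<bar>poly (pderiv (pderiv p)) t\<bar> \<le> B2" by (metis atLeastAtMost_iff)
  have u: "0 \<le> (2 * t - 1) ^ (2 * k)" "(2 * t - 1) ^ (2 * k) \<le> 1" if "0 \<le> t" "t \<le> 1" for t :: real
  proof -
    show "0 \<le> (2 * t - 1) ^ (2 * k)" by (simp add: power_mult)
    have "(2 * t - 1)\<^sup>2 \<le> 1" using that by (simp add: abs_square_le_1)
    then show "(2 * t - 1) ^ (2 * k) \<le> 1" by (simp add: power_mult power_le_one)
  qed
  have "cutoff (poly p) (poly (pderiv p)) (poly (pderiv (pderiv p))) (max 1 (max B1 B2))"
  proof
    fix t :: real assume t: "0 \<le> t" "t \<le> 1"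
    show "0 \<le> poly p t" "poly p t \<le> 1" using u[OF t] unfolding p by (auto intro!: power_le_one)
    show "\<bar>poly (pderiv p) t\<bar> \<le> max 1 (max B1 B2)" "\<bar>poly (pderiv (pderiv p)) t\<bar> \<le> max 1 (max B1 B2)"
      using B[OF t] by auto
  qed (rule poly_DERIV, rule poly_DERIV, simp_all add: p p' q)
  moreover have "poly p = (\<lambda>t. (1 - (2 * t - 1) ^ (2 * k))\<^sup>2)" by (simp add: p fun_eq_iff)
  ultimately show ?thesis by metis
qed

text \<open>Taylor's formula along the segment, which stays in \<open>S\<close>. Entrywise bounds by
  \<open>B\<close> bound the quadratic form of the Hessian by \<open>2 * B\<close> times the squared
  distance, and the factor one half of Taylor's formula leaves \<open>B\<close>.\<close>

lemma second_order_upper_bound: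
  fixes f fx fy fxx fxy fyy :: "real \<times> real \<Rightarrow> real"
  assumes d: "\<And>z. (f has_derivative (\<lambda>v. fx z * fst v + fy z * snd v)) (at z)"
      "\<And>z. (fx has_derivative (\<lambda>v. fxx z * fst v + fxy z * snd v)) (at z)"
      "\<And>z. (fy has_derivative (\<lambda>v. fxy z * fst v + fyy z * snd v)) (at z)"
    and S: "convex S" "x \<in> S" "y \<in> S"
    and B: "\<And>z. z \<in> S \<Longrightarrow> \<bar>fxx z\<bar> \<le> B" "\<And>z. z \<in> S \<Longrightarrow> \<bar>fxy z\<bar> \<le> B" "\<And>z. z \<in> S \<Longrightarrow> \<bar>fyy z\<bar> \<le> B"
  shows "f x \<le> f y + fx y * (fst x - fst y) + fy y * (snd x - snd y) + B * (dist x y)\<^sup>2"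
proof -
  define a b where "a = fst x - fst y" and "b = snd x - snd y"
  define c where "c = (\<lambda>t::real. y + t *\<^sub>R (x - y))"
  have c: "(c has_derivative (\<lambda>s. s *\<^sub>R (x - y))) (at t)" for t
    unfolding c_def by (auto intro!: derivative_eq_intros)
  have [simp]: "fst (x - y) = a" "snd (x - y) = b" by (simp_all add: a_def b_def)
  define diff where "diff = (\<lambda>k::nat. if k = 0 then \<lambda>t. f (c t) else if k = 1 then \<lambda>t. fx (c t) * a + fy (c t) * b
     else (\<lambda>t. (fxx (c t) * a + fxy (c t) * b) * a + (fxy (c t) * a + fyy (c t) * b) * b))"
  have e0: "((\<lambda>t. f (c t)) has_real_derivative (fx (c t) * a + fy (c t) * b)) (at t)"
    and e1: "((\<lambda>t. fx (c t)) has_real_derivative (fxx (c t) * a + fxy (c t) * b)) (at t)"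
    and e2: "((\<lambda>t. fy (c t)) has_real_derivative (fxy (c t) * a + fyy (c t) * b)) (at t)" for t
    unfolding has_field_derivative_def
    by (rule has_derivative_eq_rhs[OF has_derivative_compose[OF c d(1)]]
        has_derivative_eq_rhs[OF has_derivative_compose[OF c d(2)]]
        has_derivative_eq_rhs[OF has_derivative_compose[OF c d(3)]],
        simp add: fun_eq_iff a_def b_def algebra_simps)+
  have "\<forall>m t. m < 2 \<and> 0 \<le> t \<and> t \<le> 1 \<longrightarrow> DERIV (diff m) t :> diff (Suc m) t"
  proof (intro allI impI)
    fix m :: nat and t :: real assume "m < 2 \<and> 0 \<le> t \<and> t \<le> 1"
    then have "m = 0 \<or> m = 1" by auto
    then show "DERIV (diff m) t :> diff (Suc m) t"
      using e0 by (auto simp: diff_def intro!: derivative_eq_intros e1 e2)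
  qed
  from Taylor[of 2 diff "diff 0" 0 1 0 1, OF _ _ this] obtain t where t: "0 < t" "t < 1"
    and eq: "diff 0 1 = (\<Sum>m<2. diff m 0 / fact m * (1 - 0) ^ m) + diff 2 t / fact 2 * (1 - 0)\<^sup>2"
    by auto
  have "c t = (1 - t) *\<^sub>R y + t *\<^sub>R x" by (simp add: c_def algebra_simps)
  then have "c t \<in> S" using S t by (simp add: convexD)
  note b' = B[OF this]
  have "fxx (c t) * a\<^sup>2 \<le> B * a\<^sup>2" "fyy (c t) * b\<^sup>2 \<le> B * b\<^sup>2"
    using b' by (auto intro!: mult_right_mono)
  moreover have "2 * (fxy (c t) * (a * b)) \<le> B * (a\<^sup>2 + b\<^sup>2)"
  proof -
    have "2 * (fxy (c t) * (a * b)) \<le> \<bar>fxy (c t)\<bar> * (2 * \<bar>a * b\<bar>)"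
      by (metis abs_ge_self abs_mult mult.left_commute mult_left_mono zero_le_numeral)
    also have "\<dots> \<le> B * (a\<^sup>2 + b\<^sup>2)"
      using sum_squares_bound[of "\<bar>a\<bar>" "\<bar>b\<bar>"] b' by (intro mult_mono) (auto simp: abs_mult)
    finally show ?thesis .
  qed
  moreover have "diff 2 t = fxx (c t) * a\<^sup>2 + 2 * (fxy (c t) * (a * b)) + fyy (c t) * b\<^sup>2"
    by (simp add: diff_def power2_eq_square algebra_simps)
  moreover have "(dist x y)\<^sup>2 = a\<^sup>2 + b\<^sup>2"
    by (simp add: dist_prod_def dist_real_def a_def b_def)
  moreover have "f x = f y + (fx y * a + fy y * b) + diff 2 t / 2"
    using eq by (simp add: numeral_2_eq_2 diff_def c_def)
  ultimately show ?thesis unfolding a_def[symmetric] b_def[symmetric] by (simp add: distrib_left)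
qed

lemma closure_unit_square: "closure ({0<..<1} \<times> {0<..<1} :: (real \<times> real) set) = {0..1} \<times> {0..1}"
  by (simp add: closure_Times)

lemma frontier_unit_square: "frontier ({0<..<1} \<times> {0<..<1} :: (real \<times> real) set) = {0..1} \<times> {0..1} - {0<..<1} \<times> {0<..<1}"
  by (simp add: frontier_def closure_unit_square interior_open open_Times)

section \<open>Cut-off potentials as dual competitors\<close>

context cutoff begin

text \<open>In all uses \<open>H p q\<close> is the derivative of order \<open>p\<close> and
  \<open>q\<close> of one field. Passing the whole family keeps derivatives explicit, and they come
  for free from the kernel.\<close>

definition F :: "(nat \<Rightarrow> nat \<Rightarrow> real \<times> real \<Rightarrow> real) \<Rightarrow> real \<times> real \<Rightarrow> real" where
  "F H z = \<psi> (fst z) * \<psi> (snd z) * H 0 0 z"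

definition Fx :: "(nat \<Rightarrow> nat \<Rightarrow> real \<times> real \<Rightarrow> real) \<Rightarrow> real \<times> real \<Rightarrow> real" where
  "Fx H z = \<psi>' (fst z) * \<psi> (snd z) * H 0 0 z + \<psi> (fst z) * \<psi> (snd z) * H 1 0 z"

definition Fy :: "(nat \<Rightarrow> nat \<Rightarrow> real \<times> real \<Rightarrow> real) \<Rightarrow> real \<times> real \<Rightarrow> real" where
  "Fy H z = \<psi> (fst z) * \<psi>' (snd z) * H 0 0 z + \<psi> (fst z) * \<psi> (snd z) * H 0 1 z"

text \<open>Young's inequality is weighted asymmetrically: the gradient of the field, which carries
  the logarithm, loses only the factor \<open>1 + \<tau>\<close>, while the large factor
  \<open>1 + 1 / \<tau>\<close> falls on the field itself, whose variance is bounded.\<close>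

lemma gradient_bound:
  assumes z: "z \<in> {0..1} \<times> {0..1}" and \<tau>: "0 < \<tau>"
  shows "(Fx H z)\<^sup>2 + (Fy H z)\<^sup>2 \<le> (1 + \<tau>) * ((H 1 0 z)\<^sup>2 + (H 0 1 z)\<^sup>2) + (1 + 1 / \<tau>) * (2 * C\<^sup>2 * (H 0 0 z)\<^sup>2)"
proof -
  have young: "(r * u + s * v)\<^sup>2 \<le> (1 + \<tau>) * v\<^sup>2 + (1 + 1 / \<tau>) * (C\<^sup>2 * u\<^sup>2)"
    if "\<bar>r\<bar> \<le> C" "\<bar>s\<bar> \<le> 1" for r s u v :: real
  proof -
    define p q where "p = r * u" and "q = s * v"
    have "r\<^sup>2 \<le> C\<^sup>2" "s\<^sup>2 \<le> 1" using that by (auto simp: abs_le_square_iff[symmetric] abs_square_le_1)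
    then have pq: "p\<^sup>2 \<le> C\<^sup>2 * u\<^sup>2" "q\<^sup>2 \<le> v\<^sup>2"
      unfolding p_def q_def power_mult_distrib by (auto intro!: mult_right_mono mult_left_le_one_le)
    have "0 \<le> (\<tau> * q - p)\<^sup>2 / \<tau>" using \<tau> by simp
    also have "\<dots> = \<tau> * q\<^sup>2 + p\<^sup>2 / \<tau> - 2 * p * q" using \<tau> by (simp add: power2_eq_square field_simps)
    finally have "(p + q)\<^sup>2 \<le> (1 + \<tau>) * q\<^sup>2 + (1 + 1 / \<tau>) * p\<^sup>2" by (simp add: power2_eq_square algebra_simps)
    also have "\<dots> \<le> (1 + \<tau>) * v\<^sup>2 + (1 + 1 / \<tau>) * (C\<^sup>2 * u\<^sup>2)"
      using pq \<tau> by (intro add_mono mult_left_mono) auto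
    finally show ?thesis by (simp add: p_def q_def)
  qed
  have r: "\<bar>\<psi> (fst z)\<bar> \<le> 1" "\<bar>\<psi> (snd z)\<bar> \<le> 1" "\<bar>\<psi>' (fst z)\<bar> \<le> C" "\<bar>\<psi>' (snd z)\<bar> \<le> C"
    using z range bound by (auto simp: abs_of_nonneg)
  have "\<bar>\<psi>' (fst z) * \<psi> (snd z)\<bar> \<le> C * 1" "\<bar>\<psi> (fst z) * \<psi>' (snd z)\<bar> \<le> 1 * C" "\<bar>\<psi> (fst z) * \<psi> (snd z)\<bar> \<le> 1 * 1"
    unfolding abs_mult
    by (intro mult_mono r abs_ge_zero order_trans[OF zero_le_one bound(3)] zero_le_one)+
  then have "(Fx H z)\<^sup>2 \<le> (1 + \<tau>) * (H 1 0 z)\<^sup>2 + (1 + 1 / \<tau>) * (C\<^sup>2 * (H 0 0 z)\<^sup>2)"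
    "(Fy H z)\<^sup>2 \<le> (1 + \<tau>) * (H 0 1 z)\<^sup>2 + (1 + 1 / \<tau>) * (C\<^sup>2 * (H 0 0 z)\<^sup>2)"
    unfolding Fx_def Fy_def by (auto intro!: young)
  then show ?thesis by (simp add: algebra_simps)
qed

text \<open>Each second derivative of \<open>F H\<close> is a sum of four products of two cutoff
  factors and one derivative of the field. As \<open>1 \<le> C\<close>, the constant
  \<open>C\<close> bounds \<open>\<psi>\<close> as well as its derivatives, which gives
  \<open>4 * (C\<^sup>2 * \<delta>)\<close>.\<close>

lemma F_upper_bound:
  assumes H: "\<forall>p q z. p + q \<le> 1 \<longrightarrow> (H p q has_derivative (\<lambda>v. H (Suc p) q z * fst v + H p (Suc q) z * snd v)) (at z)"
    and \<delta>: "\<forall>p q. \<forall>z\<in>{0..1} \<times> {0..1}. p + q \<le> 2 \<longrightarrow> \<bar>H p q z\<bar> \<le> \<delta>"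
    and x: "x \<in> {0..1} \<times> {0..1}" and y: "y \<in> {0..1} \<times> {0..1}"
  shows "F H x \<le> F H y + Fx H y * (fst x - fst y) + Fy H y * (snd x - snd y) + 4 * (C\<^sup>2 * \<delta>) * (dist x y)\<^sup>2"
proof (rule second_order_upper_bound)
  have H': "(H 0 0 has_derivative (\<lambda>v. H 1 0 z * fst v + H 0 1 z * snd v)) (at z)"
    "(H 1 0 has_derivative (\<lambda>v. H 2 0 z * fst v + H 1 1 z * snd v)) (at z)"
    "(H 0 1 has_derivative (\<lambda>v. H 1 1 z * fst v + H 0 2 z * snd v)) (at z)" for z
    using H[rule_format, of 0 0 z] H[rule_format, of 1 0 z] H[rule_format, of 0 1 z] by (simp_all add: numeral_2_eq_2)
  have D: "((\<lambda>z. \<psi> (fst z)) has_derivative (\<lambda>v. \<psi>' (fst z) * fst v)) (at z)"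
    "((\<lambda>z. \<psi>' (fst z)) has_derivative (\<lambda>v. \<psi>'' (fst z) * fst v)) (at z)"
    "((\<lambda>z. \<psi> (snd z)) has_derivative (\<lambda>v. \<psi>' (snd z) * snd v)) (at z)"
    "((\<lambda>z. \<psi>' (snd z)) has_derivative (\<lambda>v. \<psi>'' (snd z) * snd v)) (at z)" for z :: "real \<times> real"
    by (rule has_derivative_compose[OF has_derivative_fst[OF has_derivative_ident] deriv(1)[unfolded has_field_derivative_def]]
        has_derivative_compose[OF has_derivative_fst[OF has_derivative_ident] deriv(2)[unfolded has_field_derivative_def]]
        has_derivative_compose[OF has_derivative_snd[OF has_derivative_ident] deriv(1)[unfolded has_field_derivative_def]]
        has_derivative_compose[OF has_derivative_snd[OF has_derivative_ident] deriv(2)[unfolded has_field_derivative_def]])+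
  show "(F H has_derivative (\<lambda>v. Fx H z * fst v + Fy H z * snd v)) (at z)" for z
    unfolding F_def[abs_def] Fx_def Fy_def
    by (rule has_derivative_eq_rhs, (rule derivative_intros D H')+) (simp add: fun_eq_iff algebra_simps)
  show "(Fx H has_derivative (\<lambda>v.
      (\<psi>'' (fst z) * \<psi> (snd z) * H 0 0 z + \<psi>' (fst z) * \<psi> (snd z) * H 1 0 z + \<psi>' (fst z) * \<psi> (snd z) * H 1 0 z + \<psi> (fst z) * \<psi> (snd z) * H 2 0 z) * fst v +
      (\<psi>' (fst z) * \<psi>' (snd z) * H 0 0 z + \<psi>' (fst z) * \<psi> (snd z) * H 0 1 z + \<psi> (fst z) * \<psi>' (snd z) * H 1 0 z + \<psi> (fst z) * \<psi> (snd z) * H 1 1 z) * snd v)) (at z)" for z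
    unfolding Fx_def[abs_def]
    by (rule has_derivative_eq_rhs, (rule derivative_intros D H')+) (simp add: fun_eq_iff algebra_simps)
  show "(Fy H has_derivative (\<lambda>v.
      (\<psi>' (fst z) * \<psi>' (snd z) * H 0 0 z + \<psi>' (fst z) * \<psi> (snd z) * H 0 1 z + \<psi> (fst z) * \<psi>' (snd z) * H 1 0 z + \<psi> (fst z) * \<psi> (snd z) * H 1 1 z) * fst v +
      (\<psi> (fst z) * \<psi>'' (snd z) * H 0 0 z + \<psi> (fst z) * \<psi>' (snd z) * H 0 1 z + \<psi> (fst z) * \<psi>' (snd z) * H 0 1 z + \<psi> (fst z) * \<psi> (snd z) * H 0 2 z) * snd v)) (at z)" for z
    unfolding Fy_def[abs_def]
    by (rule has_derivative_eq_rhs, (rule derivative_intros D H')+) (simp add: fun_eq_iff algebra_simps)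
  show "convex ({0..1} \<times> {0..1} :: (real \<times> real) set)" by (intro convex_Times) auto
  have t: "\<bar>a * b * c\<bar> \<le> C\<^sup>2 * \<delta>" if "\<bar>a\<bar> \<le> C" "\<bar>b\<bar> \<le> C" "\<bar>c\<bar> \<le> \<delta>" for a b c
    unfolding abs_mult power2_eq_square using that bound(3) by (intro mult_mono) auto
  fix z :: "real \<times> real" assume z: "z \<in> {0..1} \<times> {0..1}"
  have r: "\<bar>\<psi> (fst z)\<bar> \<le> C" "\<bar>\<psi> (snd z)\<bar> \<le> C" "\<bar>\<psi>' (fst z)\<bar> \<le> C" "\<bar>\<psi>' (snd z)\<bar> \<le> C"
     "\<bar>\<psi>'' (fst z)\<bar> \<le> C" "\<bar>\<psi>'' (snd z)\<bar> \<le> C"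
    using z range bound by (auto simp: abs_of_nonneg intro: order_trans[OF _ bound(3)])
  have h: "\<bar>H 0 0 z\<bar> \<le> \<delta>" "\<bar>H 1 0 z\<bar> \<le> \<delta>" "\<bar>H 0 1 z\<bar> \<le> \<delta>" "\<bar>H 2 0 z\<bar> \<le> \<delta>" "\<bar>H 1 1 z\<bar> \<le> \<delta>" "\<bar>H 0 2 z\<bar> \<le> \<delta>"
    by (rule \<delta>[rule_format, OF z]; simp)+
  have four: "\<bar>a + b + c + d\<bar> \<le> 4 * e" if "\<bar>a\<bar> \<le> e" "\<bar>b\<bar> \<le> e" "\<bar>c\<bar> \<le> e" "\<bar>d\<bar> \<le> e" for a b c d e :: real
    using that by linarith
  show "\<bar>\<psi>'' (fst z) * \<psi> (snd z) * H 0 0 z + \<psi>' (fst z) * \<psi> (snd z) * H 1 0 z + \<psi>' (fst z) * \<psi> (snd z) * H 1 0 z + \<psi> (fst z) * \<psi> (snd z) * H 2 0 z\<bar> \<le> 4 * (C\<^sup>2 * \<delta>)"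
    "\<bar>\<psi>' (fst z) * \<psi>' (snd z) * H 0 0 z + \<psi>' (fst z) * \<psi> (snd z) * H 0 1 z + \<psi> (fst z) * \<psi>' (snd z) * H 1 0 z + \<psi> (fst z) * \<psi> (snd z) * H 1 1 z\<bar> \<le> 4 * (C\<^sup>2 * \<delta>)"
    "\<bar>\<psi> (fst z) * \<psi>'' (snd z) * H 0 0 z + \<psi> (fst z) * \<psi>' (snd z) * H 0 1 z + \<psi> (fst z) * \<psi>' (snd z) * H 0 1 z + \<psi> (fst z) * \<psi> (snd z) * H 0 2 z\<bar> \<le> 4 * (C\<^sup>2 * \<delta>)"
    by (intro four t r h)+
qed (fact x y)+

lemma F_frontier:
  assumes "z \<in> frontier ({0<..<1} \<times> {0<..<1})"
  shows "F H z = 0" "Fx H z = 0" "Fy H z = 0"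
proof -
  have "fst z = 0 \<or> fst z = 1 \<or> snd z = 0 \<or> snd z = 1"
    using assms unfolding frontier_unit_square by (auto simp: less_le)
  then show "F H z = 0" "Fx H z = 0" "Fy H z = 0"
    using boundary by (auto simp: F_def Fx_def Fy_def)
qed

text \<open>The dual pair is \<open>2 * F H\<close> and \<open>g\<close>. Doubling the second-order
  bound produces \<open>8 * C\<^sup>2 * \<delta>\<close>, so a part \<open>1 - \<tau>\<close> of the
  squared distance remains to absorb the linear term by completing the square.\<close>

lemma Wb_power2_ge_potential:
  assumes X: "\<And>i. i \<in> {1..n} \<Longrightarrow> X i \<in> {0<..<1} \<times> {0<..<1}" and Y: "\<And>j. j \<in> {1..m} \<Longrightarrow> Y j \<in> {0<..<1} \<times> {0<..<1}"
    and H: "\<forall>p q z. p + q \<le> 1 \<longrightarrow> (H p q has_derivative (\<lambda>v. H (Suc p) q z * fst v + H p (Suc q) z * snd v)) (at z)"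
    and \<delta>: "\<forall>p q. \<forall>z\<in>{0..1} \<times> {0..1}. p + q \<le> 2 \<longrightarrow> \<bar>H p q z\<bar> \<le> \<delta>"
    and \<tau>: "8 * C\<^sup>2 * \<delta> \<le> \<tau>" "\<tau> < 1"
  shows "2 * ((\<Sum>i=1..n. 1 / real n * F H (X i)) - (\<Sum>j=1..m. 1 / real m * F H (Y j)))
      - (\<Sum>j=1..m. 1 / real m * ((Fx H (Y j))\<^sup>2 + (Fy H (Y j))\<^sup>2)) / (1 - \<tau>)
    \<le> (Wb ({0<..<1} \<times> {0<..<1}) 2 (empirical_measure n X) (empirical_measure m Y))\<^sup>2"
proof -
  let ?\<Omega> = "{0<..<1} \<times> {0<..<1} :: (real \<times> real) set"
  let ?S = "{0..1} \<times> {0..1} :: (real \<times> real) set"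
  \<comment> \<open>Minimising \<open>(1 - \<tau>) * v\<^sup>2 - 2 * p * v\<close> over
    \<open>v\<close> in each coordinate gives \<open>- p\<^sup>2 / (1 - \<tau>)\<close>;
    \<open>g\<close> is thus the transform of \<open>2 * F H\<close> computed from its quadratic
    upper bound.\<close>
  define g where "g = (\<lambda>y. - 2 * F H y - ((Fx H y)\<^sup>2 + (Fy H y)\<^sup>2) / (1 - \<tau>))"
  have key: "2 * F H x + g y \<le> (dist x y)\<^sup>2" if "x \<in> ?S" "y \<in> ?S" for x y
  proof -
    define a b p q where "a = fst x - fst y" and "b = snd x - snd y" and "p = Fx H y" and "q = Fy H y"
    have d: "(dist x y)\<^sup>2 = a\<^sup>2 + b\<^sup>2" by (simp add: dist_prod_def dist_real_def a_def b_def)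
    have "2 * F H x \<le> 2 * F H y + 2 * (p * a + q * b) + 8 * C\<^sup>2 * \<delta> * (a\<^sup>2 + b\<^sup>2)"
      using F_upper_bound[OF H \<delta> that] unfolding d a_def[symmetric] b_def[symmetric] p_def[symmetric] q_def[symmetric] by simp
    also have "\<dots> \<le> 2 * F H y + 2 * (p * a + q * b) + \<tau> * (a\<^sup>2 + b\<^sup>2)"
      using \<tau> by (intro add_left_mono mult_right_mono) auto
    finally have 1: "2 * F H x \<le> 2 * F H y + 2 * (p * a + q * b) + \<tau> * (a\<^sup>2 + b\<^sup>2)" .
    have young: "2 * (r * s) \<le> (1 - \<tau>) * s\<^sup>2 + r\<^sup>2 / (1 - \<tau>)" for r s :: real
    proof -
      have "0 \<le> ((1 - \<tau>) * s - r)\<^sup>2 / (1 - \<tau>)" using \<tau> by simp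
      also have "\<dots> = (1 - \<tau>) * s\<^sup>2 + r\<^sup>2 / (1 - \<tau>) - 2 * (r * s)"
      proof -
        have "((1 - \<tau>) * s - r)\<^sup>2 = (1 - \<tau>) * ((1 - \<tau>) * s\<^sup>2 - 2 * (r * s)) + r\<^sup>2"
          by (simp add: power2_eq_square algebra_simps)
        then show ?thesis using \<tau> by (simp add: add_divide_distrib)
      qed
      finally show ?thesis by simp
    qed
    show ?thesis
      using 1 young[of p a] young[of q b] unfolding d g_def p_def[symmetric] q_def[symmetric]
      by (simp add: add_divide_distrib algebra_simps)
  qed
  have \<Omega>: "open ?\<Omega>" by (intro open_Times) auto
  have "(0, 0) \<in> frontier ?\<Omega>" unfolding frontier_unit_square by simp
  then have fr: "frontier ?\<Omega> \<noteq> {}" by blast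
  have sub: "frontier ?\<Omega> \<subseteq> ?S" unfolding frontier_unit_square by auto
  have near: "\<exists>b\<in>frontier ?\<Omega>. infdist z (frontier ?\<Omega>) = dist z b" for z
    using infdist_attains_inf[OF frontier_closed fr] by metis
  have XS: "X i \<in> ?S" if "i \<in> {1..n}" for i using X[OF that] by (auto simp: mem_Times_iff)
  have YS: "Y j \<in> ?S" if "j \<in> {1..m}" for j using Y[OF that] by (auto simp: mem_Times_iff)
  have "(\<Sum>i=1..n. 1 / real n * (2 * F H (X i))) + (\<Sum>j=1..m. 1 / real m * g (Y j))
    \<le> (Wb ?\<Omega> 2 (empirical_measure n X) (empirical_measure m Y))\<^sup>2"
  proof (rule Wb_power2_dual[OF \<Omega> fr])
    show "X ` {1..n} \<subseteq> closure ?\<Omega>" "Y ` {1..m} \<subseteq> closure ?\<Omega>"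
      unfolding closure_unit_square using XS YS by blast+
    show "2 * F H (X i) + g (Y j) \<le> (dist (X i) (Y j))\<^sup>2" if "i \<in> {1..n}" "j \<in> {1..m}" for i j
      by (intro key XS[OF that(1)] YS[OF that(2)])
    \<comment> \<open>The constraint against the frontier is the pair inequality at the nearest
      frontier point, where both functions of the dual pair vanish.\<close>
    show "2 * F H (X i) \<le> (infdist (X i) (frontier ?\<Omega>))\<^sup>2" if i: "i \<in> {1..n}" for i
    proof -
      obtain b where b: "b \<in> frontier ?\<Omega>" "infdist (X i) (frontier ?\<Omega>) = dist (X i) b" using near[of "X i"] by (rule bexE)
      then have "2 * F H (X i) + g b \<le> (dist (X i) b)\<^sup>2" by (intro key XS[OF i] subsetD[OF sub])
      moreover have "g b = 0" using F_frontier[OF b(1)] by (simp add: g_def)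
      ultimately show ?thesis using b by simp
    qed
    show "g (Y j) \<le> (infdist (Y j) (frontier ?\<Omega>))\<^sup>2" if j: "j \<in> {1..m}" for j
    proof -
      obtain b where b: "b \<in> frontier ?\<Omega>" "infdist (Y j) (frontier ?\<Omega>) = dist (Y j) b" using near[of "Y j"] by (rule bexE)
      then have "2 * F H b + g (Y j) \<le> (dist b (Y j))\<^sup>2" by (intro key YS[OF j] subsetD[OF sub])
      then show ?thesis using b F_frontier[OF b(1)] by (simp add: dist_commute)
    qed
  qed
  moreover have "(\<Sum>j=1..m. 1 / real m * g (Y j)) = - 2 * (\<Sum>j=1..m. 1 / real m * F H (Y j))
     - (\<Sum>j=1..m. 1 / real m * ((Fx H (Y j))\<^sup>2 + (Fy H (Y j))\<^sup>2)) / (1 - \<tau>)"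
    by (simp add: g_def right_diff_distrib sum_subtractf sum_distrib_left sum_divide_distrib sum_negf diff_divide_distrib mult.assoc)
  moreover have "(\<Sum>i=1..n. 1 / real n * (2 * F H (X i))) = 2 * (\<Sum>i=1..n. 1 / real n * F H (X i))"
    by (simp add: sum_distrib_left)
  ultimately show ?thesis by (simp add: right_diff_distrib)
qed

end

section \<open>Random potentials\<close>

lemma exp_le_quadratic:
  assumes "\<bar>u\<bar> \<le> (1::real)"
  shows "exp u \<le> 1 + u + u\<^sup>2"
proof (cases "0 \<le> u")
  case True
  then show ?thesis using exp_bound[of u] assms by simp
next
  case False
  define v where "v = - u"
  have v: "0 < v" "u = - v" using False by (simp_all add: v_def)
  \<comment> \<open>The product equals \<open>1 + v ^ 3\<close>.\<close>
  have "1 \<le> (1 - v + v\<^sup>2) * (1 + v)" using v by (simp add: power2_eq_square algebra_simps)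
  also have "\<dots> \<le> (1 - v + v\<^sup>2) * exp v"
    using zero_le_power2[of "v - 1"] v by (intro mult_left_mono exp_ge_add_one_self) (simp_all add: power2_eq_square algebra_simps)
  finally show ?thesis using v by (simp add: exp_minus field_simps)
qed

context prob_space begin

text \<open>Bernstein's estimate before the choice of \<open>t\<close>. The restriction
  \<open>t * B \<le> 1\<close> makes the quadratic bound on the exponential available, so the
  exponent involves the total variance and not the square of \<open>B\<close>.\<close>

lemma chernoff_bounded_sum:
  fixes W :: "'i \<Rightarrow> 'a \<Rightarrow> real"
  assumes I: "finite I" and ind: "indep_vars (\<lambda>_. borel) W I"
    and B: "\<And>i s. i \<in> I \<Longrightarrow> \<bar>W i s\<bar> \<le> B" and mean: "\<And>i. i \<in> I \<Longrightarrow> expectation (W i) = 0"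
    and t: "0 \<le> t" "t * B \<le> 1" and V: "(\<Sum>i\<in>I. expectation (\<lambda>s. (W i s)\<^sup>2)) \<le> V"
  shows "prob {s\<in>space M. \<delta> \<le> (\<Sum>i\<in>I. W i s)} \<le> exp (t\<^sup>2 * V - t * \<delta>)"
proof -
  have [measurable]: "\<And>i. i \<in> I \<Longrightarrow> random_variable borel (W i)" using ind by (auto simp: indep_vars_def)
  have int: "integrable M (W i)" "integrable M (\<lambda>s. (W i s)\<^sup>2)" "integrable M (\<lambda>s. exp (t * W i s))" if "i \<in> I" for i
  proof -
    have B': "\<bar>W i s\<bar> \<le> B" for s using B that by blast
    show "integrable M (W i)" using that B' by (intro integrable_const_bound[where B = B]) auto
    show "integrable M (\<lambda>s. (W i s)\<^sup>2)" using that power_mono[OF B' abs_ge_zero, of _ 2]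
      by (intro integrable_const_bound[where B = "B\<^sup>2"]) auto
    have "t * W i s \<le> t * B" for s using B'[of s] t by (intro mult_left_mono) auto
    then show "integrable M (\<lambda>s. exp (t * W i s))" using that
      by (intro integrable_const_bound[where B = "exp (t * B)"]) auto
  qed
  have mgf: "expectation (\<lambda>s. exp (t * W i s)) \<le> exp (t\<^sup>2 * expectation (\<lambda>s. (W i s)\<^sup>2))" if "i \<in> I" for i
  proof -
    have "\<bar>t * W i s\<bar> \<le> 1" for s
      using mult_left_mono[OF B[OF that, of s] t(1)] t by (simp add: abs_mult)
    then have "expectation (\<lambda>s. exp (t * W i s)) \<le> expectation (\<lambda>s. 1 + t * W i s + t\<^sup>2 * (W i s)\<^sup>2)"
      using exp_le_quadratic[of "t * W i _"] int[OF that] by (intro integral_mono) (auto simp: power_mult_distrib)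
    also have "\<dots> = 1 + t\<^sup>2 * expectation (\<lambda>s. (W i s)\<^sup>2)"
      using int[OF that] mean[OF that] by (simp add: prob_space)
    also have "\<dots> \<le> exp (t\<^sup>2 * expectation (\<lambda>s. (W i s)\<^sup>2))" by (rule exp_ge_add_one_self)
    finally show ?thesis .
  qed
  have indE: "indep_vars (\<lambda>_. borel) (\<lambda>i s. exp (t * W i s)) I"
    by (rule indep_vars_compose2[OF ind]) auto
  have prodE: "exp (t * (\<Sum>i\<in>I. W i s)) = (\<Prod>i\<in>I. exp (t * W i s))" for s
    using I by (simp add: exp_sum sum_distrib_left)
  have intE: "integrable M (\<lambda>s. exp (t * (\<Sum>i\<in>I. W i s)))"
    unfolding prodE by (rule indep_vars_integrable[OF I indE int(3)])
  have "expectation (\<lambda>s. exp (t * (\<Sum>i\<in>I. W i s))) = (\<Prod>i\<in>I. expectation (\<lambda>s. exp (t * W i s)))"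
    unfolding prodE by (rule indep_vars_lebesgue_integral[OF I indE int(3)])
  also have "\<dots> \<le> (\<Prod>i\<in>I. exp (t\<^sup>2 * expectation (\<lambda>s. (W i s)\<^sup>2)))"
    using mgf by (intro prod_mono) auto
  also have "\<dots> = exp (t\<^sup>2 * (\<Sum>i\<in>I. expectation (\<lambda>s. (W i s)\<^sup>2)))"
    using I by (simp add: exp_sum sum_distrib_left)
  also have "\<dots> \<le> exp (t\<^sup>2 * V)" using V by (simp add: mult_left_mono)
  finally have E: "expectation (\<lambda>s. exp (t * (\<Sum>i\<in>I. W i s))) \<le> exp (t\<^sup>2 * V)" .
  have "prob {s\<in>space M. \<delta> \<le> (\<Sum>i\<in>I. W i s)} \<le> prob {s\<in>space M. exp (t * \<delta>) \<le> exp (t * (\<Sum>i\<in>I. W i s))}"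
    using t by (intro finite_measure_mono) (auto intro: mult_left_mono)
  also have "\<dots> \<le> expectation (\<lambda>s. exp (t * (\<Sum>i\<in>I. W i s))) / exp (t * \<delta>)"
    using intE by (intro integral_Markov_inequality_measure[where A = "{}"]) auto
  also have "\<dots> \<le> exp (t\<^sup>2 * V) / exp (t * \<delta>)" using E by (intro divide_right_mono) auto
  finally show ?thesis by (simp add: exp_diff)
qed

lemma expectation_power2_indep_sum:
  fixes W :: "'i \<Rightarrow> 'a \<Rightarrow> real"
  assumes I: "finite I" and ind: "indep_vars (\<lambda>_. borel) W I"
    and B: "\<And>i s. i \<in> I \<Longrightarrow> \<bar>W i s\<bar> \<le> B" and mean: "\<And>i. i \<in> I \<Longrightarrow> expectation (W i) = 0"
  shows "expectation (\<lambda>s. (\<Sum>i\<in>I. W i s)\<^sup>2) = (\<Sum>i\<in>I. expectation (\<lambda>s. (W i s)\<^sup>2))"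
proof -
  have [measurable]: "\<And>i. i \<in> I \<Longrightarrow> random_variable borel (W i)" using ind by (auto simp: indep_vars_def)
  have int: "integrable M (W i)" if "i \<in> I" for i
    using that B[OF that] by (intro integrable_const_bound[where B = B]) auto
  have int2: "integrable M (\<lambda>s. W i s * W j s)" if "i \<in> I" "j \<in> I" for i j
  proof (rule integrable_const_bound[where B = "B * B"])
    have "\<bar>W i s * W j s\<bar> \<le> B * B" for s
      unfolding abs_mult using B[OF that(1), of s] B[OF that(2), of s] by (intro mult_mono) auto
    then show "AE s in M. norm (W i s * W j s) \<le> B * B" by simp
  qed (use that in measurable)
  have cross: "expectation (\<lambda>s. W i s * W j s) = 0" if ij: "i \<in> I" "j \<in> I" "i \<noteq> j" for i j
  proof -
    have "indep_vars (\<lambda>_. borel) W {i, j}" using ind ij by (intro indep_vars_subset[OF ind]) auto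
    from indep_vars_lebesgue_integral[OF _ this] show ?thesis using ij int mean by auto
  qed
  have "expectation (\<lambda>s. (\<Sum>i\<in>I. W i s)\<^sup>2) = expectation (\<lambda>s. \<Sum>i\<in>I. \<Sum>j\<in>I. W i s * W j s)"
    by (simp add: power2_eq_square sum_product)
  also have "\<dots> = (\<Sum>i\<in>I. \<Sum>j\<in>I. expectation (\<lambda>s. W i s * W j s))"
    using int2 by (subst Bochner_Integration.integral_sum, auto intro!: sum.cong Bochner_Integration.integral_sum)
  also have "\<dots> = (\<Sum>i\<in>I. \<Sum>j\<in>I. if i = j then expectation (\<lambda>s. (W i s)\<^sup>2) else 0)"
    using cross by (intro sum.cong refl) (auto simp: power2_eq_square)
  finally show ?thesis using I by simp
qed

end

section \<open>Moments of the random potential\<close>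

locale uniform_sample = prob_space M for M :: "'a measure" +
  fixes I :: "'i set" and Z :: "'i \<Rightarrow> 'a \<Rightarrow> real \<times> real" and w :: "'i \<Rightarrow> real" and N :: nat
  assumes finite_I: "finite I"
    and indep: "indep_vars (\<lambda>_. borel) Z I"
    and distr_Z: "i \<in> I \<Longrightarrow> distr M borel (Z i) = unif_square"
begin

text \<open>Both samples form one independent family with signed weights \<open>w\<close>, so the
  field of the difference of the empirical measures is a single sum. A proper subset
  \<open>J\<close> omits the index of the point of evaluation and makes the field independent of
  that point.\<close>

definition potential :: "'i set \<Rightarrow> nat \<Rightarrow> nat \<Rightarrow> 'a \<Rightarrow> real \<times> real \<Rightarrow> real" where
  "potential J p q s x = (\<Sum>i\<in>J. w i * kern N p q (x - Z i s))"

lemma Z_measurable: "i \<in> I \<Longrightarrow> Z i \<in> borel_measurable M"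
  using indep by (auto simp: indep_vars_def)

lemma expectation_Z:
  fixes g :: "real \<times> real \<Rightarrow> real"
  assumes "i \<in> I" "g \<in> borel_measurable borel"
  shows "expectation (\<lambda>s. g (Z i s)) = (\<integral>x. g x \<partial>unif_square)"
  using integral_distr[OF Z_measurable[OF assms(1)] assms(2)] distr_Z[OF assms(1)] by simp

lemma indep_kern:
  assumes "J \<subseteq> I"
  shows "indep_vars (\<lambda>_. borel) (\<lambda>i s. w i * kern N p q (x - Z i s)) J"
  by (rule indep_vars_compose2[OF indep_vars_subset[OF indep assms]]) auto

lemma weighted_kern_bound:
  assumes "p + q \<le> 2"
  shows "\<bar>w i * kern N p q z\<bar> \<le> \<bar>w i\<bar> * (4 * (real N)\<^sup>2)"
  unfolding abs_mult by (intro mult_left_mono abs_kern_le assms) auto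

lemma expectation_kern: "i \<in> I \<Longrightarrow> expectation (\<lambda>s. w i * kern N p q (x - Z i s)) = 0"
  using expectation_Z[of i "\<lambda>z. w i * kern N p q (x - z)"] by (simp add: integral_kern)

lemma expectation_kern_power2:
  "i \<in> I \<Longrightarrow> expectation (\<lambda>s. (w i * kern N p q (x - Z i s))\<^sup>2) = (w i)\<^sup>2 * kern_energy N p q"
  using expectation_Z[of i "\<lambda>z. (w i * kern N p q (x - z))\<^sup>2"]
  by (simp add: power_mult_distrib integral_kern_power2)

lemma weighted_kern_bound_sum:
  assumes "p + q \<le> 2" "i \<in> J" "J \<subseteq> I"
  shows "\<bar>w i * kern N p q z\<bar> \<le> (\<Sum>i\<in>J. \<bar>w i\<bar>) * (4 * (real N)\<^sup>2)"
proof -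
  have "\<bar>w i\<bar> \<le> (\<Sum>i\<in>J. \<bar>w i\<bar>)" using finite_subset[OF assms(3) finite_I] assms(2) by (intro member_le_sum) auto
  then show ?thesis by (intro order_trans[OF weighted_kern_bound[OF assms(1)] mult_right_mono]) auto
qed

lemma potential_bound:
  assumes "p + q \<le> 2"
  shows "\<bar>potential J p q s x\<bar> \<le> (\<Sum>i\<in>J. \<bar>w i\<bar>) * (4 * (real N)\<^sup>2)"
  unfolding potential_def sum_distrib_right
  by (intro order_trans[OF sum_abs] sum_mono weighted_kern_bound assms)

lemma expectation_potential_at:
  assumes "J \<subseteq> I" "p + q \<le> 2"
  shows "expectation (\<lambda>s. potential J p q s x) = 0"
    and "expectation (\<lambda>s. (potential J p q s x)\<^sup>2) = (\<Sum>i\<in>J. (w i)\<^sup>2) * kern_energy N p q"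
proof -
  have J: "finite J" using assms finite_I finite_subset by auto
  have i: "integrable M (\<lambda>s. w i * kern N p q (x - Z i s))" if "i \<in> J" for i
  proof (rule integrable_const_bound[where B = "\<bar>w i\<bar> * (4 * (real N)\<^sup>2)"])
    have [measurable]: "Z i \<in> borel_measurable M" using Z_measurable assms that by auto
    show "(\<lambda>s. w i * kern N p q (x - Z i s)) \<in> borel_measurable M" by measurable
  qed (use weighted_kern_bound[OF assms(2)] in auto)
  show "expectation (\<lambda>s. potential J p q s x) = 0"
  proof -
    have "expectation (\<lambda>s. potential J p q s x) = (\<Sum>i\<in>J. expectation (\<lambda>s. w i * kern N p q (x - Z i s)))"
      unfolding potential_def by (rule Bochner_Integration.integral_sum[OF i])
    also have "\<dots> = 0" using assms(1) by (intro sum.neutral ballI expectation_kern) auto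
    finally show ?thesis .
  qed
  have "expectation (\<lambda>s. (potential J p q s x)\<^sup>2) = (\<Sum>i\<in>J. expectation (\<lambda>s. (w i * kern N p q (x - Z i s))\<^sup>2))"
    unfolding potential_def
  proof (rule expectation_power2_indep_sum[OF J indep_kern[OF assms(1)]])
    show "\<bar>w i * kern N p q (x - Z i s)\<bar> \<le> (\<Sum>i\<in>J. \<bar>w i\<bar>) * (4 * (real N)\<^sup>2)" if "i \<in> J" for i s
      by (rule weighted_kern_bound_sum[OF assms(2) that assms(1)])
    show "expectation (\<lambda>s. w i * kern N p q (x - Z i s)) = 0" if "i \<in> J" for i
      using assms(1) that by (intro expectation_kern) auto
  qed
  also have "\<dots> = (\<Sum>i\<in>J. (w i)\<^sup>2 * kern_energy N p q)"
    using assms by (intro sum.cong refl expectation_kern_power2) auto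
  finally show "expectation (\<lambda>s. (potential J p q s x)\<^sup>2) = (\<Sum>i\<in>J. (w i)\<^sup>2) * kern_energy N p q"
    by (simp add: sum_distrib_right)
qed

text \<open>The joint law of \<open>Z j\<close> and of the remaining points is a product, so Fubini
  allows averaging over the field first, at a fixed point of evaluation.\<close>

lemma expectation_freeze:
  assumes j: "j \<in> I" "j \<notin> J" "J \<subseteq> I"
    and G: "G \<in> borel_measurable (borel \<Otimes>\<^sub>M PiM J (\<lambda>_. borel))" "\<And>z. \<bar>G z\<bar> \<le> (K :: real)"
  shows "expectation (\<lambda>s. G (Z j s, restrict (\<lambda>i. Z i s) J)) = (\<integral>x. expectation (\<lambda>s. G (x, restrict (\<lambda>i. Z i s) J)) \<partial>unif_square)"
proof -
  define A where "A = (\<lambda>s. restrict (\<lambda>i. Z i s) {j})"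
  define B where "B = (\<lambda>s. restrict (\<lambda>i. Z i s) J)"
  let ?S = "PiM {j} (\<lambda>_. borel) :: ('i \<Rightarrow> real \<times> real) measure" and ?T = "PiM J (\<lambda>_. borel) :: ('i \<Rightarrow> real \<times> real) measure"
  note G(1)[measurable]
  have "indep_var ?S A ?T B"
    unfolding A_def B_def using j by (intro indep_var_restrict[OF indep]) auto
  then have A[measurable]: "A \<in> measurable M ?S" and B[measurable]: "B \<in> measurable M ?T"
    and eq: "distr M ?S A \<Otimes>\<^sub>M distr M ?T B = distr M (?S \<Otimes>\<^sub>M ?T) (\<lambda>s. (A s, B s))"
    unfolding indep_var_distribution_eq by auto
  interpret DA: prob_space "distr M ?S A" by (rule prob_space_distr[OF A])
  interpret DB: prob_space "distr M ?T B" by (rule prob_space_distr[OF B])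
  interpret D: pair_prob_space "distr M ?S A" "distr M ?T B" ..
  \<comment> \<open>Independence is stated for restricted families, so the single variable appears
    as a family over \<open>{j}\<close> and is read off at \<open>j\<close>.\<close>
  define G' where "G' = (\<lambda>z. G (fst z j, snd z))"
  have [measurable]: "G' \<in> borel_measurable (?S \<Otimes>\<^sub>M ?T)" unfolding G'_def by measurable
  have "G' \<in> borel_measurable (distr M ?S A \<Otimes>\<^sub>M distr M ?T B)"
    by (subst measurable_cong_sets[OF sets_pair_measure_cong[of _ ?S _ ?T] refl]) auto
  then have int: "integrable (distr M ?S A \<Otimes>\<^sub>M distr M ?T B) G'"
    using G(2) by (intro D.integrable_const_bound[where B = K]) (auto simp: G'_def)
  have "expectation (\<lambda>s. G (Z j s, B s)) = expectation (\<lambda>s. G' (A s, B s))" by (simp add: G'_def A_def)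
  also have "\<dots> = (\<integral>z. G' z \<partial>distr M (?S \<Otimes>\<^sub>M ?T) (\<lambda>s. (A s, B s)))"
    by (rule integral_distr[symmetric]) measurable
  also have "\<dots> = (\<integral>x. (\<integral>y. G' (x, y) \<partial>distr M ?T B) \<partial>distr M ?S A)"
    unfolding eq[symmetric] D.integral_fst'[OF int] ..
  also have "\<dots> = (\<integral>x. expectation (\<lambda>s. G (x j, B s)) \<partial>distr M ?S A)"
  proof (rule Bochner_Integration.integral_cong[OF refl])
    fix x assume "x \<in> space (distr M ?S A)"
    then have [measurable]: "x \<in> space ?S" by simp
    show "(\<integral>y. G' (x, y) \<partial>distr M ?T B) = expectation (\<lambda>s. G (x j, B s))"
      by (subst integral_distr) (auto simp: G'_def intro!: measurable_compose[OF _ G(1)])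
  qed
  also have "\<dots> = expectation (\<lambda>t. expectation (\<lambda>s. G (A t j, B s)))"
  proof (rule integral_distr[OF A])
    show "(\<lambda>x. expectation (\<lambda>s. G (x j, B s))) \<in> borel_measurable ?S"
      by (rule borel_measurable_lebesgue_integral) measurable
  qed
  also have "\<dots> = expectation (\<lambda>t. expectation (\<lambda>s. G (Z j t, B s)))" by (simp add: A_def)
  also have "\<dots> = (\<integral>x. expectation (\<lambda>s. G (x, B s)) \<partial>unif_square)"
    by (rule expectation_Z[OF j(1)]) (rule borel_measurable_lebesgue_integral, measurable)
  finally show ?thesis by (simp add: B_def)
qed

lemma potential_measurable [measurable]:
  assumes "J \<subseteq> I" "g \<in> borel_measurable M"
  shows "(\<lambda>s. potential J p q s (g s)) \<in> borel_measurable M"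
proof -
  note assms(2)[measurable]
  have [measurable]: "i \<in> J \<Longrightarrow> Z i \<in> borel_measurable M" for i using Z_measurable assms by auto
  show ?thesis unfolding potential_def by measurable
qed

text \<open>Once the evaluation point is frozen, the moments no longer depend on it, so the outer
  average is over a constant. The weighted first moment vanishes since the field is centred at every
  point.\<close>

lemma expectation_potential_other:
  assumes j: "j \<in> I" "j \<notin> J" "J \<subseteq> I" "p + q \<le> 2"
  shows "expectation (\<lambda>s. (potential J p q s (Z j s))\<^sup>2) = (\<Sum>i\<in>J. (w i)\<^sup>2) * kern_energy N p q"
    and "g \<in> borel_measurable borel \<Longrightarrow> (\<And>x. \<bar>g x\<bar> \<le> K) \<Longrightarrow> expectation (\<lambda>s. g (Z j s) * potential J p q s (Z j s)) = 0"
proof -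
  interpret U: prob_space unif_square by (rule prob_space_unif_square)
  define P where "P = (\<lambda>(x, \<omega>). \<Sum>i\<in>J. w i * kern N p q (x - \<omega> i))"
  have P: "P (x, restrict (\<lambda>i. Z i s) J) = potential J p q s x" for x s
    by (simp add: P_def potential_def)
  have [measurable]: "P \<in> borel_measurable (borel \<Otimes>\<^sub>M PiM J (\<lambda>_. borel))"
    unfolding P_def case_prod_unfold by measurable
  define K' where "K' = (\<Sum>i\<in>J. \<bar>w i\<bar>) * (4 * (real N)\<^sup>2)"
  have Pb: "\<bar>P z\<bar> \<le> K'" for z
    unfolding P_def case_prod_unfold K'_def sum_distrib_right
    by (intro order_trans[OF sum_abs] sum_mono weighted_kern_bound j)
  have "expectation (\<lambda>s. (P (Z j s, restrict (\<lambda>i. Z i s) J))\<^sup>2) = (\<integral>x. expectation (\<lambda>s. (P (x, restrict (\<lambda>i. Z i s) J))\<^sup>2) \<partial>unif_square)"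
    using power_mono[OF Pb abs_ge_zero, of _ 2]
    by (intro expectation_freeze[where G = "\<lambda>z. (P z)\<^sup>2" and K = "K'\<^sup>2"] j) auto
  then show "expectation (\<lambda>s. (potential J p q s (Z j s))\<^sup>2) = (\<Sum>i\<in>J. (w i)\<^sup>2) * kern_energy N p q"
    unfolding P expectation_potential_at[OF j(3,4)] using U.prob_space by simp
  show "expectation (\<lambda>s. g (Z j s) * potential J p q s (Z j s)) = 0"
    if g: "g \<in> borel_measurable borel" "\<And>x. \<bar>g x\<bar> \<le> K"
  proof -
    note [measurable] = g(1)
    have b: "\<bar>g (fst z) * P z\<bar> \<le> K * K'" for z
      unfolding abs_mult using g(2)[of "fst z"] Pb[of z] by (intro mult_mono) auto
    have "expectation (\<lambda>s. g (fst (Z j s, restrict (\<lambda>i. Z i s) J)) * P (Z j s, restrict (\<lambda>i. Z i s) J)) =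
      (\<integral>x. expectation (\<lambda>s. g (fst (x, restrict (\<lambda>i. Z i s) J)) * P (x, restrict (\<lambda>i. Z i s) J)) \<partial>unif_square)"
      using b by (intro expectation_freeze[where G = "\<lambda>z. g (fst z) * P z" and K = "K * K'"] j) auto
    then show ?thesis
      unfolding P fst_conv by (simp add: expectation_potential_at[OF j(3,4)])
  qed
qed

lemma potential_split:
  assumes "j \<in> I"
  shows "potential I p q s (Z j s) = w j * kern N p q 0 + potential (I - {j}) p q s (Z j s)"
  unfolding potential_def using finite_I assms by (subst sum.remove[of I j]) auto

text \<open>Given \<open>Z j\<close>, the field of the other points is centred; what remains is the
  deterministic self-interaction \<open>w j * green_sum N\<close>. The sign of \<open>w j\<close>
  squares away in the later weighted sum.\<close>

lemma expectation_pairing: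
  assumes j: "j \<in> I" and g: "g \<in> borel_measurable borel" "\<And>x. \<bar>g x\<bar> \<le> K"
  shows "expectation (\<lambda>s. g (Z j s) * potential I 0 0 s (Z j s)) = w j * green_sum N * (\<integral>x. g x \<partial>unif_square)"
proof -
  note [measurable] = g(1) Z_measurable[OF j]
  have 1: "integrable M (\<lambda>s. g (Z j s) * (w j * green_sum N))"
    using g(2) by (intro integrable_mult_left integrable_const_bound[where B = K]) auto
  have "\<bar>g (Z j s) * potential (I - {j}) 0 0 s (Z j s)\<bar> \<le> K * ((\<Sum>i\<in>I - {j}. \<bar>w i\<bar>) * (4 * (real N)\<^sup>2))" for s
    unfolding abs_mult using g(2)[of 0] by (intro mult_mono g potential_bound) auto
  then have 2: "integrable M (\<lambda>s. g (Z j s) * potential (I - {j}) 0 0 s (Z j s))"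
    by (intro integrable_const_bound) auto
  have "expectation (\<lambda>s. g (Z j s) * potential I 0 0 s (Z j s)) =
    expectation (\<lambda>s. g (Z j s) * (w j * green_sum N)) + expectation (\<lambda>s. g (Z j s) * potential (I - {j}) 0 0 s (Z j s))"
    unfolding potential_split[OF j] kern_at_0 distrib_left by (rule Bochner_Integration.integral_add[OF 1 2])
  also have "expectation (\<lambda>s. g (Z j s) * potential (I - {j}) 0 0 s (Z j s)) = 0"
    using j g by (intro expectation_potential_other(2)[where K = K]) auto
  also have "expectation (\<lambda>s. g (Z j s) * (w j * green_sum N)) = w j * green_sum N * (\<integral>x. g x \<partial>unif_square)"
    using expectation_Z[OF j g(1)] by simp
  finally show ?thesis by simp
qed

text \<open>
  The self-interaction of \<open>Z j\<close> does not contribute, since the gradient of the even function \<open>kern N 0 0\<close>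
  vanishes at the origin.
\<close>

lemma expectation_gradient_le:
  assumes j: "j \<in> I"
  shows "expectation (\<lambda>s. (potential I 1 0 s (Z j s))\<^sup>2) + expectation (\<lambda>s. (potential I 0 1 s (Z j s))\<^sup>2)
    \<le> (\<Sum>i\<in>I. (w i)\<^sup>2) * green_sum N"
proof -
  have "expectation (\<lambda>s. (potential I 1 0 s (Z j s))\<^sup>2) + expectation (\<lambda>s. (potential I 0 1 s (Z j s))\<^sup>2)
    = (\<Sum>i\<in>I - {j}. (w i)\<^sup>2) * kern_energy N 1 0 + (\<Sum>i\<in>I - {j}. (w i)\<^sup>2) * kern_energy N 0 1"
    using j by (simp only: potential_split[OF j] kern_at_0) (simp add: expectation_potential_other(1))
  also have "\<dots> = (\<Sum>i\<in>I - {j}. (w i)\<^sup>2) * green_sum N"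
    by (simp add: kern_energy_gradient[symmetric] distrib_left)
  also have "\<dots> \<le> (\<Sum>i\<in>I. (w i)\<^sup>2) * green_sum N"
    using finite_I by (intro mult_right_mono sum_mono2 green_sum_nonneg) auto
  finally show ?thesis .
qed

text \<open>Unlike for the gradient, the self-interaction survives here and contributes the square
  of \<open>green_sum N\<close>. The mixed term vanishes because the rest of the field is centred,
  and the rest has bounded energy.\<close>

lemma expectation_potential_power2_le:
  assumes j: "j \<in> I"
  shows "expectation (\<lambda>s. (potential I 0 0 s (Z j s))\<^sup>2) \<le> (w j)\<^sup>2 * (green_sum N)\<^sup>2 + 4 * (\<Sum>i\<in>I. (w i)\<^sup>2)"
proof -
  note [measurable] = Z_measurable[OF j]
  define b where "b = (\<lambda>s. potential (I - {j}) 0 0 s (Z j s))"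
  define B where "B = (\<Sum>i\<in>I - {j}. \<bar>w i\<bar>) * (4 * (real N)\<^sup>2)"
  have bb: "\<bar>b s\<bar> \<le> B" for s unfolding b_def B_def by (rule potential_bound) simp
  have [measurable]: "b \<in> borel_measurable M" unfolding b_def by measurable
  have i: "integrable M b" "integrable M (\<lambda>s. (b s)\<^sup>2)"
    using bb power_mono[OF bb abs_ge_zero, of _ 2]
    by (auto intro!: integrable_const_bound[where B = B and f = b] integrable_const_bound[where B = "B\<^sup>2" and f = "\<lambda>s. (b s)\<^sup>2"])
  have e: "expectation b = 0" "expectation (\<lambda>s. (b s)\<^sup>2) = (\<Sum>i\<in>I - {j}. (w i)\<^sup>2) * kern_energy N 0 0"
    using expectation_potential_other(2)[of j "I - {j}" 0 0 "\<lambda>_. 1" 1] expectation_potential_other(1)[of j "I - {j}" 0 0] j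
    by (simp_all add: b_def)
  have "expectation (\<lambda>s. (potential I 0 0 s (Z j s))\<^sup>2) = expectation (\<lambda>s. (w j * green_sum N)\<^sup>2 + 2 * (w j * green_sum N) * b s + (b s)\<^sup>2)"
    unfolding potential_split[OF j] kern_at_0 b_def by (simp add: power2_sum algebra_simps)
  also have "\<dots> = (w j * green_sum N)\<^sup>2 + expectation (\<lambda>s. (b s)\<^sup>2)"
    using i by (simp add: e(1) prob_space)
  also have "\<dots> \<le> (w j)\<^sup>2 * (green_sum N)\<^sup>2 + (\<Sum>i\<in>I. (w i)\<^sup>2) * 4"
    unfolding e(2) power_mult_distrib using finite_I
    by (intro add_mono order_refl mult_mono sum_mono2 kern_energy_0_le sum_nonneg) (auto simp: kern_energy_def intro!: sum_nonneg)
  finally show ?thesis by simp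
qed

end

section \<open>Uniform control of the derivatives\<close>

context uniform_sample begin

text \<open>Both the supremum of the kernel and its variance are of order \<open>N\<^sup>2\<close>.
  A bound through the variance therefore leaves \<open>n / N\<^sup>2\<close> in the exponent, where
  the supremum alone would leave \<open>n / N ^ 4\<close>.\<close>

lemma potential_tail:
  assumes n: "0 < (n::real)" "\<And>i. i \<in> I \<Longrightarrow> \<bar>w i\<bar> \<le> 1 / n" "(\<Sum>i\<in>I. (w i)\<^sup>2) \<le> 2 / n"
    and \<delta>: "0 < \<delta>" "\<delta> \<le> 4" and N: "1 \<le> N" and pq: "p + q \<le> 2"
  shows "prob {s\<in>space M. \<delta> \<le> \<bar>potential I p q s x\<bar>} \<le> 2 * exp (- (n * \<delta>\<^sup>2 / (32 * (real N)\<^sup>2)))"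
proof -
  have one: "prob {s\<in>space M. \<delta> \<le> \<sigma> * potential I p q s x} \<le> exp (- (n * \<delta>\<^sup>2 / (32 * (real N)\<^sup>2)))"
    if \<sigma>: "\<bar>\<sigma>\<bar> = 1" for \<sigma> :: real
  proof -
    define W where "W = (\<lambda>i s. \<sigma> * (w i * kern N p q (x - Z i s)))"
    have \<sigma>2: "\<sigma>\<^sup>2 = 1" using \<sigma> by (metis power2_abs one_power2)
    \<comment> \<open>This \<open>t\<close> minimises the exponent for
      \<open>V = 8 * N\<^sup>2 / n\<close>, being \<open>\<delta> / (2 * V)\<close>. Then
      \<open>t * B\<close> equals \<open>\<delta> / 4\<close>, which is where
      \<open>\<delta> \<le> 4\<close> enters.\<close>
    have "prob {s\<in>space M. \<delta> \<le> (\<Sum>i\<in>I. W i s)} \<le>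
      exp ((n * \<delta> / (16 * (real N)\<^sup>2))\<^sup>2 * (8 * (real N)\<^sup>2 / n) - (n * \<delta> / (16 * (real N)\<^sup>2)) * \<delta>)"
    proof (rule chernoff_bounded_sum[OF finite_I])
      show "indep_vars (\<lambda>_. borel) W I" unfolding W_def
        by (rule indep_vars_compose2[OF indep_kern[OF order_refl]]) auto
      show "\<bar>W i s\<bar> \<le> 4 * (real N)\<^sup>2 / n" if "i \<in> I" for i s
      proof -
        have "\<bar>W i s\<bar> \<le> \<bar>w i\<bar> * (4 * (real N)\<^sup>2)"
          using weighted_kern_bound[OF pq] \<sigma> by (simp add: W_def abs_mult)
        also have "\<dots> \<le> 1 / n * (4 * (real N)\<^sup>2)" using n(2)[OF that] by (intro mult_right_mono) auto
        finally show ?thesis by simp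
      qed
      show "expectation (W i) = 0" if "i \<in> I" for i
        unfolding W_def using expectation_kern[OF that] by (metis integral_mult_right_zero mult_zero_right)
      show "0 \<le> n * \<delta> / (16 * (real N)\<^sup>2)" using n \<delta> by simp
      show "n * \<delta> / (16 * (real N)\<^sup>2) * (4 * (real N)\<^sup>2 / n) \<le> 1"
        using n \<delta> N by (simp add: field_simps)
      have "expectation (\<lambda>s. (W i s)\<^sup>2) = (w i)\<^sup>2 * kern_energy N p q" if "i \<in> I" for i
        using expectation_kern_power2[OF that] by (simp add: W_def power_mult_distrib \<sigma>2)
      then have "(\<Sum>i\<in>I. expectation (\<lambda>s. (W i s)\<^sup>2)) = (\<Sum>i\<in>I. (w i)\<^sup>2) * kern_energy N p q"
        by (simp add: sum_distrib_right)
      also have "\<dots> \<le> 2 / n * (4 * (real N)\<^sup>2)"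
        using n by (intro mult_mono kern_energy_le pq) (auto simp: kern_energy_def intro!: sum_nonneg)
      finally show "(\<Sum>i\<in>I. expectation (\<lambda>s. (W i s)\<^sup>2)) \<le> 8 * (real N)\<^sup>2 / n" by simp
    qed
    also have "(n * \<delta> / (16 * (real N)\<^sup>2))\<^sup>2 * (8 * (real N)\<^sup>2 / n) - (n * \<delta> / (16 * (real N)\<^sup>2)) * \<delta> = - (n * \<delta>\<^sup>2 / (32 * (real N)\<^sup>2))"
      using n N by (simp add: power2_eq_square field_simps)
    finally show ?thesis by (simp add: W_def potential_def sum_distrib_left)
  qed
  have [measurable]: "(\<lambda>s. potential I p q s x) \<in> borel_measurable M" by (rule potential_measurable) auto
  have "{s\<in>space M. \<delta> \<le> \<bar>potential I p q s x\<bar>} = {s\<in>space M. \<delta> \<le> 1 * potential I p q s x} \<union> {s\<in>space M. \<delta> \<le> - 1 * potential I p q s x}"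
    by auto
  also have "prob \<dots> \<le> prob {s\<in>space M. \<delta> \<le> 1 * potential I p q s x} + prob {s\<in>space M. \<delta> \<le> - 1 * potential I p q s x}"
    by (rule measure_subadditive) (auto simp: emeasure_eq_measure)
  also have "\<dots> \<le> 2 * exp (- (n * \<delta>\<^sup>2 / (32 * (real N)\<^sup>2)))"
    using one[of 1] one[of "- 1"] by simp
  finally show ?thesis .
qed

text \<open>Restricting to grid points makes the event a finite union, hence measurable and open to
  a union bound.\<close>

definition bad :: "nat \<Rightarrow> real \<Rightarrow> 'a set" where
  "bad Q \<delta> = (\<Union>((a, b), p, q) \<in> ({..Q} \<times> {..Q}) \<times> {(p, q) \<in> {..2} \<times> {..2}. p + q \<le> 2}.
     {s \<in> space M. \<delta> \<le> \<bar>potential I p q s (real a / real Q, real b / real Q)\<bar>})"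

lemma bad_measurable [measurable]: "bad Q \<delta> \<in> sets M"
proof -
  have [measurable]: "(\<lambda>s. potential I p q s x) \<in> borel_measurable M" for p q x by (rule potential_measurable) auto
  have fin: "finite {(p, q) \<in> {..2} \<times> {..2}. p + q \<le> (2::nat)}" by (rule finite_subset[of _ "{..2} \<times> {..2}"]) auto
  show ?thesis unfolding bad_def
    by (intro sets.finite_UN finite_cartesian_product finite_atMost fin) (auto split: prod.split)
qed

lemma prob_bad_le:
  assumes "0 < (n::real)" "\<And>i. i \<in> I \<Longrightarrow> \<bar>w i\<bar> \<le> 1 / n" "(\<Sum>i\<in>I. (w i)\<^sup>2) \<le> 2 / n"
    and "0 < \<delta>" "\<delta> \<le> 4" "1 \<le> N"
  shows "prob (bad Q \<delta>) \<le> 18 * (real Q + 1)\<^sup>2 * exp (- (n * \<delta>\<^sup>2 / (32 * (real N)\<^sup>2)))"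
proof -
  let ?E = "exp (- (n * \<delta>\<^sup>2 / (32 * (real N)\<^sup>2)))"
  let ?S = "{(p, q) \<in> {..2} \<times> {..2}. p + q \<le> (2::nat)}"
  let ?T = "({..Q} \<times> {..Q}) \<times> ?S"
  let ?A = "\<lambda>((a, b), p, q). {s \<in> space M. \<delta> \<le> \<bar>potential I p q s (real a / real Q, real b / real Q)\<bar>}"
  have [measurable]: "(\<lambda>s. potential I p q s x) \<in> borel_measurable M" for p q x by (rule potential_measurable) auto
  have fin: "finite ?S" by (rule finite_subset[of _ "{..2} \<times> {..2}"]) auto
  \<comment> \<open>The set has six elements; the crude 9, times 2 for the two-sided tail, is the
    origin of 18.\<close>
  have card: "card ?S \<le> 9"
    using card_mono[of "{..2::nat} \<times> {..2::nat}" ?S] by (auto simp: card_cartesian_product)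
  have "prob (bad Q \<delta>) \<le> (\<Sum>t\<in>?T. prob (?A t))"
    unfolding bad_def
    by (intro finite_measure_subadditive_finite finite_cartesian_product finite_atMost fin) (auto split: prod.split)
  also have "\<dots> \<le> (\<Sum>t\<in>?T. 2 * ?E)"
    using potential_tail[OF assms] by (intro sum_mono) auto
  also have "\<dots> = real ((Q + 1)\<^sup>2 * card ?S) * (2 * ?E)"
    by (simp add: card_cartesian_product power2_eq_square)
  also have "\<dots> \<le> real ((Q + 1)\<^sup>2 * 9) * (2 * ?E)"
    using card by (intro mult_right_mono of_nat_mono mult_left_mono) auto
  finally show ?thesis by (simp add: algebra_simps)
qed

text \<open>The grid contributes one \<open>\<delta>\<close>, the Lipschitz bound the other. The
  constant \<open>16 * pi\<close> is twice that of the kernel, one for each coordinate in which the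
  point is rounded.\<close>

lemma potential_bound_off_bad:
  assumes "s \<in> space M" "s \<notin> bad Q \<delta>" "1 \<le> Q"
    and lip: "(\<Sum>i\<in>I. \<bar>w i\<bar>) * (16 * pi * real N ^ 3) / real Q \<le> \<delta>"
    and pq: "p + q \<le> 2" and x: "x \<in> {0..1} \<times> {0..1}"
  shows "\<bar>potential I p q s x\<bar> \<le> 2 * \<delta>"
proof -
  \<comment> \<open>Rounding down sends \<open>t = 1\<close> to the index \<open>Q\<close>, so the
    grid has to include both ends.\<close>
  define r where "r = (\<lambda>t::real. nat \<lfloor>t * real Q\<rfloor>)"
  have r: "r t \<le> Q" "\<bar>t - real (r t) / real Q\<bar> \<le> 1 / real Q" if "0 \<le> t" "t \<le> 1" for t
  proof -
    have "t * real Q \<le> 1 * real Q" using that by (intro mult_right_mono) auto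
    moreover have fl: "real (r t) \<le> t * real Q" "t * real Q < real (r t) + 1"
      using that by (auto simp: r_def)
    ultimately show "r t \<le> Q" by linarith
    have "\<bar>t * real Q - real (r t)\<bar> \<le> 1" using fl by linarith
    moreover have "t - real (r t) / real Q = (t * real Q - real (r t)) / real Q"
      using assms(3) by (simp add: field_simps)
    ultimately show "\<bar>t - real (r t) / real Q\<bar> \<le> 1 / real Q"
      by (simp add: divide_right_mono)
  qed
  have x01: "0 \<le> fst x" "fst x \<le> 1" "0 \<le> snd x" "snd x \<le> 1" using x by (auto simp: mem_Times_iff)
  define g where "g = (real (r (fst x)) / real Q, real (r (snd x)) / real Q)"
  have "\<bar>potential I p q s g\<bar> < \<delta>"
  proof (rule ccontr)
    assume "\<not> \<bar>potential I p q s g\<bar> < \<delta>"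
    then have "s \<in> bad Q \<delta>"
      unfolding bad_def using assms(1) pq r(1)[OF x01(1,2)] r(1)[OF x01(3,4)]
      by (intro UN_I[of "((r (fst x), r (snd x)), p, q)"]) (auto simp: g_def)
    with assms(2) show False by simp
  qed
  moreover have "\<bar>potential I p q s x - potential I p q s g\<bar> \<le> \<delta>"
  proof -
    have "\<bar>kern N p q (x - z) - kern N p q (g - z)\<bar> \<le> 16 * pi * real N ^ 3 / real Q" for z
    proof -
      have "\<bar>kern N p q (x - z) - kern N p q (g - z)\<bar> \<le> 8 * pi * real N ^ 3 * (\<bar>fst (x - z) - fst (g - z)\<bar> + \<bar>snd (x - z) - snd (g - z)\<bar>)"
        by (rule kern_lipschitz[OF pq])
      also have "\<dots> \<le> 8 * pi * real N ^ 3 * (1 / real Q + 1 / real Q)"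
        using r(2)[OF x01(1,2)] r(2)[OF x01(3,4)] by (intro mult_left_mono add_mono) (auto simp: g_def)
      finally show ?thesis by simp
    qed
    then have "(\<Sum>i\<in>I. \<bar>w i * (kern N p q (x - Z i s) - kern N p q (g - Z i s))\<bar>) \<le> (\<Sum>i\<in>I. \<bar>w i\<bar> * (16 * pi * real N ^ 3 / real Q))"
      unfolding abs_mult by (intro sum_mono mult_left_mono) auto
    then have "\<bar>\<Sum>i\<in>I. w i * (kern N p q (x - Z i s) - kern N p q (g - Z i s))\<bar> \<le> (\<Sum>i\<in>I. \<bar>w i\<bar>) * (16 * pi * real N ^ 3 / real Q)"
      unfolding sum_distrib_right by (rule order_trans[OF sum_abs])
    then show ?thesis using lip
      by (simp add: potential_def sum_subtractf right_diff_distrib)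
  qed
  ultimately show ?thesis by linarith
qed

lemma potential_has_derivative:
  "(potential I p q s has_derivative (\<lambda>v. potential I (Suc p) q s x * fst v + potential I p (Suc q) s x * snd v)) (at x)"
proof -
  have k: "((\<lambda>x. w i * kern N p q (x - Z i s)) has_derivative
     (\<lambda>v. w i * kern N (Suc p) q (x - Z i s) * fst v + w i * kern N p (Suc q) (x - Z i s) * snd v)) (at x)" for i
  proof -
    have "((\<lambda>x. x - Z i s) has_derivative (\<lambda>v. v)) (at x)" by (auto intro!: derivative_eq_intros)
    from has_derivative_mult_right[OF has_derivative_compose[OF this kern_has_derivative], of "w i"]
    show ?thesis by (simp add: algebra_simps)
  qed
  have "((\<lambda>x. \<Sum>i\<in>I. w i * kern N p q (x - Z i s)) has_derivative
     (\<lambda>v. \<Sum>i\<in>I. w i * kern N (Suc p) q (x - Z i s) * fst v + w i * kern N p (Suc q) (x - Z i s) * snd v)) (at x)"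
    by (rule has_derivative_sum) (rule k)
  then show ?thesis by (simp add: potential_def[abs_def] sum.distrib sum_distrib_right)
qed

end

section \<open>Lower bound for the expected cost\<close>

lemma (in uniform_sample) integrable_potential:
  assumes "j \<in> I" "p + q \<le> 2"
  shows "integrable M (\<lambda>s. (potential I p q s (Z j s))\<^sup>2)"
    and "g \<in> borel_measurable borel \<Longrightarrow> (\<And>x. \<bar>g x\<bar> \<le> K) \<Longrightarrow> integrable M (\<lambda>s. g (Z j s) * potential I p q s (Z j s))"
proof -
  note [measurable] = Z_measurable[OF assms(1)]
  let ?B = "(\<Sum>i\<in>I. \<bar>w i\<bar>) * (4 * (real N)\<^sup>2)"
  note b = potential_bound[OF assms(2), of I]
  show "integrable M (\<lambda>s. (potential I p q s (Z j s))\<^sup>2)"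
    using power_mono[OF b abs_ge_zero, of _ _ 2]
    by (intro integrable_const_bound[where B = "?B\<^sup>2"]) auto
  show "integrable M (\<lambda>s. g (Z j s) * potential I p q s (Z j s))"
    if g: "g \<in> borel_measurable borel" "\<And>x. \<bar>g x\<bar> \<le> K"
  proof -
    note [measurable] = g(1)
    have "\<bar>g (Z j s) * potential I p q s (Z j s)\<bar> \<le> K * ?B" for s
      unfolding abs_mult using g(2)[of 0] by (intro mult_mono g b) auto
    then show ?thesis by (intro integrable_const_bound[where B = "K * ?B"]) auto
  qed
qed

section \<open>Mass of the cutoff\<close>

context cutoff begin

text \<open>The locale controls \<open>\<psi>\<close> only on the unit interval, while the moment
  lemmas require weights bounded on the whole plane. Sample points lie in the square almost surely,
  so the two weights agree there.\<close>

definition trunc :: "real \<Rightarrow> real" where "trunc t = indicator {0..1} t * \<psi> t"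

lemma trunc_bound: "\<bar>trunc t\<bar> \<le> 1"
  using range[of t] by (auto simp: trunc_def indicator_def)

lemma trunc_measurable [measurable]: "trunc \<in> borel_measurable borel"
proof -
  have "continuous_on UNIV \<psi>" using deriv(1) by (meson DERIV_isCont continuous_at_imp_continuous_on)
  then have [measurable]: "\<psi> \<in> borel_measurable borel" by (rule borel_measurable_continuous_onI)
  show ?thesis unfolding trunc_def[abs_def] by measurable
qed

definition mass :: real where "mass = (\<integral>z. trunc (fst z) * trunc (snd z) \<partial>unif_square)"

lemma mass_eq: "mass = (\<integral>t. trunc t \<partial>unif_interval)\<^sup>2"
  unfolding mass_def power2_eq_square
  by (rule integral_unif_square_times[OF trunc_measurable trunc_bound trunc_measurable trunc_bound])

end

text \<open>With \<open>u = (2 * t - 1) ^ (2 * k)\<close> the cutoff is at least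
  \<open>1 - 2 * u\<close>, and \<open>u\<close> has mean \<open>1 / (2 * k + 1)\<close>. A loss of
  \<open>\<tau> / 2\<close> per coordinate makes at most \<open>\<tau>\<close> for the
  square.\<close>

lemma exists_cutoff_mass:
  assumes "0 < (\<tau>::real)" "\<tau> < 1"
  shows "\<exists>\<psi> \<psi>' \<psi>'' C. cutoff \<psi> \<psi>' \<psi>'' C \<and> 1 - \<tau> \<le> cutoff.mass \<psi>"
proof -
  interpret U: prob_space unif_interval by (rule prob_space_unif_interval)
  obtain k :: nat where "4 / \<tau> < real k" using reals_Archimedean2 by blast
  then have k: "2 / (2 * real k + 1) \<le> \<tau> / 2" using assms by (simp add: field_simps)
  define \<psi> where "\<psi> = (\<lambda>t::real. (1 - (2 * t - 1) ^ (2 * k))\<^sup>2)"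
  obtain \<psi>' \<psi>'' C where c: "cutoff \<psi> \<psi>' \<psi>'' C" unfolding \<psi>_def using exists_cutoff[of k] by blast
  interpret cutoff \<psi> \<psi>' \<psi>'' C by (rule c)
  have "1 - 2 / (2 * real k + 1) = (\<integral>t. 1 - 2 * (2 * t - 1) ^ (2 * k) \<partial>unif_interval)"
  proof -
    have "(\<integral>t. 1 - 2 * (2 * t - 1) ^ (2 * k) \<partial>unif_interval) =
      (1 - (2 * 1 - 1) ^ (2 * k + 1) / (2 * real k + 1)) - (0 - (2 * 0 - 1) ^ (2 * k + 1) / (2 * real k + 1))"
    proof (rule integral_unif_interval_FTC)
      show "((\<lambda>t. t - (2 * t - 1) ^ (2 * k + 1) / (2 * real k + 1)) has_real_derivative 1 - 2 * (2 * x - 1) ^ (2 * k)) (at x)" for x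
      proof -
        define c where "c = 2 * real k + 1"
        have "((\<lambda>t. 2 * t - 1) has_real_derivative 2) (at x)" by (auto intro!: derivative_eq_intros)
        from DERIV_power_Suc[OF this, of "2 * k"]
        have "((\<lambda>t. t - (2 * t - 1) ^ Suc (2 * k) / c) has_real_derivative 1 - (1 + real (2 * k)) * (2 * (2 * x - 1) ^ (2 * k)) / c) (at x)"
          by (intro DERIV_diff DERIV_ident DERIV_cdivide)
        moreover have "1 + real (2 * k) = c" "c \<noteq> 0" by (simp_all add: c_def)
        ultimately show ?thesis by (simp add: c_def[symmetric])
      qed
    qed (intro continuous_intros)
    then show ?thesis by simp
  qed
  also have "\<dots> \<le> (\<integral>t. trunc t \<partial>unif_interval)"
  proof (rule integral_mono_AE)
    have ae: "AE t in unif_interval. t \<in> {0<..<1}" by (rule AE_uniform_measureI) auto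
    have u: "0 \<le> (2 * t - 1) ^ (2 * k) \<and> (2 * t - 1) ^ (2 * k) \<le> 1" if "t \<in> {0<..<1}" for t :: real
    proof -
      have "(2 * t - 1)\<^sup>2 \<le> 1" using that by (simp add: abs_square_le_1 abs_le_iff)
      then show ?thesis by (simp add: power_mult power_le_one)
    qed
    show "integrable unif_interval trunc"
      using trunc_bound by (intro U.integrable_const_bound[where B = 1]) auto
    show "integrable unif_interval (\<lambda>t. 1 - 2 * (2 * t - 1) ^ (2 * k))"
    proof (rule U.integrable_const_bound[where B = 1])
      show "AE t in unif_interval. norm (1 - 2 * (2 * t - 1) ^ (2 * k)) \<le> 1"
        using ae by eventually_elim (use u in \<open>auto simp: abs_le_iff\<close>)
    qed measurable
    show "AE t in unif_interval. 1 - 2 * (2 * t - 1) ^ (2 * k) \<le> trunc t"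
      using ae by eventually_elim (simp add: trunc_def, simp add: \<psi>_def power2_eq_square algebra_simps)
  qed
  finally have "1 - \<tau> / 2 \<le> (\<integral>t. trunc t \<partial>unif_interval)" using k by linarith
  then have "(1 - \<tau> / 2)\<^sup>2 \<le> mass" unfolding mass_eq using assms by (intro power_mono) auto
  moreover have "1 - \<tau> \<le> (1 - \<tau> / 2)\<^sup>2" by (simp add: power2_eq_square algebra_simps)
  ultimately have "1 - \<tau> \<le> cutoff.mass \<psi>" by linarith
  then show ?thesis using c by blast
qed

text \<open>An estimate without asymptotics, obtained by integrating one almost sure inequality. Its
  three lines are the pairing minus the energy, the price of the cutoff derivative including
  self-interactions, and the bad event.\<close>

lemma expectation_Wb_ge:
  fixes M :: "'a measure" and X Y :: "nat \<Rightarrow> 'a \<Rightarrow> real \<times> real"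
  assumes M: "prob_space M"
    and ind: "prob_space.indep_vars M (\<lambda>_. borel) (case_sum X Y) ({1..} <+> {1..})"
    and dX: "\<And>i. i \<ge> 1 \<Longrightarrow> distr M borel (X i) = unif_square"
    and dY: "\<And>i. i \<ge> 1 \<Longrightarrow> distr M borel (Y i) = unif_square"
    and nm: "1 \<le> n" "n \<le> m" and NQ: "1 \<le> N" "1 \<le> Q"
    and c: "cutoff \<psi> \<psi>' \<psi>'' C" and \<tau>: "0 < \<tau>" "\<tau> < 1"
    and \<delta>: "\<delta> = \<tau> / (16 * C\<^sup>2)" "32 * pi * real N ^ 3 / real Q \<le> \<delta>"
  shows "(1 / real n + 1 / real m) * green_sum N * (2 * cutoff.mass \<psi> - (1 + \<tau>) / (1 - \<tau>))
      - (1 + 1 / \<tau>) * (2 * C\<^sup>2) / (1 - \<tau>) * ((green_sum N)\<^sup>2 / (real m)\<^sup>2 + 4 * (1 / real n + 1 / real m))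
      - 32 * (real N)\<^sup>2 * (18 * (real Q + 1)\<^sup>2 * exp (- (real n * \<delta>\<^sup>2 / (32 * (real N)\<^sup>2))))
    \<le> prob_space.expectation M (\<lambda>s. (Wb ({0<..<1} \<times> {0<..<1}) 2
        (empirical_measure n (\<lambda>i. X i s)) (empirical_measure m (\<lambda>i. Y i s)))\<^sup>2)"
proof -
  interpret cutoff \<psi> \<psi>' \<psi>'' C by (rule c)
  define I where "I = {1..n} <+> {1..m}"
  define Z where "Z = case_sum X Y"
  \<comment> \<open>The sign makes the potential the field of the first empirical measure minus the
    second.\<close>
  define w where "w = case_sum (\<lambda>_::nat. 1 / real n) (\<lambda>_::nat. - (1 / real m))"
  interpret prob_space M by (rule M)
  interpret uniform_sample M I Z w N
  proof
    show "finite I" by (simp add: I_def)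
    show "indep_vars (\<lambda>_. borel) Z I"
      unfolding Z_def I_def by (rule indep_vars_subset[OF ind]) auto
    show "distr M borel (Z i) = unif_square" if "i \<in> I" for i
      using that dX dY by (auto simp: I_def Z_def)
  qed
  have n0: "0 < real n" "0 < real m" "1 / real m \<le> 1 / real n" using nm by (auto simp: frac_le)
  have sumI: "(\<Sum>k\<in>I. f k) = (\<Sum>i=1..n. f (Inl i)) + (\<Sum>j=1..m. f (Inr j))" for f :: "_ \<Rightarrow> real"
    unfolding I_def by (simp add: sum.Plus)
  define S where "S = 1 / real n + 1 / real m"
  define L where "L = green_sum N"
  have L0: "0 \<le> L" by (simp add: L_def green_sum_nonneg)
  have w2: "(\<Sum>k\<in>I. (w k)\<^sup>2) = S"
    using n0 by (simp add: sumI w_def S_def power2_eq_square)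
  have w1: "(\<Sum>k\<in>I. \<bar>w k\<bar>) = 2" using n0 by (simp add: sumI w_def)
  have wn: "\<bar>w k\<bar> \<le> 1 / real n" if "k \<in> I" for k using n0 that by (auto simp: w_def I_def)
  have Inr: "Inr j \<in> I" if "j \<in> {1..m}" for j using that by (auto simp: I_def)
  have S2: "(\<Sum>k\<in>I. (w k)\<^sup>2) \<le> 2 / real n" unfolding w2 S_def using n0 by simp
  have C2: "1 \<le> C\<^sup>2" using bound(3) by (rule one_le_power)
  \<comment> \<open>Off the bad event the derivatives are bounded by \<open>2 * \<delta>\<close>,
    and \<open>8 * C\<^sup>2 * (2 * \<delta>)\<close> is exactly \<open>\<tau>\<close>; this fixes
    the 16 in \<open>\<delta>\<close>.\<close>
  have \<delta>0: "0 < \<delta>" "\<delta> \<le> 4" "8 * C\<^sup>2 * (2 * \<delta>) \<le> \<tau>" 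
  proof -
    have "0 < C\<^sup>2" using C2 by linarith
    then show "0 < \<delta>" "8 * C\<^sup>2 * (2 * \<delta>) \<le> \<tau>" using \<tau> unfolding \<delta>(1) by simp_all
    have "\<tau> \<le> 4 * (16 * C\<^sup>2)" using \<tau> C2 by linarith
    then show "\<delta> \<le> 4" using \<open>0 < C\<^sup>2\<close> unfolding \<delta>(1) by (simp add: divide_le_eq)
  qed
  define g where "g = (\<lambda>z. trunc (fst z) * trunc (snd z))"
  have gm: "g \<in> borel_measurable borel"
    unfolding g_def
    by (intro borel_measurable_times measurable_compose[OF _ trunc_measurable] borel_measurable_continuous_onI continuous_intros)
  have gb: "\<bar>g z\<bar> \<le> 1" for z unfolding g_def abs_mult by (intro mult_le_one trunc_bound) auto
  define K where "K = (1 + 1 / \<tau>) * (2 * C\<^sup>2)"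
  have K0: "0 \<le> K" using \<tau> by (simp add: K_def)
  define T1 where "T1 = (\<lambda>s. \<Sum>k\<in>I. w k * (g (Z k s) * potential I 0 0 s (Z k s)))"
  \<comment> \<open>The bound on the squared gradient at the points of the second sample, with the
    cutoff removed, so that its expectation is given by the moments of the stationary field.\<close>
  define R where "R = (\<lambda>j s. (1 + \<tau>) * ((potential I 1 0 s (Z (Inr j) s))\<^sup>2 + (potential I 0 1 s (Z (Inr j) s))\<^sup>2)
     + K * (potential I 0 0 s (Z (Inr j) s))\<^sup>2)"
  define T2 where "T2 = (\<lambda>s. \<Sum>j=1..m. 1 / real m * R j s)"
  define Wf where "Wf = (\<lambda>s. (Wb ({0<..<1} \<times> {0<..<1}) 2
        (empirical_measure n (\<lambda>i. X i s)) (empirical_measure m (\<lambda>i. Y i s)))\<^sup>2)"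
  have iT1: "integrable M T1" unfolding T1_def
    by (intro Bochner_Integration.integrable_sum integrable_mult_right integrable_potential(2)[where K = 1] gm gb) simp_all
  have iR: "integrable M (R j)" if "j \<in> {1..m}" for j
    unfolding R_def using Inr[OF that]
    by (intro Bochner_Integration.integrable_add integrable_mult_right integrable_potential(1)) simp_all
  have iT2: "integrable M T2" unfolding T2_def
    by (intro Bochner_Integration.integrable_sum integrable_mult_right iR)
  have ET1: "expectation T1 = S * L * mass"
  proof -
    have "expectation T1 = (\<Sum>k\<in>I. w k * (w k * green_sum N * (\<integral>x. g x \<partial>unif_square)))"
      unfolding T1_def
      by (subst Bochner_Integration.integral_sum)
         (auto intro!: sum.cong integrable_potential(2)[where K = 1] gm gb simp: expectation_pairing[OF _ gm gb])
    also have "\<dots> = (\<Sum>k\<in>I. (w k)\<^sup>2 * (L * mass))"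
      by (intro sum.cong refl) (simp add: mass_def g_def L_def power2_eq_square)
    also have "\<dots> = S * L * mass" unfolding sum_distrib_right[symmetric] w2 by simp
    finally show ?thesis .
  qed
  have ER: "expectation (R j) \<le> (1 + \<tau>) * (S * L) + K * (L\<^sup>2 / (real m)\<^sup>2 + 4 * S)" if j: "j \<in> {1..m}" for j
  proof -
    note i = integrable_potential(1)[OF Inr[OF j]]
    have "expectation (R j) = (1 + \<tau>) * (expectation (\<lambda>s. (potential I 1 0 s (Z (Inr j) s))\<^sup>2) + expectation (\<lambda>s. (potential I 0 1 s (Z (Inr j) s))\<^sup>2))
       + K * expectation (\<lambda>s. (potential I 0 0 s (Z (Inr j) s))\<^sup>2)"
      unfolding R_def using i[of 1 0] i[of 0 1] i[of 0 0] by simp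
    also have "\<dots> \<le> (1 + \<tau>) * (S * L) + K * (L\<^sup>2 / (real m)\<^sup>2 + 4 * S)"
      using expectation_gradient_le[OF Inr[OF j]] expectation_potential_power2_le[OF Inr[OF j]] \<tau> K0
      unfolding w2 by (intro add_mono mult_left_mono) (simp_all add: L_def w_def power_divide)
    finally show ?thesis .
  qed
  have ET2: "expectation T2 \<le> (1 + \<tau>) * (S * L) + K * (L\<^sup>2 / (real m)\<^sup>2 + 4 * S)"
  proof -
    have "expectation T2 = (\<Sum>j=1..m. 1 / real m * expectation (R j))"
      unfolding T2_def by (subst Bochner_Integration.integral_sum) (use iR in auto)
    also have "\<dots> \<le> (\<Sum>j=1..m. 1 / real m * ((1 + \<tau>) * (S * L) + K * (L\<^sup>2 / (real m)\<^sup>2 + 4 * S)))"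
      by (intro sum_mono mult_left_mono ER) auto
    also have "\<dots> = (1 + \<tau>) * (S * L) + K * (L\<^sup>2 / (real m)\<^sup>2 + 4 * S)" using n0 by simp
    finally show ?thesis .
  qed
  have open_sq: "open ({0<..<1} \<times> {0<..<1} :: (real \<times> real) set)" by (intro open_Times) auto
  have "(0, 0) \<in> frontier ({0<..<1} \<times> {0<..<1} :: (real \<times> real) set)" unfolding frontier_unit_square by simp
  then have fr: "frontier ({0<..<1} \<times> {0<..<1} :: (real \<times> real) set) \<noteq> {}" by blast
  have bdd: "bounded ({0<..<1} \<times> {0<..<1} :: (real \<times> real) set)" by (intro bounded_Times) auto
  have XM: "X i \<in> borel_measurable M" if "i \<in> {1..n}" for i
    using Z_measurable[of "Inl i", unfolded I_def, OF InlI[OF that]] by (simp add: Z_def)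
  have YM: "Y j \<in> borel_measurable M" if "j \<in> {1..m}" for j
    using Z_measurable[of "Inr j", unfolded I_def, OF InrI[OF that]] by (simp add: Z_def)
  have WM: "Wf \<in> borel_measurable M" and WB: "Wf s \<le> 2 * (diameter (closure ({0<..<1} \<times> {0<..<1} :: (real \<times> real) set)))\<^sup>2" for s
    unfolding Wf_def by (rule borel_measurable_Wb_power2(1)[OF open_sq fr XM YM], assumption+)
      (rule borel_measurable_Wb_power2(2)[OF open_sq fr XM YM bdd], assumption+)
  have W0: "0 \<le> Wf s" for s by (simp add: Wf_def)
  have iW: "integrable M Wf"
    using WM WB W0 by (intro integrable_const_bound[where B = "2 * (diameter (closure ({0<..<1} \<times> {0<..<1} :: (real \<times> real) set)))\<^sup>2"]) auto
  \<comment> \<open>The weights have total absolute mass 2, and this factor enters twice: in the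
    bound on the field and in the sum over the points.\<close>
  have T1b: "2 * T1 s \<le> 32 * (real N)\<^sup>2" for s
  proof -
    have "T1 s \<le> (\<Sum>k\<in>I. \<bar>w k\<bar> * (1 * (2 * (4 * (real N)\<^sup>2))))"
      unfolding T1_def
    proof (intro sum_mono)
      fix k assume "k \<in> I"
      have "w k * (g (Z k s) * potential I 0 0 s (Z k s)) \<le> \<bar>w k\<bar> * (\<bar>g (Z k s)\<bar> * \<bar>potential I 0 0 s (Z k s)\<bar>)"
        by (metis abs_ge_self abs_mult)
      also have "\<dots> \<le> \<bar>w k\<bar> * (1 * (2 * (4 * (real N)\<^sup>2)))"
        using potential_bound[of 0 0 I s "Z k s"] unfolding w1 by (intro mult_left_mono mult_mono gb) auto
      finally show "w k * (g (Z k s) * potential I 0 0 s (Z k s)) \<le> \<bar>w k\<bar> * (1 * (2 * (4 * (real N)\<^sup>2)))" .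
    qed
    also have "\<dots> = 2 * (1 * (2 * (4 * (real N)\<^sup>2)))" unfolding sum_distrib_right[symmetric] w1 ..
    finally show ?thesis by simp
  qed
  have T20: "0 \<le> T2 s" for s
    unfolding T2_def R_def using \<tau> K0 by (intro sum_nonneg mult_nonneg_nonneg add_nonneg_nonneg) auto
  have "AE s in M. \<forall>k\<in>I. Z k s \<in> {0<..<1} \<times> {0<..<1}"
  proof (rule AE_finite_allI[OF finite_I])
    fix k assume k: "k \<in> I"
    have "AE z in distr M borel (Z k). z \<in> {0<..<1} \<times> {0<..<1}"
      unfolding distr_Z[OF k] by (rule AE_uniform_measureI) (use open_sq in auto)
    then show "AE s in M. Z k s \<in> {0<..<1} \<times> {0<..<1}"
      using open_sq by (subst (asm) AE_distr_iff[OF Z_measurable[OF k]]) auto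
  qed
  \<comment> \<open>On the bad event the left side is at most zero by \<open>T1b\<close> and
    \<open>T20\<close>, and the cost is nonnegative; elsewhere the dual bound applies.\<close>
  then have ae: "AE s in M. 2 * T1 s - T2 s / (1 - \<tau>) - 32 * (real N)\<^sup>2 * indicator (bad Q \<delta>) s \<le> Wf s"
    using AE_space
  proof eventually_elim
    case (elim s)
    show ?case
    proof (cases "s \<in> bad Q \<delta>")
      case True
      have "0 \<le> T2 s / (1 - \<tau>)" using T20 \<tau> by simp
      then show ?thesis using T1b[of s] W0[of s] True by simp
    next
      case False
      define H where "H = (\<lambda>p q. potential I p q s)"
      have sq: "Z k s \<in> {0..1} \<times> {0..1}" if "k \<in> I" for k
        using bspec[OF elim(1) that] by (auto simp: mem_Times_iff)
      have XZ: "X i s = Z (Inl i) s" "Y i s = Z (Inr i) s" for i by (simp_all add: Z_def)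
      have "2 * ((\<Sum>i=1..n. 1 / real n * F H (X i s)) - (\<Sum>j=1..m. 1 / real m * F H (Y j s)))
        - (\<Sum>j=1..m. 1 / real m * ((Fx H (Y j s))\<^sup>2 + (Fy H (Y j s))\<^sup>2)) / (1 - \<tau>) \<le> Wf s"
        unfolding Wf_def
      proof (rule Wb_power2_ge_potential[where \<delta> = "2 * \<delta>"])
        show "X i s \<in> {0<..<1} \<times> {0<..<1}" if "i \<in> {1..n}" for i
          unfolding XZ by (rule bspec[OF elim(1)]) (use that in \<open>auto simp: I_def\<close>)
        show "Y i s \<in> {0<..<1} \<times> {0<..<1}" if "i \<in> {1..m}" for i
          unfolding XZ by (rule bspec[OF elim(1)]) (use that in \<open>auto simp: I_def\<close>)
        show "\<forall>p q z. p + q \<le> 1 \<longrightarrow> (H p q has_derivative (\<lambda>v. H (Suc p) q z * fst v + H p (Suc q) z * snd v)) (at z)"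
          unfolding H_def by (intro allI impI potential_has_derivative)
        show "\<forall>p q. \<forall>z\<in>{0..1} \<times> {0..1}. p + q \<le> 2 \<longrightarrow> \<bar>H p q z\<bar> \<le> 2 * \<delta>"
          unfolding H_def by (intro allI ballI impI potential_bound_off_bad[OF elim(2) False NQ(2)]) (use w1 \<delta> in auto)
      qed (fact \<delta>0 \<tau>)+
      moreover have "(\<Sum>i=1..n. 1 / real n * F H (X i s)) - (\<Sum>j=1..m. 1 / real m * F H (Y j s)) = T1 s"
      proof -
        have eq: "w k * F H (Z k s) = w k * (g (Z k s) * potential I 0 0 s (Z k s))" if "k \<in> I" for k
          using sq[OF that] by (simp add: F_def g_def H_def trunc_def mem_Times_iff)
        have "T1 s = (\<Sum>k\<in>I. w k * F H (Z k s))" unfolding T1_def by (intro sum.cong refl eq[symmetric])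
        then show ?thesis unfolding XZ by (simp add: sumI w_def sum_negf)
      qed
      moreover have "(\<Sum>j=1..m. 1 / real m * ((Fx H (Y j s))\<^sup>2 + (Fy H (Y j s))\<^sup>2)) / (1 - \<tau>) \<le> T2 s / (1 - \<tau>)"
        unfolding T2_def
      proof (intro divide_right_mono sum_mono mult_left_mono)
        fix j assume "j \<in> {1..m}"
        from gradient_bound[OF sq[OF Inr[OF this]] \<tau>(1), of H]
        show "(Fx H (Y j s))\<^sup>2 + (Fy H (Y j s))\<^sup>2 \<le> R j s"
          unfolding XZ R_def K_def H_def by (simp add: mult.assoc)
      qed (use \<tau> in auto)
      ultimately show ?thesis using False by simp
    qed
  qed
  have iB: "integrable M (\<lambda>s. 32 * (real N)\<^sup>2 * indicator (bad Q \<delta>) s)"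
    by (intro integrable_mult_right integrable_real_indicator) (auto simp: emeasure_eq_measure)
  have combine: "e \<le> W \<Longrightarrow> e = u - t - v \<Longrightarrow> t \<le> t' \<Longrightarrow> v \<le> v' \<Longrightarrow> r = u - t' \<Longrightarrow> r - v' \<le> W"
    for e W u t t' v v' r :: real
    by linarith
  have "expectation (\<lambda>s. 2 * T1 s - T2 s / (1 - \<tau>) - 32 * (real N)\<^sup>2 * indicator (bad Q \<delta>) s) \<le> expectation Wf"
    by (rule integral_mono_AE[OF _ iW ae]) (intro Bochner_Integration.integrable_diff integrable_mult_right integrable_divide iT1 iT2 iB)
  moreover have "expectation (\<lambda>s. 2 * T1 s - T2 s / (1 - \<tau>) - 32 * (real N)\<^sup>2 * indicator (bad Q \<delta>) s)
    = 2 * (S * L * mass) - expectation T2 / (1 - \<tau>) - 32 * (real N)\<^sup>2 * prob (bad Q \<delta>)"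
    using iT1 iT2 iB by (simp add: ET1)
  moreover have "expectation T2 / (1 - \<tau>) \<le> ((1 + \<tau>) * (S * L) + K * (L\<^sup>2 / (real m)\<^sup>2 + 4 * S)) / (1 - \<tau>)"
    using ET2 \<tau> by (intro divide_right_mono) auto
  moreover have "32 * (real N)\<^sup>2 * prob (bad Q \<delta>) \<le> 32 * (real N)\<^sup>2 * (18 * (real Q + 1)\<^sup>2 * exp (- (real n * \<delta>\<^sup>2 / (32 * (real N)\<^sup>2))))"
    using prob_bad_le[OF n0(1) wn S2 \<delta>0(1,2) NQ(1)] by (intro mult_left_mono) auto
  moreover have "S * L * (2 * mass - (1 + \<tau>) / (1 - \<tau>)) - K / (1 - \<tau>) * (L\<^sup>2 / (real m)\<^sup>2 + 4 * S)
     = 2 * (S * L * mass) - ((1 + \<tau>) * (S * L) + K * (L\<^sup>2 / (real m)\<^sup>2 + 4 * S)) / (1 - \<tau>)"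
    by (simp add: add_divide_distrib algebra_simps)
  ultimately show ?thesis
    unfolding Wf_def[symmetric] K_def[symmetric] L_def[symmetric] S_def[symmetric] by (rule combine)
qed

text \<open>Dividing by the logarithm in \<open>N\<close> serves two errors:
  \<open>N\<^sup>2 / n\<close> tends to zero, which controls the self-interactions, and the exponent
  is at least a multiple of the squared logarithm, which beats all powers of \<open>n\<close>. The
  price is an iterated logarithm in \<open>ln N\<close>.\<close>

lemma truncation_asymptotics:
  fixes \<tau> \<delta> K \<epsilon> :: real
  assumes \<delta>: "0 < \<delta>" and K: "0 \<le> K" and \<tau>: "1 - \<epsilon> < 1 - 5 * \<tau>" "5 * \<tau> < 1" "0 < \<tau>"
  shows "eventually (\<lambda>n :: nat. let N = nat \<lfloor>sqrt (real n) / ln (real n)\<rfloor>; Q = n\<^sup>2 in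
     1 \<le> N \<and> 1 \<le> Q \<and> 32 * pi * real N ^ 3 / real Q \<le> \<delta> \<and>
     ln (real n) / (4 * pi) * (1 - \<epsilon>) \<le> green_sum N * (1 - 5 * \<tau> - 4 * K * ((real N)\<^sup>2 / real n)) - 4 * K
       - real n * (32 * (real N)\<^sup>2 * (18 * (real Q + 1)\<^sup>2 * exp (- (real n * \<delta>\<^sup>2 / (32 * (real N)\<^sup>2)))))) sequentially"
proof -
  define c where "c = \<delta>\<^sup>2 / 32"
  have c0: "0 < c" using \<delta> by (simp add: c_def)
  have l1: "((\<lambda>n::nat. (pi / 2 * (ln (real n) / 2 - ln (ln (real n))) - 3) / pi\<^sup>2 / ln (real n)) \<longlongrightarrow> 1 / (4 * pi)) sequentially"
  proof -
    have "((\<lambda>n::nat. (ln (real n) / 2 - ln (ln (real n))) / ln (real n)) \<longlongrightarrow> 1 / 2) sequentially"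
      by real_asymp
    moreover have "((\<lambda>n::nat. 1 / ln (real n)) \<longlongrightarrow> 0) sequentially" by real_asymp
    ultimately have "((\<lambda>n::nat. 1 / (2 * pi) * ((ln (real n) / 2 - ln (ln (real n))) / ln (real n)) - 3 / pi\<^sup>2 * (1 / ln (real n)))
        \<longlongrightarrow> 1 / (2 * pi) * (1 / 2) - 3 / pi\<^sup>2 * 0) sequentially"
      by (intro tendsto_diff tendsto_mult tendsto_const)
    moreover have "1 / (2 * pi) * (x / l) - 3 / pi\<^sup>2 * (1 / l) = (pi / 2 * x - 3) / pi\<^sup>2 / l" for x l :: real
      by (simp add: diff_divide_distrib power2_eq_square)
    ultimately show ?thesis by simp
  qed
  have l2: "((\<lambda>n::nat. 1 / (ln (real n))\<^sup>2) \<longlongrightarrow> 0) sequentially" by real_asymp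
  have l3: "((\<lambda>n::nat. 1 / ln (real n)) \<longlongrightarrow> 0) sequentially" by real_asymp
  have l4: "((\<lambda>n::nat. real n * (32 * real n * (18 * (real n ^ 2 + 1)\<^sup>2 * exp (- (c * (ln (real n))\<^sup>2))))) \<longlongrightarrow> 0) sequentially"
    using c0 by real_asymp
  \<comment> \<open>The Lipschitz constant is at most of order \<open>n\<close> to the power
    \<open>3 / 2\<close>, so a mesh of \<open>1 / n\<^sup>2\<close> is fine enough.\<close>
  have l5: "((\<lambda>n::nat. 32 * pi * (sqrt (real n)) ^ 3 / (real n)\<^sup>2) \<longlongrightarrow> 0) sequentially"
    by real_asymp
  \<comment> \<open>The right-hand side divided by \<open>ln n\<close>, with \<open>N\<close> and
    \<open>green_sum N\<close> replaced by bounds explicit in \<open>n\<close>; its limit is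
    \<open>(1 - 5 * \<tau>) / (4 * pi)\<close>.\<close>
  let ?low = "\<lambda>n::nat. (pi / 2 * (ln (real n) / 2 - ln (ln (real n))) - 3) / pi\<^sup>2 / ln (real n) * (1 - 5 * \<tau> - 4 * K * (1 / (ln (real n))\<^sup>2))
     - 4 * K * (1 / ln (real n)) - real n * (32 * real n * (18 * (real n ^ 2 + 1)\<^sup>2 * exp (- (c * (ln (real n))\<^sup>2)))) * (1 / ln (real n))"
  have "(?low \<longlongrightarrow> 1 / (4 * pi) * (1 - 5 * \<tau> - 4 * K * 0) - 4 * K * 0 - 0 * 0) sequentially"
    by (intro tendsto_intros l1 l2 l3 l4)
  moreover have "1 / (4 * pi) * (1 - \<epsilon>) < 1 / (4 * pi) * (1 - 5 * \<tau> - 4 * K * 0) - 4 * K * 0 - 0 * 0"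
    using \<tau> by (simp add: divide_strict_right_mono)
  ultimately have e1: "eventually (\<lambda>n. 1 / (4 * pi) * (1 - \<epsilon>) < ?low n) sequentially"
    by (rule order_tendstoD(1))
  have "((\<lambda>n::nat. 1 - 5 * \<tau> - 4 * K * (1 / (ln (real n))\<^sup>2)) \<longlongrightarrow> 1 - 5 * \<tau> - 4 * K * 0) sequentially"
    by (intro tendsto_intros l2)
  then have e2: "eventually (\<lambda>n::nat. 0 < 1 - 5 * \<tau> - 4 * K * (1 / (ln (real n))\<^sup>2)) sequentially"
    using \<tau> by (intro order_tendstoD(1)[of _ "1 - 5 * \<tau> - 4 * K * 0"]) auto
  have e3: "eventually (\<lambda>n::nat. 32 * pi * (sqrt (real n)) ^ 3 / (real n)\<^sup>2 < \<delta>) sequentially"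
    using l5 \<delta> by (rule order_tendstoD(2))
  have e4: "eventually (\<lambda>n::nat. 1 \<le> sqrt (real n) / ln (real n)) sequentially" by real_asymp
  have e5: "eventually (\<lambda>n::nat. 1 \<le> ln (real n)) sequentially" by real_asymp
  from e1 e2 e3 e4 e5 eventually_ge_at_top[of 1] show ?thesis
  proof eventually_elim
    case (elim n)
    define N where "N = nat \<lfloor>sqrt (real n) / ln (real n)\<rfloor>"
    define l where "l = ln (real n)"
    have l: "1 \<le> l" and n: "1 \<le> real n" using elim by (auto simp: l_def)
    have N: "real N \<le> sqrt (real n) / l" "sqrt (real n) / l < real N + 1" "1 \<le> N"
      using elim(4) unfolding N_def l_def by (auto simp: le_nat_iff le_floor_iff)
    have N1: "1 \<le> real N" using N(3) by simp
    have Nsq: "(real N)\<^sup>2 \<le> real n / l\<^sup>2"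
      using power_mono[OF N(1), of 2] n by (simp add: power_divide)
    have Nn: "(real N)\<^sup>2 / real n \<le> 1 / l\<^sup>2" using divide_right_mono[OF Nsq, of "real n"] n by simp
    have "1 \<le> l\<^sup>2" using l by (rule one_le_power)
    have Nn': "(real N)\<^sup>2 \<le> real n"
    proof -
      have "real n / l\<^sup>2 \<le> real n / 1" using \<open>1 \<le> l\<^sup>2\<close> n by (intro divide_left_mono) auto
      then show ?thesis using Nsq by linarith
    qed
    have "real N \<le> sqrt (real n)" using Nn' by (rule real_le_rsqrt)
    then have "32 * pi * real N ^ 3 / real (n\<^sup>2) \<le> 32 * pi * (sqrt (real n)) ^ 3 / (real n)\<^sup>2"
      unfolding of_nat_power by (intro divide_right_mono mult_left_mono power_mono) auto
    then have r3: "32 * pi * real N ^ 3 / real (n\<^sup>2) \<le> \<delta>" using elim(3) by linarith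
    \<comment> \<open>The \<open>N + 1\<close> in \<open>green_sum_ge\<close> absorbs the rounding
      in the definition of \<open>N\<close>.\<close>
    have "l / 2 - ln l \<le> ln (real N + 1)"
    proof -
      have "l / 2 - ln l = ln (sqrt (real n) / l)" using l n by (simp add: ln_div ln_sqrt l_def)
      also have "\<dots> \<le> ln (real N + 1)" using N l n by (intro ln_mono) auto
      finally show ?thesis .
    qed
    then have "(pi / 2 * (l / 2 - ln l) - 3) / pi\<^sup>2 \<le> (pi / 2 * ln (real N + 1) - 3) / pi\<^sup>2"
      by (intro divide_right_mono diff_right_mono mult_left_mono) auto
    also have "\<dots> \<le> green_sum N" by (rule green_sum_ge)
    finally have G: "(pi / 2 * (l / 2 - ln l) - 3) / pi\<^sup>2 \<le> green_sum N" .
    \<comment> \<open>The lower bound on \<open>green_sum N\<close> may only be multiplied by a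
      nonnegative factor, which holds for large \<open>n\<close>.\<close>
    have pos: "0 \<le> 1 - 5 * \<tau> - 4 * K * (1 / l\<^sup>2)" using elim(2) by (simp add: l_def)
    have t1: "(pi / 2 * (l / 2 - ln l) - 3) / pi\<^sup>2 * (1 - 5 * \<tau> - 4 * K * (1 / l\<^sup>2))
        \<le> green_sum N * (1 - 5 * \<tau> - 4 * K * ((real N)\<^sup>2 / real n))"
    proof (rule order_trans)
      show "(pi / 2 * (l / 2 - ln l) - 3) / pi\<^sup>2 * (1 - 5 * \<tau> - 4 * K * (1 / l\<^sup>2)) \<le> green_sum N * (1 - 5 * \<tau> - 4 * K * (1 / l\<^sup>2))"
        by (intro mult_right_mono G pos)
      show "green_sum N * (1 - 5 * \<tau> - 4 * K * (1 / l\<^sup>2)) \<le> green_sum N * (1 - 5 * \<tau> - 4 * K * ((real N)\<^sup>2 / real n))"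
        using Nn K by (intro mult_left_mono diff_left_mono green_sum_nonneg) auto
    qed
    have t2: "real n * (32 * (real N)\<^sup>2 * (18 * (real (n\<^sup>2) + 1)\<^sup>2 * exp (- (real n * \<delta>\<^sup>2 / (32 * (real N)\<^sup>2)))))
       \<le> real n * (32 * real n * (18 * (real n ^ 2 + 1)\<^sup>2 * exp (- (c * l\<^sup>2))))"
    proof -
      have "l\<^sup>2 \<le> real n / (real N)\<^sup>2"
      proof -
        have "(real N)\<^sup>2 * l\<^sup>2 \<le> real n" using Nsq \<open>1 \<le> l\<^sup>2\<close> by (simp add: le_divide_eq split: if_splits)
        then show ?thesis using N1 by (simp add: le_divide_eq mult.commute)
      qed
      then have "c * l\<^sup>2 \<le> c * (real n / (real N)\<^sup>2)" using c0 by (intro mult_left_mono) auto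
      also have "\<dots> = real n * \<delta>\<^sup>2 / (32 * (real N)\<^sup>2)" by (simp add: c_def)
      finally show ?thesis using Nn' by (intro mult_left_mono mult_mono) auto
    qed
    have "1 / (4 * pi) * (1 - \<epsilon>) * l \<le> (?low n) * l"
      using elim(1) l by (intro mult_right_mono) auto
    also have "\<dots> = (pi / 2 * (l / 2 - ln l) - 3) / pi\<^sup>2 * (1 - 5 * \<tau> - 4 * K * (1 / l\<^sup>2)) - 4 * K
       - real n * (32 * real n * (18 * (real n ^ 2 + 1)\<^sup>2 * exp (- (c * l\<^sup>2))))"
    proof -
      have "(u / l * v - x * (1 / l) - y * (1 / l)) * l = u * v - x - y" for u v x y
        using l by (simp add: field_simps)
      then show ?thesis unfolding l_def[symmetric] by blast
    qed
    finally have "l / (4 * pi) * (1 - \<epsilon>) \<le> green_sum N * (1 - 5 * \<tau> - 4 * K * ((real N)\<^sup>2 / real n)) - 4 * K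
       - real n * (32 * (real N)\<^sup>2 * (18 * (real (n\<^sup>2) + 1)\<^sup>2 * exp (- (real n * \<delta>\<^sup>2 / (32 * (real N)\<^sup>2)))))"
      using t1 t2 by (simp add: mult_ac)
    moreover have "1 \<le> n\<^sup>2" using elim by simp
    ultimately show ?case
      using N(3) r3 unfolding Let_def N_def[symmetric] unfolding l_def[symmetric] by blast
  qed
qed

text \<open>
  The least admissible error is taken as the rate; the constant \<open>2\<close> is always admissible.
\<close>

lemma exists_rate_function:
  fixes R a :: "nat \<Rightarrow> nat \<Rightarrow> real" and b :: "nat \<Rightarrow> real"
  assumes b: "\<And>n. 1 \<le> n \<Longrightarrow> 0 \<le> b n" and R: "\<And>n m. 0 \<le> R n m" and a: "\<And>n m. a n m \<le> 2"
    and ev: "\<And>\<epsilon>. 0 < \<epsilon> \<Longrightarrow> eventually (\<lambda>n. \<forall>m\<ge>n. b n * (a n m - \<epsilon>) \<le> R n m) sequentially"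
  shows "\<exists>\<omega>. rate_function \<omega> \<and> (\<forall>n m. 1 \<le> n \<and> n \<le> m \<longrightarrow> b n * (a n m - \<omega> (real n)) \<le> R n m)"
proof -
  \<comment> \<open>The range \<open>{0..2}\<close> keeps the infimum nonnegative. Demanding
    admissibility for all sample sizes from \<open>t\<close> on makes \<open>G\<close> grow with
    \<open>t\<close>, so its infimum decreases.\<close>
  define G where "G = (\<lambda>t::real. {\<epsilon>\<in>{0..2}. \<forall>n m. 1 \<le> n \<and> t \<le> real n \<and> n \<le> m \<longrightarrow> b n * (a n m - \<epsilon>) \<le> R n m})"
  have G2: "2 \<in> G t" for t
  proof -
    have "b n * (a n m - 2) \<le> R n m" if "1 \<le> n" for n m
      using mult_nonneg_nonpos[OF b[OF that], of "a n m - 2"] a[of n m] R[of n m] by linarith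
    then show ?thesis by (auto simp: G_def)
  qed
  have bdd: "bdd_below (G t)" for t by (rule bdd_belowI[of _ 0]) (auto simp: G_def)
  define \<omega> where "\<omega> = (\<lambda>t. Inf (G t))"
  have \<omega>0: "0 \<le> \<omega> t" for t unfolding \<omega>_def using G2 by (intro cInf_greatest) (auto simp: G_def)
  have mono: "\<omega> t \<le> \<omega> s" if "s \<le> t" for s t
    unfolding \<omega>_def
  proof (rule cInf_superset_mono)
    show "G s \<subseteq> G t" using that by (auto simp: G_def)
    show "G s \<noteq> {}" using G2 by blast
  qed (rule bdd)
  have lim: "(\<omega> \<longlongrightarrow> 0) at_top"
  proof (rule order_tendstoI)
    fix e :: real assume "e < 0"
    then show "\<forall>\<^sub>F x in at_top. e < \<omega> x" using \<omega>0 by (intro always_eventually allI) (rule less_le_trans)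
  next
    fix e :: real assume e: "0 < e"
    define d where "d = min (e / 2) 2"
    have d: "0 < d" "d < e" "d \<le> 2" using e by (auto simp: d_def)
    obtain n0 where n0: "\<And>n m. n0 \<le> n \<Longrightarrow> n \<le> m \<Longrightarrow> b n * (a n m - d) \<le> R n m"
      using ev[OF d(1)] unfolding eventually_sequentially by blast
    have "\<omega> x < e" if "real n0 \<le> x" for x
    proof -
      have "d \<in> G x" using d n0 that by (auto simp: G_def)
      then have "\<omega> x \<le> d" unfolding \<omega>_def by (intro cInf_lower bdd)
      then show ?thesis using d by linarith
    qed
    then show "\<forall>\<^sub>F x in at_top. \<omega> x < e" by (auto simp: eventually_at_top_linorder)
  qed
  have "b n * (a n m - \<omega> (real n)) \<le> R n m" if nm: "1 \<le> n" "n \<le> m" for n m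
  \<comment> \<open>Admissibility is linear in the error and thus passes to the infimum after
    division by \<open>b n\<close>. The case \<open>b n = 0\<close>, which includes
    \<open>n = 1\<close> in the application, is settled by nonnegativity of the cost.\<close>
  proof (cases "b n = 0")
    case False
    then have b0: "0 < b n" using b[OF nm(1)] by linarith
    have "a n m - R n m / b n \<le> \<omega> (real n)"
      unfolding \<omega>_def
    proof (rule cInf_greatest)
      show "G (real n) \<noteq> {}" using G2 by blast
      fix \<epsilon> assume "\<epsilon> \<in> G (real n)"
      then have "b n * (a n m - \<epsilon>) \<le> R n m" using nm by (auto simp: G_def)
      then have "a n m - \<epsilon> \<le> R n m / b n" using b0 by (simp add: le_divide_eq mult.commute)
      then show "a n m - R n m / b n \<le> \<epsilon>" by linarith
    qed
    then have "a n m - \<omega> (real n) \<le> R n m / b n" by linarith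
    then show ?thesis using b0 by (simp add: le_divide_eq mult.commute)
  qed (use R in simp)
  moreover have "rate_function \<omega>"
    unfolding rate_function_def using lim mono by (auto intro!: monotone_onI)
  ultimately show ?thesis by blast
qed

theorem proposition3p2:
  fixes M :: "'a measure" and X Y :: "nat \<Rightarrow> 'a \<Rightarrow> real \<times> real"
  assumes "prob_space M"
    and "prob_space.indep_vars M (\<lambda>_. borel) (case_sum X Y) ({1..} <+> {1..})"
    and "\<And>i. i \<ge> 1 \<Longrightarrow> distr M borel (X i) = uniform_measure lborel ({0<..<1} \<times> {0<..<1})"
    and "\<And>i. i \<ge> 1 \<Longrightarrow> distr M borel (Y i) = uniform_measure lborel ({0<..<1} \<times> {0<..<1})"
  shows "\<exists>\<omega>. rate_function \<omega> \<and>
    (\<forall>n m :: nat. 1 \<le> n \<and> n \<le> m \<longrightarrow>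
      prob_space.expectation M (\<lambda>s.
        (Wb ({0<..<1} \<times> {0<..<1}) 2
          (empirical_measure n (\<lambda>i. X i s)) (empirical_measure m (\<lambda>i. Y i s)))\<^sup>2)
      \<ge> ln (real n) / (4 * pi * real n) * (1 + real n / real m - \<omega> (real n)))"
proof -
  define R where "R = (\<lambda>n m. prob_space.expectation M (\<lambda>s. (Wb ({0<..<1} \<times> {0<..<1}) 2
          (empirical_measure n (\<lambda>i. X i s)) (empirical_measure m (\<lambda>i. Y i s)))\<^sup>2))"
  \<comment> \<open>The value 0 for \<open>m < n\<close> makes the bound by 2 hold for all
    pairs.\<close>
  define a where "a = (\<lambda>n m :: nat. if n \<le> m then 1 + real n / real m else 0)"
  define b where "b = (\<lambda>n :: nat. ln (real n) / (4 * pi * real n))"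
  have "\<exists>\<omega>. rate_function \<omega> \<and> (\<forall>n m. 1 \<le> n \<and> n \<le> m \<longrightarrow> b n * (a n m - \<omega> (real n)) \<le> R n m)"
  proof (rule exists_rate_function)
    show "0 \<le> b n" if "1 \<le> n" for n using that by (simp add: b_def)
    show "0 \<le> R n m" for n m by (simp add: R_def)
    show "a n m \<le> 2" for n m by (simp add: a_def divide_le_eq)
    fix \<epsilon> :: real assume \<epsilon>: "0 < \<epsilon>"
    \<comment> \<open>The second term gives \<open>5 * \<tau> < \<epsilon> / 2\<close>; the first
      keeps \<open>3 * \<tau> \<le> 1\<close> and \<open>5 * \<tau> < 1\<close>.\<close>
    define \<tau> where "\<tau> = min (1 / 10) (\<epsilon> / 20)"
    have \<tau>: "0 < \<tau>" "\<tau> \<le> 1 / 10" "\<tau> < 1" "5 * \<tau> < 1" "1 - \<epsilon> / 2 < 1 - 5 * \<tau>" using \<epsilon> by (auto simp: \<tau>_def)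
    obtain \<psi> \<psi>' \<psi>'' C where c: "cutoff \<psi> \<psi>' \<psi>'' C" and mass: "1 - \<tau> \<le> cutoff.mass \<psi>"
      using exists_cutoff_mass[OF \<tau>(1,3)] by blast
    have C: "1 \<le> C" using c by (simp add: cutoff_def)
    define K where "K = (1 + 1 / \<tau>) * (2 * C\<^sup>2) / (1 - \<tau>)"
    define \<delta> where "\<delta> = \<tau> / (16 * C\<^sup>2)"
    have K0: "0 \<le> K" and \<delta>0: "0 < \<delta>" using \<tau> C by (auto simp: K_def \<delta>_def)
    \<comment> \<open>The loss \<open>5 * \<tau>\<close> consists of \<open>2 * \<tau>\<close> from
      the doubled mass and \<open>3 * \<tau>\<close> from the quotient.\<close>
    have coef: "1 - 5 * \<tau> \<le> 2 * cutoff.mass \<psi> - (1 + \<tau>) / (1 - \<tau>)"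
    proof -
      have "(1 + \<tau>) / (1 - \<tau>) \<le> 1 + 3 * \<tau>"
      proof -
        have "0 \<le> \<tau> * (1 - 3 * \<tau>)" using \<tau> by simp
        then have "1 + \<tau> \<le> (1 + 3 * \<tau>) * (1 - \<tau>)" by (simp add: algebra_simps)
        then show ?thesis using \<tau> by (simp add: divide_le_eq)
      qed
      then show ?thesis using mass by linarith
    qed
    from truncation_asymptotics[OF \<delta>0 K0 \<tau>(5,4,1)] eventually_ge_at_top[of 1]
    show "eventually (\<lambda>n. \<forall>m\<ge>n. b n * (a n m - \<epsilon>) \<le> R n m) sequentially"
    proof eventually_elim
      case (elim n)
      define N Q where "N = nat \<lfloor>sqrt (real n) / ln (real n)\<rfloor>" and "Q = n\<^sup>2"
      define P where "P = 32 * (real N)\<^sup>2 * (18 * (real Q + 1)\<^sup>2 * exp (- (real n * \<delta>\<^sup>2 / (32 * (real N)\<^sup>2))))"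
      define L where "L = green_sum N"
      have N: "1 \<le> N" "1 \<le> Q" "32 * pi * real N ^ 3 / real Q \<le> \<delta>"
        and main: "ln (real n) / (4 * pi) * (1 - \<epsilon> / 2) \<le> L * (1 - 5 * \<tau> - 4 * K * ((real N)\<^sup>2 / real n)) - 4 * K - real n * P"
        using elim(1) unfolding Let_def N_def[symmetric] Q_def[symmetric] P_def[symmetric] L_def[symmetric] by blast+
      have P0: "0 \<le> P" by (simp add: P_def)
      have L0: "0 \<le> L" "L \<le> 4 * (real N)\<^sup>2" by (simp_all add: L_def green_sum_nonneg green_sum_le)
      show ?case
      proof (intro allI impI)
        fix m assume m: "n \<le> m"
        have n0: "0 < real n" "0 < real m" "real n \<le> real m" using elim(2) m by auto
        define S where "S = 1 / real n + 1 / real m"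
        have S: "1 / real n \<le> S" "1 / real m \<le> S" "0 \<le> S" using n0 by (auto simp: S_def)
        \<comment> \<open>One factor \<open>L\<close> is traded for its crude bound
          \<open>4 * N\<^sup>2\<close>, and \<open>n \<le> m\<close> turns the other quotient into
          \<open>N\<^sup>2 / n\<close>. The squared self-interaction becomes a vanishing fraction of
          the main term, uniformly in \<open>m\<close>.\<close>
        have q: "L\<^sup>2 / (real m)\<^sup>2 \<le> S * (L * (4 * ((real N)\<^sup>2 / real n)))"
        proof -
          have "L\<^sup>2 / (real m)\<^sup>2 = (1 / real m) * (L * (L / real m))" by (simp add: power2_eq_square)
          also have "\<dots> \<le> S * (L * (4 * (real N)\<^sup>2 / real n))"
          proof (intro mult_mono mult_left_mono)
            show "L / real m \<le> 4 * (real N)\<^sup>2 / real n" using L0 n0 by (intro frac_le) auto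
          qed (use S L0 in auto)
          finally show ?thesis by simp
        qed
        have p: "P \<le> S * (real n * P)"
        proof -
          have "1 / real n * (real n * P) \<le> S * (real n * P)" using S P0 by (intro mult_right_mono) auto
          then show ?thesis using n0 by simp
        qed
        have "S * (ln (real n) / (4 * pi) * (1 - \<epsilon> / 2)) \<le> S * (L * (1 - 5 * \<tau> - 4 * K * ((real N)\<^sup>2 / real n)) - 4 * K - real n * P)"
          using main S by (intro mult_left_mono) auto
        also have "\<dots> = S * L * (1 - 5 * \<tau>) - K * (S * (L * (4 * ((real N)\<^sup>2 / real n))) + 4 * S) - S * (real n * P)"
          by (simp add: algebra_simps)
        also have "\<dots> \<le> S * L * (2 * cutoff.mass \<psi> - (1 + \<tau>) / (1 - \<tau>)) - K * (L\<^sup>2 / (real m)\<^sup>2 + 4 * S) - P"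
        proof (intro diff_mono p)
          show "S * L * (1 - 5 * \<tau>) \<le> S * L * (2 * cutoff.mass \<psi> - (1 + \<tau>) / (1 - \<tau>))"
            using S L0 by (intro mult_left_mono coef) auto
          show "K * (L\<^sup>2 / (real m)\<^sup>2 + 4 * S) \<le> K * (S * (L * (4 * ((real N)\<^sup>2 / real n))) + 4 * S)"
            using q K0 by (intro mult_left_mono add_right_mono) auto
        qed
        also have "\<dots> \<le> R n m"
          using expectation_Wb_ge[OF assms elim(2) m N(1,2) c \<tau>(1,3) \<delta>_def N(3)]
          unfolding R_def S_def L_def K_def P_def by simp
        finally have 1: "S * (ln (real n) / (4 * pi) * (1 - \<epsilon> / 2)) \<le> R n m" .
        have an: "a n m = real n * S" "a n m \<le> 2" using n0 m by (auto simp: a_def S_def distrib_left divide_le_eq)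
        \<comment> \<open>As \<open>a n m \<le> 2\<close>, a relative loss of
          \<open>\<epsilon> / 2\<close> costs at most \<open>\<epsilon>\<close> in absolute terms,
          whatever \<open>m\<close> is.\<close>
        have "b n * (a n m - \<epsilon>) \<le> b n * (a n m * (1 - \<epsilon> / 2))"
          using an(2) \<epsilon> elim(2) by (intro mult_left_mono) (auto simp: b_def algebra_simps)
        also have "\<dots> = S * (ln (real n) / (4 * pi) * (1 - \<epsilon> / 2))"
          using n0 by (simp add: an b_def)
        finally show "b n * (a n m - \<epsilon>) \<le> R n m" using 1 by linarith
      qed
    qed
  qed
  then obtain \<omega> where \<omega>: "rate_function \<omega>" "\<And>n m. 1 \<le> n \<Longrightarrow> n \<le> m \<Longrightarrow> b n * (a n m - \<omega> (real n)) \<le> R n m"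
    by blast
  have "b n * (1 + real n / real m - \<omega> (real n)) \<le> R n m" if "1 \<le> n" "n \<le> m" for n m
    using \<omega>(2)[OF that] that by (simp add: a_def)
  then show ?thesis using \<omega>(1) unfolding b_def R_def by blast
qed

end
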